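(* Let $G$ be a discrete group, $p$ a prime, and $\mathcal E$ the collection of all nontrivial elementary abelian $p$-subgroups of $G$. Let $X=X^\alpha_{\mathcal E}$ be the Dwyer space for the centralizer decomposition of $G$ over $\mathcal E$. Then for every nontrivial finite $p$-subgroup $P\le G$, the fixed point subspace $X^P$ and the orbit space $C_G(P)\backslash X^P$ are contractible.
   Context: The $\mathcal E$-conjugacy category $\mathcal A_{\mathcal E}(G)$ has as objects the pairs $(H,[i])$ where $H$ is a group and $[i]$ is a $G$-conjugacy class of monomorphisms $i:H\to G$ with $i(H)\in\mathcal E$ ($g\in G$ acts by $g\cdot i=c_g\circ i$, $c_g(x)=gxg^{-1}$). A morphism $(H,[i])\to(H',[i'])$ is a homomorphism $f:H\to H'$ with $[i]=[i'\circ f]$. (Replace it by an equivalent small category when needed.) Let $\widetilde\alpha:\mathcal A_{\mathcal E}(G)^{op}\to G\text{-Sets}$ send $(H,[i])$ to the $G$-set $[i]$ $(\cong G/C_G(i(H)))$. The Dwyer space is the $G$-space $X^\alpha_{\mathcal E}=\mathrm{hocolim}_{\mathcal A_{\mathcal E}(G)^{op}}\widetilde\alpha$. Its realization is $G$-homeomorphic to the realization of the nerve of the category whose objects are pairs $(H,i)$ with $H$ a group and $i:H\to G$ a monomorphism with $i(H)\in\mathcal E$, with a unique morphism $(H,i)\to(H',i')$ if there is a homomorphism $f:H\to H'$ with $i=i'\circ f$ (and none otherwise), $G$ acting by $g\cdot(H,i)=(H,c_g\circ i)$. Contractibility refers to geometric realizations. *)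

theory Defs
  imports
    "HOL-Homology.Simplices"
    "HOL-Algebra.Group_Action"
    "HOL-Computational_Algebra.Primes"
begin

section \<open>Quotient and orbit spaces\<close>

definition quotient_topology :: "'a topology \<Rightarrow> ('a \<Rightarrow> 'b) \<Rightarrow> 'b topology" where
  "quotient_topology X q =
     topology (\<lambda>V. V \<subseteq> q ` topspace X \<and> openin X {x \<in> topspace X. q x \<in> V})"

lemma openin_quotient_topology:
  "openin (quotient_topology X q) V \<longleftrightarrow>
     V \<subseteq> q ` topspace X \<and> openin X {x \<in> topspace X. q x \<in> V}"
proof -
  have "istopology (\<lambda>V. V \<subseteq> q ` topspace X \<and> openin X {x \<in> topspace X. q x \<in> V})"
    unfolding istopology_def
  proof (intro conjI allI impI)
    fix S T
    assume S: "S \<subseteq> q ` topspace X \<and> openin X {x \<in> topspace X. q x \<in> S}"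
      and T: "T \<subseteq> q ` topspace X \<and> openin X {x \<in> topspace X. q x \<in> T}"
    have "{x \<in> topspace X. q x \<in> S \<inter> T} =
          {x \<in> topspace X. q x \<in> S} \<inter> {x \<in> topspace X. q x \<in> T}" by blast
    with S T show "openin X {x \<in> topspace X. q x \<in> S \<inter> T}" by auto
    show "S \<inter> T \<subseteq> q ` topspace X" using S by blast
  next
    fix K
    assume K: "\<forall>S\<in>K. S \<subseteq> q ` topspace X \<and> openin X {x \<in> topspace X. q x \<in> S}"
    have "{x \<in> topspace X. q x \<in> \<Union>K} = (\<Union>S\<in>K. {x \<in> topspace X. q x \<in> S})" by blast
    with K show "openin X {x \<in> topspace X. q x \<in> \<Union>K}" by auto
    show "\<Union>K \<subseteq> q ` topspace X" using K by blast
  qed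
  then show ?thesis
    unfolding quotient_topology_def by (simp add: topology_inverse')
qed

lemma topspace_quotient_topology [simp]:
  "topspace (quotient_topology X q) = q ` topspace X"
proof -
  have "{x \<in> topspace X. q x \<in> q ` topspace X} = topspace X" by blast
  then have "openin (quotient_topology X q) (q ` topspace X)"
    by (simp add: openin_quotient_topology)
  then show ?thesis
    by (metis openin_quotient_topology openin_subset openin_topspace subset_antisym)
qed

lemma quotient_map_quotient_topology: "quotient_map X (quotient_topology X q) q"
  by (auto simp: quotient_map_def openin_quotient_topology)

definition orbit_space ::
    "('g, 'b) monoid_scheme \<Rightarrow> ('g \<Rightarrow> 'x \<Rightarrow> 'x) \<Rightarrow> 'x topology \<Rightarrow> 'x set topology" where
  "orbit_space K \<phi> X = quotient_topology X (orbit K \<phi>)"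

definition fixed_point_space :: "'g set \<Rightarrow> ('g \<Rightarrow> 'x \<Rightarrow> 'x) \<Rightarrow> 'x topology \<Rightarrow> 'x topology" where
  "fixed_point_space P \<phi> X = subtopology X {x \<in> topspace X. \<forall>g\<in>P. x \<in> invariants (topspace X) \<phi> g}"

text \<open>The library predicate \<^const>\<open>contractible_space\<close> holds of the empty space.\<close>

definition nonempty_contractible :: "'x topology \<Rightarrow> bool" where
  "nonempty_contractible X \<longleftrightarrow> topspace X \<noteq> {} \<and> contractible_space X"


section \<open>Simplicial \<open>G\<close>-sets and geometric realization\<close>

text \<open>
  \<open>pull X m n \<theta> : X\<^sub>n \<rightarrow> X\<^sub>m\<close> is the structure map of a simplicial set along a monotone map
  \<open>\<theta> : {0..m} \<rightarrow> {0..n}\<close>. Values of \<open>\<theta>\<close> above \<open>m\<close> are irrelevant.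
\<close>

definition simplicial_ops :: "nat \<Rightarrow> nat \<Rightarrow> (nat \<Rightarrow> nat) set" where
  "simplicial_ops m n = {\<theta> \<in> {..m} \<rightarrow> {..n}. mono_on {..m} \<theta>}"

record 's sset =
  simplices :: "nat \<Rightarrow> 's set"
  pull :: "nat \<Rightarrow> nat \<Rightarrow> (nat \<Rightarrow> nat) \<Rightarrow> 's \<Rightarrow> 's"

record ('g, 's) gsset = "'s sset" +
  sact :: "nat \<Rightarrow> 'g \<Rightarrow> 's \<Rightarrow> 's"

locale simplicial_gset =
  fixes G :: "('g, 'b) monoid_scheme" and X :: "('g, 's) gsset"
  assumes pull_closed: "\<lbrakk>\<theta> \<in> simplicial_ops m n; x \<in> simplices X n\<rbrakk> \<Longrightarrow> pull X m n \<theta> x \<in> simplices X m"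
    and pull_cong: "\<lbrakk>\<theta> \<in> simplicial_ops m n; \<And>i. i \<le> m \<Longrightarrow> \<theta> i = \<theta>' i; x \<in> simplices X n\<rbrakk>
      \<Longrightarrow> pull X m n \<theta> x = pull X m n \<theta>' x"
    and pull_id: "x \<in> simplices X n \<Longrightarrow> pull X n n id x = x"
    and pull_comp: "\<lbrakk>\<theta> \<in> simplicial_ops l m; \<theta>' \<in> simplicial_ops m n; x \<in> simplices X n\<rbrakk>
      \<Longrightarrow> pull X l m \<theta> (pull X m n \<theta>' x) = pull X l n (\<theta>' \<circ> \<theta>) x"
    and sact: "group_action G (simplices X n) (sact X n)"
    and pull_sact: "\<lbrakk>\<theta> \<in> simplicial_ops m n; g \<in> carrier G; x \<in> simplices X n\<rbrakk>
      \<Longrightarrow> pull X m n \<theta> (sact X n g x) = sact X m g (pull X m n \<theta> x)"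

definition push_simplex :: "nat \<Rightarrow> (nat \<Rightarrow> nat) \<Rightarrow> (nat \<Rightarrow> real) \<Rightarrow> nat \<Rightarrow> real" where
  "push_simplex m \<theta> t = (\<lambda>j. \<Sum>i | i \<le> m \<and> \<theta> i = j. t i)"

definition simplex_space :: "('s, 'z) sset_scheme \<Rightarrow> ((nat \<times> 's) \<times> (nat \<Rightarrow> real)) topology" where
  "simplex_space X =
     sum_topology (\<lambda>(n, x). subtopology (powertop_real UNIV) (standard_simplex n))
       (SIGMA n:UNIV. simplices X n)"

definition simplex_glue ::
    "('s, 'z) sset_scheme \<Rightarrow> (((nat \<times> 's) \<times> (nat \<Rightarrow> real)) \<times> ((nat \<times> 's) \<times> (nat \<Rightarrow> real))) set" where
  "simplex_glue X = {(((m, pull X m n \<theta> x), t), ((n, x), push_simplex m \<theta> t)) | m n \<theta> x t.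
     \<theta> \<in> simplicial_ops m n \<and> x \<in> simplices X n \<and> t \<in> standard_simplex m}"

definition simplex_class ::
    "('s, 'z) sset_scheme \<Rightarrow> (nat \<times> 's) \<times> (nat \<Rightarrow> real) \<Rightarrow> ((nat \<times> 's) \<times> (nat \<Rightarrow> real)) set" where
  "simplex_class X z = (simplex_glue X \<union> (simplex_glue X)\<inverse>)\<^sup>* `` {z}"

definition realization ::
    "('s, 'z) sset_scheme \<Rightarrow> ((nat \<times> 's) \<times> (nat \<Rightarrow> real)) set topology" where
  "realization X = quotient_topology (simplex_space X) (simplex_class X)"

definition realization_act ::
    "('g, 's) gsset \<Rightarrow> 'g \<Rightarrow> ((nat \<times> 's) \<times> (nat \<Rightarrow> real)) set \<Rightarrow> ((nat \<times> 's) \<times> (nat \<Rightarrow> real)) set" where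
  "realization_act X g = (\<lambda>A\<in>topspace (realization X). (\<lambda>((n, x), t). ((n, sact X n g x), t)) ` A)"


section \<open>Small categories, functors to \<open>G\<close>-sets and homotopy colimits\<close>

text \<open>\<open>Comp C a b c v u\<close> is the composite of \<open>u : a \<rightarrow> b\<close> and \<open>v : b \<rightarrow> c\<close>.\<close>

record ('o, 'm) cat =
  Ob :: "'o set"
  Hom :: "'o \<Rightarrow> 'o \<Rightarrow> 'm set"
  Idt :: "'o \<Rightarrow> 'm"
  Comp :: "'o \<Rightarrow> 'o \<Rightarrow> 'o \<Rightarrow> 'm \<Rightarrow> 'm \<Rightarrow> 'm"

locale small_category =
  fixes C :: "('o, 'm) cat"
  assumes Idt_in: "a \<in> Ob C \<Longrightarrow> Idt C a \<in> Hom C a a"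
    and Comp_in: "\<lbrakk>a \<in> Ob C; b \<in> Ob C; c \<in> Ob C; u \<in> Hom C a b; v \<in> Hom C b c\<rbrakk>
      \<Longrightarrow> Comp C a b c v u \<in> Hom C a c"
    and Comp_Idt_left: "\<lbrakk>a \<in> Ob C; b \<in> Ob C; u \<in> Hom C a b\<rbrakk> \<Longrightarrow> Comp C a b b (Idt C b) u = u"
    and Comp_Idt_right: "\<lbrakk>a \<in> Ob C; b \<in> Ob C; u \<in> Hom C a b\<rbrakk> \<Longrightarrow> Comp C a a b u (Idt C a) = u"
    and Comp_assoc: "\<lbrakk>a \<in> Ob C; b \<in> Ob C; c \<in> Ob C; d \<in> Ob C;
        u \<in> Hom C a b; v \<in> Hom C b c; w \<in> Hom C c d\<rbrakk>
      \<Longrightarrow> Comp C a c d w (Comp C a b c v u) = Comp C a b d (Comp C b c d w v) u"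

definition op_cat :: "('o, 'm) cat \<Rightarrow> ('o, 'm) cat" where
  "op_cat C = \<lparr>Ob = Ob C, Hom = (\<lambda>a b. Hom C b a), Idt = Idt C,
     Comp = (\<lambda>a b c v u. Comp C c b a u v)\<rparr>"

lemma op_cat_simps [simp]:
  "Ob (op_cat C) = Ob C" "Hom (op_cat C) a b = Hom C b a" "Idt (op_cat C) = Idt C"
  "Comp (op_cat C) a b c v u = Comp C c b a u v"
  by (simp_all add: op_cat_def)

lemma small_category_op: "small_category C \<Longrightarrow> small_category (op_cat C)"
  unfolding small_category_def by simp

record ('o, 'm, 'g, 'x) gset_diagram =
  dset :: "'o \<Rightarrow> 'x set"
  dact :: "'o \<Rightarrow> 'g \<Rightarrow> 'x \<Rightarrow> 'x"
  dmap :: "'o \<Rightarrow> 'o \<Rightarrow> 'm \<Rightarrow> 'x \<Rightarrow> 'x"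

locale gset_functor = small_category C
  for C :: "('o, 'm) cat" and G :: "('g, 'b) monoid_scheme" and F :: "('o, 'm, 'g, 'x) gset_diagram" +
  assumes dact: "a \<in> Ob C \<Longrightarrow> group_action G (dset F a) (dact F a)"
    and dmap_closed: "\<lbrakk>a \<in> Ob C; b \<in> Ob C; u \<in> Hom C a b; x \<in> dset F a\<rbrakk> \<Longrightarrow> dmap F a b u x \<in> dset F b"
    and dmap_dact: "\<lbrakk>a \<in> Ob C; b \<in> Ob C; u \<in> Hom C a b; x \<in> dset F a; g \<in> carrier G\<rbrakk>
      \<Longrightarrow> dmap F a b u (dact F a g x) = dact F b g (dmap F a b u x)"
    and dmap_Idt: "\<lbrakk>a \<in> Ob C; x \<in> dset F a\<rbrakk> \<Longrightarrow> dmap F a a (Idt C a) x = x"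
    and dmap_Comp: "\<lbrakk>a \<in> Ob C; b \<in> Ob C; c \<in> Ob C; u \<in> Hom C a b; v \<in> Hom C b c; x \<in> dset F a\<rbrakk>
      \<Longrightarrow> dmap F a c (Comp C a b c v u) x = dmap F b c v (dmap F a b u x)"

text \<open>
  An \<open>n\<close>-simplex of the nerve is a functor \<open>(c, u)\<close> from the ordinal \<open>{0 \<le> \<dots> \<le> n}\<close> to \<open>C\<close>: objects
  \<open>c i\<close> and morphisms \<open>u (i, j) : c i \<rightarrow> c j\<close> for \<open>i \<le> j \<le> n\<close>.
\<close>

definition ordinal_arrows :: "nat \<Rightarrow> (nat \<times> nat) set" where
  "ordinal_arrows n = {(i, j). i \<le> j \<and> j \<le> n}"

definition nerve :: "('o, 'm) cat \<Rightarrow> ((nat \<Rightarrow> 'o) \<times> (nat \<times> nat \<Rightarrow> 'm)) sset" where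
  "nerve C = \<lparr>
     simplices = (\<lambda>n. {(c, u).
        c \<in> {..n} \<rightarrow>\<^sub>E Ob C \<and>
        u \<in> (\<Pi>\<^sub>E (i, j) \<in> ordinal_arrows n. Hom C (c i) (c j)) \<and>
        (\<forall>i\<le>n. u (i, i) = Idt C (c i)) \<and>
        (\<forall>i j k. i \<le> j \<and> j \<le> k \<and> k \<le> n \<longrightarrow>
           u (i, k) = Comp C (c i) (c j) (c k) (u (j, k)) (u (i, j)))}),
     pull = (\<lambda>m n \<theta> (c, u).
        (\<lambda>i\<in>{..m}. c (\<theta> i), \<lambda>(i, j)\<in>ordinal_arrows m. u (\<theta> i, \<theta> j)))\<rparr>"

text \<open>
  Simplicial replacement: an \<open>n\<close>-simplex of the homotopy colimit of \<open>F\<close> is a chain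
  \<open>c 0 \<rightarrow> \<dots> \<rightarrow> c n\<close> in \<open>C\<close> with a point of \<open>F (c 0)\<close>, which is transported along \<open>c 0 \<rightarrow> c (\<theta> 0)\<close>
  when the initial vertex changes. For set-valued \<open>F\<close> the diagonal is not needed.
\<close>

definition hocolim :: "('o, 'm) cat \<Rightarrow> ('o, 'm, 'g, 'x) gset_diagram
    \<Rightarrow> ('g, ((nat \<Rightarrow> 'o) \<times> (nat \<times> nat \<Rightarrow> 'm)) \<times> 'x) gsset" where
  "hocolim C F = \<lparr>
     simplices = (\<lambda>n. {((c, u), x). (c, u) \<in> simplices (nerve C) n \<and> x \<in> dset F (c 0)}),
     pull = (\<lambda>m n \<theta> ((c, u), x).
        (pull (nerve C) m n \<theta> (c, u), dmap F (c 0) (c (\<theta> 0)) (u (0, \<theta> 0)) x)),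
     sact = (\<lambda>n g. \<lambda>((c, u), x)\<in>{((c, u), x). (c, u) \<in> simplices (nerve C) n \<and> x \<in> dset F (c 0)}.
        ((c, u), dact F (c 0) g x))\<rparr>"


section \<open>The conjugacy category and the Dwyer space\<close>

definition conj_map ::
    "('a, 'b) monoid_scheme \<Rightarrow> 'a monoid \<Rightarrow> 'a \<Rightarrow> ('a \<Rightarrow> 'a) \<Rightarrow> 'a \<Rightarrow> 'a" where
  "conj_map G H g i = (\<lambda>x\<in>carrier H. g \<otimes>\<^bsub>G\<^esub> i x \<otimes>\<^bsub>G\<^esub> inv\<^bsub>G\<^esub> g)"

definition conj_class ::
    "('a, 'b) monoid_scheme \<Rightarrow> 'a monoid \<Rightarrow> ('a \<Rightarrow> 'a) \<Rightarrow> ('a \<Rightarrow> 'a) set" where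
  "conj_class G H i = orbit G (conj_map G H) i"

text \<open>
  Size: \<open>H\<close> ranges over the groups whose elements lie in the underlying type of \<open>G\<close>. Every group
  embedding into \<open>G\<close> is isomorphic to such a group, so this is a small full subcategory equivalent
  to the category of all pairs \<open>(H, [i])\<close>. Maps are extensional outside the carrier of their
  source, so that equality of maps is equality on that carrier.
\<close>

definition conj_category ::
    "('a, 'b) monoid_scheme \<Rightarrow> 'a set set \<Rightarrow> ('a monoid \<times> ('a \<Rightarrow> 'a) set, 'a \<Rightarrow> 'a) cat" where
  "conj_category G \<E> = \<lparr>
     Ob = {(H, conj_class G H i) | H i.
       group H \<and> i \<in> mon H G \<and> i \<in> extensional (carrier H) \<and> i ` carrier H \<in> \<E>},
     Hom = (\<lambda>(H, I) (H', I'). {f \<in> hom H H'. f \<in> extensional (carrier H) \<and>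
       (\<exists>i\<in>I. \<exists>i'\<in>I'. conj_class G H i = conj_class G H (compose (carrier H) i' f))}),
     Idt = (\<lambda>(H, I). \<lambda>x\<in>carrier H. x),
     Comp = (\<lambda>(H, I) b c v u. compose (carrier H) v u)\<rparr>"

text \<open>
  The functor \<open>(H, [i]) \<mapsto> [i]\<close> on the opposite category: \<open>f : (H, [i]) \<rightarrow> (H', [i'])\<close> induces
  precomposition \<open>[i'] \<rightarrow> [i]\<close>.
\<close>

definition alpha_functor :: "('a, 'b) monoid_scheme
    \<Rightarrow> ('a monoid \<times> ('a \<Rightarrow> 'a) set, 'a \<Rightarrow> 'a, 'a, 'a \<Rightarrow> 'a) gset_diagram" where
  "alpha_functor G = \<lparr>
     dset = (\<lambda>(H, I). I),
     dact = (\<lambda>(H, I) g. \<lambda>j\<in>I. conj_map G H g j),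
     dmap = (\<lambda>(H', I') (H, I) f. \<lambda>j\<in>I'. compose (carrier H) j f)\<rparr>"

definition dwyer_sset where
  "dwyer_sset G \<E> = hocolim (op_cat (conj_category G \<E>)) (alpha_functor G)"

definition dwyer_space where
  "dwyer_space G \<E> = realization (dwyer_sset G \<E>)"

definition dwyer_act where
  "dwyer_act G \<E> = realization_act (dwyer_sset G \<E>)"


section \<open>Subgroups\<close>

definition centralizer :: "('a, 'b) monoid_scheme \<Rightarrow> 'a set \<Rightarrow> 'a set" where
  "centralizer G P = {g \<in> carrier G. \<forall>x\<in>P. g \<otimes>\<^bsub>G\<^esub> x = x \<otimes>\<^bsub>G\<^esub> g}"

text \<open>No finiteness is required: infinite rank is allowed when \<open>G\<close> is infinite.\<close>

definition elementary_abelian_subgroup :: "nat \<Rightarrow> 'a set \<Rightarrow> ('a, 'b) monoid_scheme \<Rightarrow> bool" where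
  "elementary_abelian_subgroup p E G \<longleftrightarrow> subgroup E G \<and>
     (\<forall>x\<in>E. \<forall>y\<in>E. x \<otimes>\<^bsub>G\<^esub> y = y \<otimes>\<^bsub>G\<^esub> x) \<and> (\<forall>x\<in>E. x [^]\<^bsub>G\<^esub> p = \<one>\<^bsub>G\<^esub>)"

definition nontrivial_elementary_abelians :: "nat \<Rightarrow> ('a, 'b) monoid_scheme \<Rightarrow> 'a set set" where
  "nontrivial_elementary_abelians p G = {E. elementary_abelian_subgroup p E G \<and> E \<noteq> {\<one>\<^bsub>G\<^esub>}}"

definition finite_p_subgroup :: "nat \<Rightarrow> 'a set \<Rightarrow> ('a, 'b) monoid_scheme \<Rightarrow> bool" where
  "finite_p_subgroup p P G \<longleftrightarrow> subgroup P G \<and> finite P \<and> (\<exists>k. card P = p ^ k)"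


section \<open>Well-definedness\<close>

text \<open>
  The conjugacy category is a category, \<open>\<alpha>\<close> is a functor to \<open>G\<close>-sets, their homotopy colimit is a
  simplicial \<open>G\<close>-set, and \<open>G\<close> acts on the Dwyer space.
\<close>


lemma conj_map_compose: "f \<in> hom H H' \<Longrightarrow>
  compose (carrier H) (conj_map G H' g i) f = conj_map G H g (compose (carrier H) i f)"
  by (auto simp: conj_map_def compose_def hom_def fun_eq_iff)

lemma conj_class_alt: "conj_class G H i = (\<lambda>g. conj_map G H g i) ` carrier G"
  by (auto simp: conj_class_def orbit_def)

lemma conj_class_compose: "f \<in> hom H H' \<Longrightarrow>
  (\<lambda>j. compose (carrier H) j f) ` conj_class G H' i = conj_class G H (compose (carrier H) i f)"
  by (simp add: conj_class_alt image_image conj_map_compose)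

context group begin

lemma conj_map_mult:
  assumes "g \<in> carrier G" "h \<in> carrier G" "i \<in> carrier H \<rightarrow> carrier G"
  shows "conj_map G H g (conj_map G H h i) = conj_map G H (g \<otimes> h) i"
  using assms by (auto simp: conj_map_def fun_eq_iff inv_mult_group m_assoc Pi_iff)

lemma conj_map_one:
  assumes "i \<in> carrier H \<rightarrow> carrier G" "i \<in> extensional (carrier H)"
  shows "conj_map G H \<one> i = i"
  using assms by (auto simp: conj_map_def fun_eq_iff extensional_def Pi_iff)

lemma conj_class_self:
  assumes "i \<in> carrier H \<rightarrow> carrier G" "i \<in> extensional (carrier H)"
  shows "i \<in> conj_class G H i"
  unfolding conj_class_alt using conj_map_one[OF assms] by (metis image_eqI one_closed)

lemma conj_class_conj_map:
  assumes g: "g \<in> carrier G" and i: "i \<in> carrier H \<rightarrow> carrier G"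
  shows "conj_class G H (conj_map G H g i) = conj_class G H i"
proof -
  have s: "(\<lambda>h. h \<otimes> g) ` carrier G = carrier G"
  proof
    show "carrier G \<subseteq> (\<lambda>h. h \<otimes> g) ` carrier G"
    proof
      fix x assume "x \<in> carrier G"
      then have "x = (x \<otimes> inv g) \<otimes> g" "x \<otimes> inv g \<in> carrier G" using g by (auto simp: m_assoc)
      then show "x \<in> (\<lambda>h. h \<otimes> g) ` carrier G" by (rule image_eqI)
    qed
  qed (use g in auto)
  have "conj_class G H (conj_map G H g i) = (\<lambda>h. conj_map G H (h \<otimes> g) i) ` carrier G"
    unfolding conj_class_alt by (rule image_cong) (use assms conj_map_mult in auto)
  also have "\<dots> = (\<lambda>h. conj_map G H h i) ` ((\<lambda>h. h \<otimes> g) ` carrier G)"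
    by (simp add: image_image)
  also note s
  finally show ?thesis by (simp add: conj_class_alt)
qed

lemma conj_class_eq:
  assumes "j \<in> conj_class G H i" and "i \<in> carrier H \<rightarrow> carrier G"
  shows "conj_class G H j = conj_class G H i"
  using assms conj_class_conj_map by (auto simp: conj_class_alt[of G H i])

lemma conj_class_member:
  assumes "j \<in> conj_class G H i" and "i \<in> carrier H \<rightarrow> carrier G"
  shows "j \<in> carrier H \<rightarrow> carrier G" "j \<in> extensional (carrier H)"
  using assms by (auto simp: conj_class_alt conj_map_def Pi_iff)

definition maps_class :: "'a monoid \<Rightarrow> ('a \<Rightarrow> 'a) set \<Rightarrow> bool" where
  "maps_class H I \<longleftrightarrow> (\<exists>i. i \<in> carrier H \<rightarrow> carrier G \<and> i \<in> extensional (carrier H) \<and> I = conj_class G H i)"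

lemma ob_maps_class: "(H, I) \<in> Ob (conj_category G \<E>) \<Longrightarrow> maps_class H I"
  by (auto simp: conj_category_def maps_class_def mon_def hom_def)

lemma hom_iff:
  assumes "maps_class H I" "maps_class H' I'"
  shows "f \<in> Hom (conj_category G \<E>) (H, I) (H', I') \<longleftrightarrow> f \<in> hom H H' \<and> f \<in> extensional (carrier H)
     \<and> I = (\<lambda>j. compose (carrier H) j f) ` I'"
proof -
  obtain i i' where i: "i \<in> carrier H \<rightarrow> carrier G" "i \<in> extensional (carrier H)" "I = conj_class G H i"
    and i': "i' \<in> carrier H' \<rightarrow> carrier G" "i' \<in> extensional (carrier H')" "I' = conj_class G H' i'"
    using assms by (auto simp: maps_class_def)
  have I: "conj_class G H j = I" if "j \<in> I" for j using that conj_class_eq i by blast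
  have I': "conj_class G H' j = I'" if "j \<in> I'" for j using that conj_class_eq i' by blast
  have "I \<noteq> {}" "I' \<noteq> {}" using i i' conj_class_self by blast+
  have key: "(\<lambda>j. compose (carrier H) j f) ` I' = conj_class G H (compose (carrier H) j' f)" if "f \<in> hom H H'" "j' \<in> I'" for j'
    using conj_class_compose[OF that(1), of G j'] I'[OF that(2)] by simp
  show ?thesis
  proof
    assume "f \<in> Hom (conj_category G \<E>) (H, I) (H', I')"
    then obtain j j' where f: "f \<in> hom H H'" "f \<in> extensional (carrier H)" and j: "j \<in> I" "j' \<in> I'"
      and eq: "conj_class G H j = conj_class G H (compose (carrier H) j' f)"
      by (auto simp: conj_category_def)
    have "I = (\<lambda>j. compose (carrier H) j f) ` I'" using key[OF f(1) j(2)] I[OF j(1)] eq by simp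
    with f show "f \<in> hom H H' \<and> f \<in> extensional (carrier H) \<and> I = (\<lambda>j. compose (carrier H) j f) ` I'" by blast
  next
    assume a: "f \<in> hom H H' \<and> f \<in> extensional (carrier H) \<and> I = (\<lambda>j. compose (carrier H) j f) ` I'"
    obtain j j' where j: "j \<in> I" "j' \<in> I'" using \<open>I \<noteq> {}\<close> \<open>I' \<noteq> {}\<close> by blast
    have "conj_class G H j = conj_class G H (compose (carrier H) j' f)"
      using key[of j'] I[OF j(1)] j a by simp
    with a j show "f \<in> Hom (conj_category G \<E>) (H, I) (H', I')"
      by (auto simp: conj_category_def)
  qed
qed

lemma ob_group: "(H, I) \<in> Ob (conj_category G \<E>) \<Longrightarrow> group H"
  by (auto simp: conj_category_def)

lemma Hom_iff:
  assumes "(H, I) \<in> Ob (conj_category G \<E>)" "(H', I') \<in> Ob (conj_category G \<E>)"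
  shows "f \<in> Hom (conj_category G \<E>) (H, I) (H', I') \<longleftrightarrow> f \<in> hom H H' \<and> f \<in> extensional (carrier H)
     \<and> I = (\<lambda>j. compose (carrier H) j f) ` I'"
  using hom_iff ob_maps_class assms by blast

lemma ob_ext:
  assumes "(H, I) \<in> Ob (conj_category G \<E>)" "i \<in> I"
  shows "i \<in> carrier H \<rightarrow> carrier G" "i \<in> extensional (carrier H)"
proof -
  obtain i0 where "i0 \<in> carrier H \<rightarrow> carrier G" "I = conj_class G H i0"
    using ob_maps_class[OF assms(1)] by (auto simp: maps_class_def)
  then show "i \<in> carrier H \<rightarrow> carrier G" "i \<in> extensional (carrier H)"
    using conj_class_member assms(2) by blast+
qed

lemma conj_cat_simps [simp]:
  "Idt (conj_category G \<E>) (H, I) = (\<lambda>x\<in>carrier H. x)"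
  "Comp (conj_category G \<E>) (H, I) b c v u = compose (carrier H) v u"
  by (simp_all add: conj_category_def)

lemma small_category_conj: "small_category (conj_category G \<E>)"
proof
  let ?C = "conj_category G \<E>"
  fix a assume a: "a \<in> Ob ?C"
  obtain H I where [simp]: "a = (H, I)" by fastforce
  have "(\<lambda>j. compose (carrier H) j (\<lambda>x\<in>carrier H. x)) ` I = id ` I"
  proof (rule image_cong)
    fix j assume "j \<in> I"
    then have "j \<in> extensional (carrier H)" using a ob_ext(2) by auto
    then show "compose (carrier H) j (\<lambda>x\<in>carrier H. x) = id j"
      by (auto simp: compose_def extensional_def fun_eq_iff)
  qed simp
  moreover have "(\<lambda>x\<in>carrier H. x) \<in> hom H H"
    using ob_group a by (auto simp: hom_def group.is_monoid monoid.m_closed)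
  ultimately show "Idt ?C a \<in> Hom ?C a a"
    using a by (simp add: Hom_iff)
next
  let ?C = "conj_category G \<E>"
  fix a b c u v assume abc: "a \<in> Ob ?C" "b \<in> Ob ?C" "c \<in> Ob ?C" and uv: "u \<in> Hom ?C a b" "v \<in> Hom ?C b c"
  obtain H I where [simp]: "a = (H, I)" by fastforce
  obtain H' I' where [simp]: "b = (H', I')" by fastforce
  obtain H'' I'' where [simp]: "c = (H'', I'')" by fastforce
  have u: "u \<in> hom H H'" and v: "v \<in> hom H' H''" and I: "I = (\<lambda>j. compose (carrier H) j u) ` I'"
     and I': "I' = (\<lambda>j. compose (carrier H') j v) ` I''"
    using abc uv by (auto simp: Hom_iff)
  have "I = (\<lambda>j. compose (carrier H) j (compose (carrier H) v u)) ` I''"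
    unfolding I I' image_image using u
    by (intro image_cong) (auto simp: compose_assoc hom_def)
  moreover have "compose (carrier H) v u \<in> hom H H''"
    using u v ob_group[of H I] abc by (auto simp: hom_def compose_def Pi_iff group.is_monoid monoid.m_closed)
  ultimately show "Comp ?C a b c v u \<in> Hom ?C a c"
    using abc by (simp add: Hom_iff)
next
  let ?C = "conj_category G \<E>"
  fix a b u assume abc: "a \<in> Ob ?C" "b \<in> Ob ?C" and uv: "u \<in> Hom ?C a b"
  obtain H I where [simp]: "a = (H, I)" by fastforce
  obtain H' I' where [simp]: "b = (H', I')" by fastforce
  have u: "u \<in> hom H H'" "u \<in> extensional (carrier H)"
    using abc uv by (auto simp: Hom_iff)
  show "Comp ?C a b b (Idt ?C b) u = u" "Comp ?C a a b u (Idt ?C a) = u"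
    using u by (auto simp: compose_def hom_def fun_eq_iff extensional_def)
next
  let ?C = "conj_category G \<E>"
  fix a b c d u v w assume abc: "a \<in> Ob ?C" "b \<in> Ob ?C" and uv: "u \<in> Hom ?C a b"
  obtain H I where [simp]: "a = (H, I)" by fastforce
  obtain H' I' where [simp]: "b = (H', I')" by fastforce
  have u: "u \<in> hom H H'"
    using abc uv by (auto simp: Hom_iff)
  then show "Comp ?C a c d w (Comp ?C a b c v u) = Comp ?C a b d (Comp ?C b c d w v) u"
    by (simp add: compose_assoc hom_def)
qed

lemma conj_act:
  assumes "(H, I) \<in> Ob (conj_category G \<E>)"
  shows "group_action G I (\<lambda>g. \<lambda>j\<in>I. conj_map G H g j)"
proof -
  obtain i where i: "i \<in> carrier H \<rightarrow> carrier G" "i \<in> extensional (carrier H)" "I = conj_class G H i"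
    using ob_maps_class[OF assms] by (auto simp: maps_class_def)
  have closed: "conj_map G H g j \<in> I" if "g \<in> carrier G" "j \<in> I" for g j
    using that i conj_map_mult by (auto simp: conj_class_alt)
  note ob = ob_ext[OF assms]
  have m: "conj_map G H g (conj_map G H h j) = conj_map G H (g \<otimes> h) j" if "j \<in> I" "g \<in> carrier G" "h \<in> carrier G" for g h j
    using that conj_map_mult ob by blast
  have ident: "conj_map G H \<one> j = j" if "j \<in> I" for j
    using that conj_map_one ob by blast
  have bij: "bij_betw (\<lambda>j\<in>I. conj_map G H g j) I I" if "g \<in> carrier G" for g
    by (rule bij_betw_byWitness[where f' = "conj_map G H (inv g)"]) (use that closed m ident in auto)
  show ?thesis
    unfolding group_action_def group_hom_def group_hom_axioms_def
  proof (intro conjI is_group group_BijGroup homI)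
    fix g h assume "g \<in> carrier G" "h \<in> carrier G"
    then show "(\<lambda>j\<in>I. conj_map G H (g \<otimes> h) j) = (\<lambda>j\<in>I. conj_map G H g j) \<otimes>\<^bsub>BijGroup I\<^esub> (\<lambda>j\<in>I. conj_map G H h j)"
      using bij[of g] bij[of h] closed m[OF _ \<open>g \<in> carrier G\<close> \<open>h \<in> carrier G\<close>]
      by (simp add: BijGroup_def Bij_def compose_def cong: restrict_cong)
  qed (use bij in \<open>auto simp: BijGroup_def Bij_def\<close>)
qed

lemma alpha_simps [simp]:
  "dset (alpha_functor G) (H, I) = I"
  "dact (alpha_functor G) (H, I) g = (\<lambda>j\<in>I. conj_map G H g j)"
  "dmap (alpha_functor G) (H', I') (H, I) f = (\<lambda>j\<in>I'. compose (carrier H) j f)"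
  by (simp_all add: alpha_functor_def)

lemma gset_functor_alpha: "gset_functor (op_cat (conj_category G \<E>)) G (alpha_functor G)"
proof -
  let ?C = "conj_category G \<E>"
  have 1: "dact (alpha_functor G) (H, I) = (\<lambda>g. \<lambda>j\<in>I. conj_map G H g j)" for H I
    by (rule ext) simp
  have "gset_functor_axioms (op_cat ?C) G (alpha_functor G)"
  proof (rule gset_functor_axioms.intro)
    fix a assume "a \<in> Ob (op_cat ?C)"
    then show "group_action G (dset (alpha_functor G) a) (dact (alpha_functor G) a)"
      using conj_act by (cases a) (simp add: 1)
  next
    fix a b u x assume abc: "a \<in> Ob (op_cat ?C)" "b \<in> Ob (op_cat ?C)" and uv: "u \<in> Hom (op_cat ?C) a b"
      and x: "x \<in> dset (alpha_functor G) a"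
    obtain H I where [simp]: "a = (H, I)" by fastforce
    obtain H' I' where [simp]: "b = (H', I')" by fastforce
    show c: "dmap (alpha_functor G) a b u x \<in> dset (alpha_functor G) b"
      using abc uv x by (auto simp: Hom_iff)
  next
    fix a b u x g assume abc: "a \<in> Ob (op_cat ?C)" "b \<in> Ob (op_cat ?C)" and uv: "u \<in> Hom (op_cat ?C) a b"
      and x: "x \<in> dset (alpha_functor G) a" and g: "g \<in> carrier G"
    obtain H I where [simp]: "a = (H, I)" by fastforce
    obtain H' I' where [simp]: "b = (H', I')" by fastforce
    have c: "dmap (alpha_functor G) a b u x \<in> dset (alpha_functor G) b"
      using abc uv x by (auto simp: Hom_iff)
    have x': "conj_map G H g x \<in> I" using conj_act abc g x 
      by (metis (no_types, lifting) \<open>a = (H, I)\<close> alpha_simps(1) group_action.element_image op_cat_simps(1) restrict_apply)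
    show "dmap (alpha_functor G) a b u (dact (alpha_functor G) a g x) = dact (alpha_functor G) b g (dmap (alpha_functor G) a b u x)"
      using x x' c abc uv conj_map_compose[of u H' H] by (auto simp: Hom_iff)
  next
    fix a x assume abc: "a \<in> Ob (op_cat ?C)" "x \<in> dset (alpha_functor G) a"
    obtain H I where [simp]: "a = (H, I)" by fastforce
    show "dmap (alpha_functor G) a a (Idt (op_cat ?C) a) x = x"
    proof -
      have "x \<in> extensional (carrier H)" using abc ob_ext(2) by simp
      then show ?thesis using abc by (auto simp: compose_def fun_eq_iff extensional_def)
    qed
  next
    fix a b c u v x assume abc: "a \<in> Ob (op_cat ?C)" "b \<in> Ob (op_cat ?C)" "c \<in> Ob (op_cat ?C)" and uv: "u \<in> Hom (op_cat ?C) a b" "v \<in> Hom (op_cat ?C) b c"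
      and x: "x \<in> dset (alpha_functor G) a"
  obtain H I where [simp]: "a = (H, I)" by fastforce
  obtain H' I' where [simp]: "b = (H', I')" by fastforce
  obtain H'' I'' where [simp]: "c = (H'', I'')" by fastforce
    show "dmap (alpha_functor G) a c (Comp (op_cat ?C) a b c v u) x = dmap (alpha_functor G) b c v (dmap (alpha_functor G) a b u x)"
    proof -
      have "v \<in> hom H'' H'" "I' = (\<lambda>j. compose (carrier H') j u) ` I" using abc uv by (auto simp: Hom_iff)
      then show ?thesis using x by (simp add: compose_assoc hom_def)
    qed
  qed
  then show ?thesis
    using small_category_conj small_category_op by (auto simp: gset_functor_def)
qed

end

lemma nerve_simps: 
 "(c,u) \<in> simplices (nerve C) n \<longleftrightarrow>  c \<in> {..n} \<rightarrow>\<^sub>E Ob C \<and>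
        u \<in> (\<Pi>\<^sub>E (i, j) \<in> ordinal_arrows n. Hom C (c i) (c j)) \<and>
        (\<forall>i\<le>n. u (i, i) = Idt C (c i)) \<and>
        (\<forall>i j k. i \<le> j \<and> j \<le> k \<and> k \<le> n \<longrightarrow>
           u (i, k) = Comp C (c i) (c j) (c k) (u (j, k)) (u (i, j)))"
  by (simp add: nerve_def)

lemma opsD: assumes "\<theta> \<in> simplicial_ops m n" "i \<le> j" "j \<le> m"
  shows "\<theta> i \<le> \<theta> j" "\<theta> j \<le> n"
  using assms by (auto simp: simplicial_ops_def mono_on_def Pi_iff)

lemma nerve_pull:
 "pull (nerve C) m n \<theta> (c,u) = (\<lambda>i\<in>{..m}. c (\<theta> i), \<lambda>(i, j)\<in>ordinal_arrows m. u (\<theta> i, \<theta> j))"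
  by (simp add: nerve_def)

lemma nerve_pull_closed:
  assumes "(c,u) \<in> simplices (nerve C) n" and t: "\<theta> \<in> simplicial_ops m n"
  shows "pull (nerve C) m n \<theta> (c,u) \<in> simplices (nerve C) m"
proof -
  have c: "c i \<in> Ob C" if "i \<le> n" for i using assms that by (auto simp: nerve_simps)
  have u: "u (i, j) \<in> Hom C (c i) (c j)" if "i \<le> j" "j \<le> n" for i j
    using assms that by (fastforce simp: nerve_simps ordinal_arrows_def PiE_iff)
  have uu: "u (i, i) = Idt C (c i)" if "i \<le> n" for i using assms that by (auto simp: nerve_simps)
  have uc: "u (i, k) = Comp C (c i) (c j) (c k) (u (j, k)) (u (i, j))" if "i \<le> j" "j \<le> k" "k \<le> n" for i j k
    using assms(1) that unfolding nerve_simps by blast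
  show ?thesis
    unfolding nerve_pull nerve_simps
  proof (intro conjI allI impI)
    show "(\<lambda>i\<in>{..m}. c (\<theta> i)) \<in> {..m} \<rightarrow>\<^sub>E Ob C" using c opsD(2)[OF t order_refl] by auto
    show "(\<lambda>(i, j)\<in>ordinal_arrows m. u (\<theta> i, \<theta> j)) \<in> (\<Pi>\<^sub>E (i, j) \<in> ordinal_arrows m. Hom C ((\<lambda>i\<in>{..m}. c (\<theta> i)) i) ((\<lambda>i\<in>{..m}. c (\<theta> i)) j))"
      using u opsD[OF t] by (auto simp: ordinal_arrows_def)
  next
    fix i assume "i \<le> m" then show "(\<lambda>(i, j)\<in>ordinal_arrows m. u (\<theta> i, \<theta> j)) (i, i) = Idt C ((\<lambda>i\<in>{..m}. c (\<theta> i)) i)"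
      using uu[of "\<theta> i"] opsD(2)[OF t order_refl] by (auto simp: ordinal_arrows_def)
  next
    fix i j k assume "i \<le> j \<and> j \<le> k \<and> k \<le> m"
    then show "(\<lambda>(i, j)\<in>ordinal_arrows m. u (\<theta> i, \<theta> j)) (i, k) =
       Comp C ((\<lambda>i\<in>{..m}. c (\<theta> i)) i) ((\<lambda>i\<in>{..m}. c (\<theta> i)) j) ((\<lambda>i\<in>{..m}. c (\<theta> i)) k)
        ((\<lambda>(i, j)\<in>ordinal_arrows m. u (\<theta> i, \<theta> j)) (j, k)) ((\<lambda>(i, j)\<in>ordinal_arrows m. u (\<theta> i, \<theta> j)) (i, j))"
      using uc[of "\<theta> i" "\<theta> j" "\<theta> k"] opsD[OF t] by (auto simp: ordinal_arrows_def)
  qed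
qed

lemma hocolim_simps [simp]:
  "((c,u),x) \<in> simplices (hocolim C F) n \<longleftrightarrow> (c, u) \<in> simplices (nerve C) n \<and> x \<in> dset F (c 0)"
  "pull (hocolim C F) m n \<theta> ((c,u),x) = (pull (nerve C) m n \<theta> (c, u), dmap F (c 0) (c (\<theta> 0)) (u (0, \<theta> 0)) x)"
  "sact (hocolim C F) n g = (\<lambda>((c, u), x)\<in>simplices (hocolim C F) n. ((c, u), dact F (c 0) g x))"
  by (simp_all add: hocolim_def)

lemma ga_one: "group_action G E \<phi> \<Longrightarrow> x \<in> E \<Longrightarrow> \<phi> \<one>\<^bsub>G\<^esub> x = x"
  using group_action.id_eq_one[of G E \<phi>] by (metis restrict_apply')
lemma ga_mult: "group_action G E \<phi> \<Longrightarrow> x \<in> E \<Longrightarrow> g \<in> carrier G \<Longrightarrow> h \<in> carrier G \<Longrightarrow> \<phi> (g \<otimes>\<^bsub>G\<^esub> h) x = \<phi> g (\<phi> h x)"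
  by (rule group_action.composition_rule)
lemma ga_closed: "group_action G E \<phi> \<Longrightarrow> x \<in> E \<Longrightarrow> g \<in> carrier G \<Longrightarrow> \<phi> g x \<in> E"
  using group_action.element_image by metis
lemma ga_intro:
  assumes "group G" and eq: "\<And>g. \<phi> g = restrict (f g) S"
    and closed: "\<And>g x. g \<in> carrier G \<Longrightarrow> x \<in> S \<Longrightarrow> f g x \<in> S"
    and m: "\<And>g h x. g \<in> carrier G \<Longrightarrow> h \<in> carrier G \<Longrightarrow> x \<in> S \<Longrightarrow> f g (f h x) = f (g \<otimes>\<^bsub>G\<^esub> h) x"
    and ident: "\<And>x. x \<in> S \<Longrightarrow> f \<one>\<^bsub>G\<^esub> x = x"
  shows "group_action G S \<phi>"
proof -
  interpret group G by fact
  have bij: "bij_betw (restrict (f g) S) S S" if "g \<in> carrier G" for g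
    by (rule bij_betw_byWitness[where f' = "f (inv\<^bsub>G\<^esub> g)"]) (use that closed m ident in \<open>simp_all add: image_subset_iff\<close>)
  show ?thesis
    unfolding group_action_def group_hom_def group_hom_axioms_def 
  proof (intro conjI is_group group_BijGroup homI)
    fix g h assume gh: "g \<in> carrier G" "h \<in> carrier G"
    have "restrict (f (g \<otimes>\<^bsub>G\<^esub> h)) S = compose S (restrict (f g) S) (restrict (f h) S)"
      unfolding compose_def by (rule restrict_cong[OF refl]) (use closed[OF gh(2)] m[OF gh] in \<open>simp add: simp_implies_def\<close>)
    then show "\<phi> (g \<otimes>\<^bsub>G\<^esub> h) = \<phi> g \<otimes>\<^bsub>BijGroup S\<^esub> \<phi> h" 
      using bij[OF gh(1)] bij[OF gh(2)] by (simp add: BijGroup_def Bij_def eq)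
  qed (use bij in \<open>auto simp: BijGroup_def Bij_def eq\<close>)
qed

lemma simplicial_gset_hocolim:
  assumes "gset_functor C G F" and "group G"
  shows "simplicial_gset G (hocolim C F)"
proof -
  interpret gset_functor C G F by fact
  interpret group G by fact
  have cc: "c i \<in> Ob C" if "i \<le> n" "(c,u) \<in> simplices (nerve C) n" for c u i n using that by (auto simp: nerve_simps)
  have uu: "u (i, j) \<in> Hom C (c i) (c j)" if "i \<le> j" "j \<le> n" "(c,u) \<in> simplices (nerve C) n" for c u i j n
    using that by (fastforce simp: nerve_simps ordinal_arrows_def PiE_iff)
  show ?thesis
  proof (rule simplicial_gset.intro)
    fix \<theta> m n y assume t: "\<theta> \<in> simplicial_ops m n" and y: "y \<in> simplices (hocolim C F) n"
    obtain c u x where [simp]: "y = ((c,u),x)" by (metis surj_pair)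
    show "pull (hocolim C F) m n \<theta> y \<in> simplices (hocolim C F) m"
    proof -
      have "\<theta> 0 \<le> n" using opsD[OF t, of 0 0] by simp
      then have "dmap F (c 0) (c (\<theta> 0)) (u (0, \<theta> 0)) x \<in> dset F (c (\<theta> 0))"
        using y cc[of _ n c u] uu[of _ _ n c u] by (intro dmap_closed) auto
      then show ?thesis using y nerve_pull_closed[of c u C n \<theta> m] t by (simp add: nerve_pull)
    qed
  next
    fix \<theta> \<theta>' :: "nat \<Rightarrow> nat" and m n y assume t: "\<theta> \<in> simplicial_ops m n" and y: "y \<in> simplices (hocolim C F) n" and e: "\<And>i. i \<le> m \<Longrightarrow> \<theta> i = \<theta>' i"
    obtain c u x where [simp]: "y = ((c,u),x)" by (metis surj_pair)
    show "pull (hocolim C F) m n \<theta> y = pull (hocolim C F) m n \<theta>' y"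
      using e by (auto simp: nerve_pull ordinal_arrows_def fun_eq_iff)
  next
    fix n y assume y: "y \<in> simplices (hocolim C F) n"
    obtain c u x where [simp]: "y = ((c,u),x)" by (metis surj_pair)
    have "u (0,0) = Idt C (c 0)" using y by (simp add: nerve_simps)
    moreover have "restrict c {..n} = c" "(\<lambda>(i, j)\<in>ordinal_arrows n. u (i, j)) = u" using y
      by (auto simp: nerve_simps PiE_def extensional_restrict)
    ultimately show "pull (hocolim C F) n n id y = y"
      using y cc[of 0 n c u] dmap_Idt by (auto simp: nerve_pull)
  next
    fix \<theta> \<theta>' l m n y assume t: "\<theta> \<in> simplicial_ops l m" and t': "\<theta>' \<in> simplicial_ops m n" and y: "y \<in> simplices (hocolim C F) n"
    obtain c u x where [simp]: "y = ((c,u),x)" by (metis surj_pair)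
    have h: "\<theta> 0 \<le> m" "\<theta>' 0 \<le> \<theta>' (\<theta> 0)" "\<theta>' (\<theta> 0) \<le> n" "\<theta>' 0 \<le> n" using opsD[OF t, of 0 0] opsD[OF t'] by auto
    have "u (0, \<theta>' (\<theta> 0)) = Comp C (c 0) (c (\<theta>' 0)) (c (\<theta>' (\<theta> 0))) (u (\<theta>' 0, \<theta>' (\<theta> 0))) (u (0, \<theta>' 0))"
      using y h unfolding \<open>y = _\<close> hocolim_simps nerve_simps by blast
    moreover have "dmap F (c 0) (c (\<theta>' (\<theta> 0))) (Comp C (c 0) (c (\<theta>' 0)) (c (\<theta>' (\<theta> 0))) (u (\<theta>' 0, \<theta>' (\<theta> 0))) (u (0, \<theta>' 0))) x
      = dmap F (c (\<theta>' 0)) (c (\<theta>' (\<theta> 0))) (u (\<theta>' 0, \<theta>' (\<theta> 0))) (dmap F (c 0) (c (\<theta>' 0)) (u (0, \<theta>' 0)) x)"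
      by (rule dmap_Comp) (use y h cc[of _ n c u] uu[of _ _ n c u] in auto)
    ultimately have calc: "dmap F (c (\<theta>' 0)) (c (\<theta>' (\<theta> 0))) (u (\<theta>' 0, \<theta>' (\<theta> 0))) (dmap F (c 0) (c (\<theta>' 0)) (u (0, \<theta>' 0)) x)
        = dmap F (c 0) (c (\<theta>' (\<theta> 0))) (u (0, \<theta>' (\<theta> 0))) x" by simp
    show "pull (hocolim C F) l m \<theta> (pull (hocolim C F) m n \<theta>' y) = pull (hocolim C F) l n (\<theta>' \<circ> \<theta>) y"
      
    proof -
      have le: "\<theta> i \<le> m" if "i \<le> l" for i using opsD(2)[OF t order_refl that] .
      have mo: "\<theta> i \<le> \<theta> j" if "i \<le> j" "j \<le> l" for i j using opsD(1)[OF t that] .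
      have 1: "(\<lambda>i\<in>{..l}. restrict (\<lambda>i. c (\<theta>' i)) {..m} (\<theta> i)) = (\<lambda>i\<in>{..l}. c (\<theta>' (\<theta> i)))"
        by (rule restrict_cong) (simp_all add: simp_implies_def le)
      have 2: "(\<lambda>(i, j)\<in>ordinal_arrows l. (\<lambda>(i, j)\<in>ordinal_arrows m. u (\<theta>' i, \<theta>' j)) (\<theta> i, \<theta> j)) = (\<lambda>(i, j)\<in>ordinal_arrows l. u (\<theta>' (\<theta> i), \<theta>' (\<theta> j)))"
        by (rule restrict_cong) (auto simp: simp_implies_def le mo ordinal_arrows_def)
      have 3: "(0, \<theta> 0) \<in> ordinal_arrows m" using h by (simp add: ordinal_arrows_def)
      show "pull (hocolim C F) l m \<theta> (pull (hocolim C F) m n \<theta>' y) = pull (hocolim C F) l n (\<theta>' \<circ> \<theta>) y"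
        using calc 1 2 3 h by (simp add: nerve_pull)
    qed
  next
    fix n
    let ?S = "simplices (hocolim C F) n"
    let ?f = "\<lambda>g ((c, u), x). ((c, u), dact F (c 0) g x)"
    have ga: "group_action G (dset F (c 0)) (dact F (c 0))" if "((c,u),x) \<in> ?S" for c u x
      using that dact cc[of 0 n c u] by simp
    show "group_action G ?S (sact (hocolim C F) n)"
    proof (rule ga_intro[where f = ?f])
      fix g y assume g: "g \<in> carrier G" and y: "y \<in> ?S"
      obtain c u x where [simp]: "y = ((c,u),x)" by (metis surj_pair)
      have "dact F (c 0) g x \<in> dset F (c 0)" using y ga_closed[OF ga[of c u x], of x] g by simp
      then show "?f g y \<in> ?S" using y by simp
    next
      fix g h y assume g: "g \<in> carrier G" "h \<in> carrier G" and y: "y \<in> ?S"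
      obtain c u x where [simp]: "y = ((c,u),x)" by (metis surj_pair)
      have "dact F (c 0) (g \<otimes>\<^bsub>G\<^esub> h) x = dact F (c 0) g (dact F (c 0) h x)" using y ga_mult[OF ga[of c u x], of x] g by simp
      then show "?f g (?f h y) = ?f (g \<otimes>\<^bsub>G\<^esub> h) y" by simp
    next
      fix y assume y: "y \<in> ?S"
      obtain c u x where [simp]: "y = ((c,u),x)" by (metis surj_pair)
      have "dact F (c 0) \<one>\<^bsub>G\<^esub> x = x" using y ga_one[OF ga[of c u x], of x] by simp
      then show "?f \<one>\<^bsub>G\<^esub> y = y" by simp
    qed (simp_all add: is_group)
  next
    fix \<theta> m n g y assume t: "\<theta> \<in> simplicial_ops m n" and y: "y \<in> simplices (hocolim C F) n" and g: "g \<in> carrier G"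
    obtain c u x where [simp]: "y = ((c,u),x)" by (metis surj_pair)
    have h: "\<theta> 0 \<le> n" using opsD[OF t, of 0 0] by auto
    have "dmap F (c 0) (c (\<theta> 0)) (u (0, \<theta> 0)) x \<in> dset F (c (\<theta> 0))" 
      "dmap F (c 0) (c (\<theta> 0)) (u (0, \<theta> 0)) (dact F (c 0) g x) = dact F (c (\<theta> 0)) g (dmap F (c 0) (c (\<theta> 0)) (u (0, \<theta> 0)) x)"
      using dmap_closed dmap_dact y h g cc[of _ n c u] uu[of _ _ n c u] by simp_all
    moreover have "pull (nerve C) m n \<theta> (c,u) \<in> simplices (nerve C) m" using nerve_pull_closed t y by auto
    ultimately show "pull (hocolim C F) m n \<theta> (sact (hocolim C F) n g y) = sact (hocolim C F) m g (pull (hocolim C F) m n \<theta> y)"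
      using y by (auto simp: nerve_pull)
  qed
qed

lemma (in group) simplicial_gset_dwyer: "simplicial_gset G (dwyer_sset G \<E>)"
  unfolding dwyer_sset_def using simplicial_gset_hocolim gset_functor_alpha is_group by blast

lemma push_closed:
  assumes t: "t \<in> standard_simplex m" and th: "\<theta> \<in> simplicial_ops m n"
  shows "push_simplex m \<theta> t \<in> standard_simplex n"
proof -
  have pos: "0 \<le> t i" for i using t by (simp add: standard_simplex_def)
  have s1: "(\<Sum>i\<le>m. t i) = 1" using t by (simp add: standard_simplex_def)
  have le: "\<theta> i \<le> n" if "i \<le> m" for i using opsD(2)[OF th order_refl that] .
  have "(\<Sum>j\<le>n. push_simplex m \<theta> t j) = (\<Sum>j\<le>n. \<Sum>i\<in>{i. i \<in> {..m} \<and> \<theta> i = j}. t i)"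
    by (simp add: push_simplex_def)
  also have "\<dots> = (\<Sum>i\<le>m. t i)"
    by (rule sum.group) (use le in auto)
  finally have s: "(\<Sum>j\<le>n. push_simplex m \<theta> t j) = 1" using s1 by simp
  have p: "0 \<le> push_simplex m \<theta> t j" for j by (simp add: push_simplex_def pos sum_nonneg)
  have z: "push_simplex m \<theta> t j = 0" if "j > n" for j
    unfolding push_simplex_def by (rule sum.neutral) (use le that in force)
  have "push_simplex m \<theta> t j \<le> 1" for j
  proof (cases "j \<le> n")
    case True
    then have "push_simplex m \<theta> t j \<le> (\<Sum>j\<le>n. push_simplex m \<theta> t j)"
      by (intro member_le_sum) (auto simp: p)
    then show ?thesis using s by simp
  qed (use z in simp)
  then show ?thesis using s p z by (simp add: standard_simplex_def)
qed

lemma topspace_simplex_space: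
  "topspace (simplex_space X) = {((n, x), t). x \<in> simplices X n \<and> t \<in> standard_simplex n}"
  by (auto simp: simplex_space_def)

lemma group_action_realization:
  assumes "simplicial_gset G X" and "group G"
  shows "group_action G (topspace (realization X)) (realization_act X)"
proof -
  interpret simplicial_gset G X by fact
  interpret group G by fact
  define f where "f = (\<lambda>g ((n, x), t::nat\<Rightarrow>real). ((n, sact X n g x), t))"
  define T where "T = topspace (simplex_space X)"
  define R where "R = simplex_glue X \<union> (simplex_glue X)\<inverse>"
  let ?S = "topspace (realization X)"
  have S: "?S = (\<lambda>z. R\<^sup>* `` {z}) ` T" by (simp add: realization_def T_def R_def simplex_class_def image_def)
  have T: "((n,x),t) \<in> T \<longleftrightarrow> x \<in> simplices X n \<and> t \<in> standard_simplex n" for n x t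
    by (auto simp: T_def topspace_simplex_space)
  have fT: "f g z \<in> T" if "g \<in> carrier G" "z \<in> T" for g z
  proof -
    obtain n x t where [simp]: "z = ((n,x),t)" by (metis surj_pair)
    have "sact X n g x \<in> simplices X n" using that ga_closed[OF sact, of x n g] by (simp add: T)
    then show ?thesis using that by (simp add: f_def T)
  qed
  have fm: "f g (f h z) = f (g \<otimes>\<^bsub>G\<^esub> h) z" if "g \<in> carrier G" "h \<in> carrier G" "z \<in> T" for g h z
  proof -
    obtain n x t where [simp]: "z = ((n,x),t)" by (metis surj_pair)
    show ?thesis using that ga_mult[OF sact, of x n g h] by (simp add: f_def T)
  qed
  have f1: "f \<one>\<^bsub>G\<^esub> z = z" if "z \<in> T" for z
  proof -
    obtain n x t where [simp]: "z = ((n,x),t)" by (metis surj_pair)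
    show ?thesis using that ga_one[OF sact, of x n] by (simp add: f_def T)
  qed
  have "simplex_glue X \<subseteq> T \<times> T"
    by (auto simp: simplex_glue_def T pull_closed push_closed)
  then have RT: "R \<subseteq> T \<times> T" by (auto simp: R_def)
  have "(f g a, f g b) \<in> simplex_glue X" if g: "g \<in> carrier G" and ab: "(a, b) \<in> simplex_glue X" for g a b
  proof -
    obtain m n \<theta> x t where h: "a = ((m, pull X m n \<theta> x), t)" "b = ((n, x), push_simplex m \<theta> t)"
      "\<theta> \<in> simplicial_ops m n" "x \<in> simplices X n" "t \<in> standard_simplex m"
      using ab by (auto simp: simplex_glue_def)
    have "f g a = ((m, pull X m n \<theta> (sact X n g x)), t)" "f g b = ((n, sact X n g x), push_simplex m \<theta> t)"
      using h g by (simp_all add: f_def pull_sact)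
    moreover have "sact X n g x \<in> simplices X n" using ga_closed[OF sact h(4) g] .
    ultimately show ?thesis using h unfolding simplex_glue_def by blast
  qed
  then have fR: "(f g a, f g b) \<in> R" if "g \<in> carrier G" "(a, b) \<in> R" for g a b
    using that unfolding R_def by blast
  have fRs: "(f g a, f g b) \<in> R\<^sup>*" if g: "g \<in> carrier G" and "(a, b) \<in> R\<^sup>*" for g a b
    using that(2) by (induction) (auto intro: rtrancl_into_rtrancl fR[OF g])
  have RsT: "b \<in> T" if "(a, b) \<in> R\<^sup>*" "a \<in> T" for a b
    using that by (induction) (use RT in auto)
  have img: "f g ` (R\<^sup>* `` {z}) = R\<^sup>* `` {f g z}" if g: "g \<in> carrier G" and z: "z \<in> T" for g z
  proof
    show "f g ` (R\<^sup>* `` {z}) \<subseteq> R\<^sup>* `` {f g z}" using fRs[OF g] by auto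
    show "R\<^sup>* `` {f g z} \<subseteq> f g ` (R\<^sup>* `` {z})"
    proof
      fix b assume b: "b \<in> R\<^sup>* `` {f g z}"
      have bT: "b \<in> T" using RsT b fT[OF g z] by auto
      have "(f (inv\<^bsub>G\<^esub> g) (f g z), f (inv\<^bsub>G\<^esub> g) b) \<in> R\<^sup>*" using b fRs g by auto
      then have "(z, f (inv\<^bsub>G\<^esub> g) b) \<in> R\<^sup>*" using g z by (simp add: fm f1)
      moreover have "b = f g (f (inv\<^bsub>G\<^esub> g) b)" using g bT by (simp add: fm f1)
      ultimately show "b \<in> f g ` (R\<^sup>* `` {z})" by blast
    qed
  qed
  have eq: "realization_act X = (\<lambda>g. \<lambda>A\<in>?S. f g ` A)"
    by (simp add: realization_act_def f_def fun_eq_iff)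
  have closed: "f g ` A \<in> ?S" if "g \<in> carrier G" "A \<in> ?S" for g A
    using that img fT by (auto simp: S)
  have AT: "A \<subseteq> T" if "A \<in> ?S" for A using that RsT by (auto simp: S)
  have m: "f g ` f h ` A = f (g \<otimes>\<^bsub>G\<^esub> h) ` A" if "g \<in> carrier G" "h \<in> carrier G" "A \<in> ?S" for g h A
    unfolding image_image by (rule image_cong) (use that fm AT[OF that(3)] in blast)+
  have ident: "f \<one>\<^bsub>G\<^esub> ` A = A" if "A \<in> ?S" for A
    using AT[OF that] f1 by (auto simp: image_iff subset_iff) (metis f1)
  show ?thesis
    by (rule ga_intro[where f = "\<lambda>g A. f g ` A"]) (use closed m ident is_group in \<open>auto simp: eq\<close>)
qed

lemma (in group) group_action_dwyer: "group_action G (topspace (dwyer_space G \<E>)) (dwyer_act G \<E>)"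
  unfolding dwyer_space_def dwyer_act_def using group_action_realization simplicial_gset_dwyer is_group by blast

end

theory Submission
  imports Defs "HOL-Analysis.Abstract_Topological_Spaces" "HOL-Algebra.Multiplicative_Group"
begin

text \<open>
  Simplices of the Dwyer simplicial set are the chains of embeddings \<open>i : H \<rightarrow> G\<close> preordered by
  inclusion of images. A point of the realization determines a monotone step function on \<open>[0, 1)\<close>
  with values in this preorder, so it is fixed by \<open>P\<close> if and only if every vertex carrying positive
  weight is fixed, that is, if and only if these images centralize \<open>P\<close>. Let \<open>Z\<close> be the group of all
  \<open>z\<close> in the centre of \<open>P\<close> with \<open>z\<^sup>p = 1\<close>, which is nontrivial. On the fixed embeddings
  \<open>i(H) \<subseteq> i(H) Z \<supseteq> Z\<close> is a cone, and since \<open>C\<^sub>G(P)\<close> centralizes \<open>Z\<close>, it can be made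
  \<open>C\<^sub>G(P)\<close>-equivariant. Two comparable monotone maps are joined by a homotopy on step functions
  that replaces one map by the other from the parameter \<open>s\<close> on. It descends to both spaces,
  because a quotient map times the identity of \<open>[0, 1]\<close> is a quotient map.
\<close>

section \<open>Cutting simplex coordinates\<close>

text \<open>Realization commuting with products is avoided: instead of a simplicial homotopy on the
  nerve times an interval, the homotopy is written in coordinates. The obstacle is that \<phi> c_0,
  ..., \<phi> c_n, \<psi> c_0, ..., \<psi> c_n is in general no chain, because \<phi> c_n need not
  precede \<psi> c_0. Only vertices up to the interval containing s on one side, and from it on the
  other, carry weight. The chain in use therefore changes with s, and continuity has to be pasted
  from closed regions. A representative of a fixed point may also contain non-fixed vertices of
  weight zero, about which the cone says nothing. Being fixed passes to smaller images, so these
  vertices form an initial segment and can be overwritten by the first fixed vertex. Z consists of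
  central elements so that Z itself lies in C_G(P), and of elements with z^p = 1 so that i(H) Z
  stays in the collection. Sending i to the inclusion of i(H) Z is not equivariant: g changes an
  embedding but keeps its source group.\<close>

lemma standard_simplexD:
  assumes "t \<in> standard_simplex n"
  shows "0 \<le> t i" "t i \<le> 1" "n < i \<Longrightarrow> t i = 0" "(\<Sum>i\<le>n. t i) = 1"
  using assms by (auto simp: standard_simplex_def)

lemma standard_simplexI:
  assumes pos: "\<And>i. 0 \<le> t i" and z: "\<And>i. n < i \<Longrightarrow> t i = 0" and s: "(\<Sum>i\<le>n. t i) = 1"
  shows "t \<in> standard_simplex n"
proof -
  have "t j \<le> 1" for j
  proof (cases "j \<le> n")
    case True
    then have "t j \<le> (\<Sum>i\<le>n. t i)" by (intro member_le_sum) (auto simp: pos)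
    then show ?thesis using s by simp
  qed (use z in simp)
  then show ?thesis using assms by (simp add: standard_simplex_def)
qed

lemma standard_simplex_support:
  assumes "t \<in> standard_simplex n"
  obtains i where "i \<le> n" "t i \<noteq> 0"
proof -
  have "(\<Sum>i\<le>n. t i) \<noteq> 0" using standard_simplexD(4)[OF assms] by simp
  then show thesis using that by (metis atMost_iff sum.neutral)
qed

text \<open>The coordinates divide \<open>[0, 1]\<close> into consecutive intervals of lengths
  \<open>t i\<close>; for \<open>0 \<le> s\<close> this is the length of the part of the
  \<open>i\<close>-th interval that lies below \<open>s\<close>.\<close>

definition cut :: "real \<Rightarrow> (nat \<Rightarrow> real) \<Rightarrow> nat \<Rightarrow> real" where
  "cut s t i = min s (\<Sum>k\<le>i. t k) - min s (\<Sum>k<i. t k)"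

lemma sum_cut: "0 \<le> s \<Longrightarrow> (\<Sum>i<k. cut s t i) = min s (\<Sum>i<k. t i)"
proof (induction k)
  case (Suc k)
  then have "(\<Sum>i<Suc k. cut s t i) = min s (\<Sum>i<k. t i) + cut s t k" by simp
  then show ?case by (simp only: cut_def lessThan_Suc_atMost)
qed simp

lemma cut_bounds:
  assumes "0 \<le> t i" shows "0 \<le> cut s t i" "cut s t i \<le> t i"
proof -
  have "(\<Sum>k\<le>i. t k) = (\<Sum>k<i. t k) + t i" by (simp flip: lessThan_Suc_atMost)
  then show "0 \<le> cut s t i" "cut s t i \<le> t i" using assms by (auto simp: cut_def)
qed

lemma cut_zero:
  assumes "\<And>i. 0 \<le> t i" shows "cut 0 t i = 0"
  using assms by (simp add: cut_def sum_nonneg min_absorb1)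

lemma cut_one:
  assumes t: "t \<in> standard_simplex n" shows "cut 1 t i = t i"
proof -
  have *: "sum t A \<le> 1" if "finite A" for A
  proof -
    have "sum t A \<le> sum t (A \<union> {..n})" using that standard_simplexD(1)[OF t] by (intro sum_mono2) auto
    also have "\<dots> = sum t {..n}" using that standard_simplexD(3)[OF t] by (intro sum.mono_neutral_right) auto
    finally show ?thesis using standard_simplexD(4)[OF t] by simp
  qed
  have "(\<Sum>k\<le>i. t k) = (\<Sum>k<i. t k) + t i" by (simp flip: lessThan_Suc_atMost)
  then show ?thesis using *[of "{..i}"] *[of "{..<i}"] by (simp add: cut_def)
qed

lemma initial_segment:
  fixes m :: nat
  assumes "\<And>i j. i \<le> j \<Longrightarrow> j \<le> m \<Longrightarrow> Q j \<Longrightarrow> Q i"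
  obtains k where "{i. i \<le> m \<and> Q i} = {..<k}"
proof -
  have "\<exists>k. {i. i \<le> m \<and> Q i} = {..<k}"
    using assms
  proof (induction m)
    case 0
    show ?case by (cases "Q 0") (auto intro: exI[of _ 1] exI[of _ 0])
  next
    case (Suc m)
    show ?case
    proof (cases "Q (Suc m)")
      case True
      then have "{i. i \<le> Suc m \<and> Q i} = {..<Suc (Suc m)}"
        using Suc.prems[OF _ order_refl] by (auto simp: less_Suc_eq_le)
      then show ?thesis by blast
    next
      case False
      then have "{i. i \<le> Suc m \<and> Q i} = {i. i \<le> m \<and> Q i}" by (auto simp: le_Suc_eq)
      moreover have "\<exists>k. {i. i \<le> m \<and> Q i} = {..<k}" using Suc by (meson le_SucI)
      ultimately show ?thesis by simp
    qed
  qed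
  then show thesis using that by blast
qed

lemma sum_push_simplex:
  assumes "finite J"
  shows "(\<Sum>j\<in>J. push_simplex m \<theta> t j) = (\<Sum>i | i \<le> m \<and> \<theta> i \<in> J. t i)"
proof -
  have "(\<Sum>j\<in>J. push_simplex m \<theta> t j) = (\<Sum>j\<in>J. \<Sum>i\<in>{i \<in> {i. i \<le> m \<and> \<theta> i \<in> J}. \<theta> i = j}. t i)"
    unfolding push_simplex_def by (intro sum.cong) auto
  also have "\<dots> = (\<Sum>i | i \<le> m \<and> \<theta> i \<in> J. t i)"
    by (rule sum.group) (use assms in auto)
  finally show ?thesis .
qed

text \<open>Both sides have the same partial sums, because preimages of initial segments under a monotone
  map are initial segments.\<close>

lemma push_simplex_cut:
  assumes th: "\<theta> \<in> simplicial_ops m n" and s: "0 \<le> s"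
  shows "push_simplex m \<theta> (cut s t) j = cut s (push_simplex m \<theta> t) j"
proof -
  have *: "(\<Sum>j\<in>J. push_simplex m \<theta> (cut s t) j) = min s (\<Sum>j\<in>J. push_simplex m \<theta> t j)"
    if J: "finite J" "\<And>a b. a \<le> b \<Longrightarrow> b \<in> J \<Longrightarrow> a \<in> J" for J
  proof -
    obtain k where k: "{i. i \<le> m \<and> \<theta> i \<in> J} = {..<k}"
      using initial_segment[of m "\<lambda>i. \<theta> i \<in> J"] J(2) opsD(1)[OF th] by blast
    show ?thesis using J(1) by (simp add: sum_push_simplex k sum_cut s)
  qed
  have "push_simplex m \<theta> (cut s t) j =
      (\<Sum>j\<le>j. push_simplex m \<theta> (cut s t) j) - (\<Sum>j<j. push_simplex m \<theta> (cut s t) j)"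
    by (simp flip: lessThan_Suc_atMost)
  also have "\<dots> = cut s (push_simplex m \<theta> t) j"
    using *[of "{..j}"] *[of "{..<j}"] by (auto simp: cut_def)
  finally show ?thesis .
qed

text \<open>Every vertex is doubled: copy \<open>i\<close> receives the length below
  \<open>s\<close>, copy \<open>i + Suc n\<close> the remainder. The offset \<open>Suc n\<close>
  puts all second copies after the first ones, hence the dimension \<open>2 * n + 1\<close>.\<close>

definition split_weights :: "nat \<Rightarrow> real \<Rightarrow> (nat \<Rightarrow> real) \<Rightarrow> nat \<Rightarrow> real" where
  "split_weights n s t i = (if i \<le> n then cut s t i
     else if i \<le> 2 * n + 1 then t (i - Suc n) - cut s t (i - Suc n) else 0)"

lemma sum_double:
  fixes f :: "nat \<Rightarrow> real"
  shows "(\<Sum>i | i \<le> 2 * n + 1 \<and> Q i. f i) = (\<Sum>i | i \<le> n \<and> Q i. f i) + (\<Sum>i | i \<le> n \<and> Q (i + Suc n). f (i + Suc n))"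
proof -
  have e: "{i. i \<le> 2 * n + 1 \<and> Q i} = {i. i \<le> n \<and> Q i} \<union> (\<lambda>i. i + Suc n) ` {i. i \<le> n \<and> Q (i + Suc n)}"
  proof (rule subset_antisym; rule subsetI)
    fix i assume "i \<in> {i. i \<le> 2 * n + 1 \<and> Q i}"
    moreover have "i = (i - Suc n) + Suc n" if "\<not> i \<le> n" using that by simp
    ultimately show "i \<in> {i. i \<le> n \<and> Q i} \<union> (\<lambda>i. i + Suc n) ` {i. i \<le> n \<and> Q (i + Suc n)}"
      by (cases "i \<le> n") (auto simp del: add_Suc_right intro!: image_eqI[of _ _ "i - Suc n"])
  qed auto
  show ?thesis unfolding e
    by (subst sum.union_disjoint) (auto simp: sum.reindex inj_on_def)
qed

lemma split_weights_closed:
  assumes t: "t \<in> standard_simplex n" and s: "0 \<le> s"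
  shows "split_weights n s t \<in> standard_simplex (2 * n + 1)"
proof (rule standard_simplexI)
  have "(\<Sum>i\<le>2 * n + 1. split_weights n s t i) = (\<Sum>i\<le>n. cut s t i) + (\<Sum>i\<le>n. t i - cut s t i)"
    using sum_double[where n = n and Q = "\<lambda>_. True" and f = "split_weights n s t"]
    by (simp add: split_weights_def atMost_def)
  then show "(\<Sum>i\<le>2 * n + 1. split_weights n s t i) = 1"
    using standard_simplexD(4)[OF t] by (simp add: sum_subtractf)
qed (use cut_bounds standard_simplexD(1)[OF t] in \<open>auto simp: split_weights_def\<close>)

text \<open>Since cutting commutes with pushing forward, splitting commutes with the ordinal sum of
  \<open>\<theta>\<close> with itself. This is what lets the deformation respect the gluing
  relation.\<close>

lemma push_simplex_split:
  assumes th: "\<theta> \<in> simplicial_ops m n" and s: "0 \<le> s"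
  shows "push_simplex (2 * m + 1) (\<lambda>i. if i \<le> m then \<theta> i else \<theta> (i - Suc m) + Suc n) (split_weights m s t)
    = split_weights n s (push_simplex m \<theta> t)"
proof
  fix j
  let ?th = "\<lambda>i. if i \<le> m then \<theta> i else \<theta> (i - Suc m) + Suc n"
  have le: "\<theta> i \<le> n" if "i \<le> m" for i using opsD(2)[OF th order_refl that] .
  have "push_simplex (2 * m + 1) ?th (split_weights m s t) j
      = (\<Sum>i | i \<le> m \<and> \<theta> i = j. cut s t i) + (\<Sum>i | i \<le> m \<and> \<theta> i + Suc n = j. t i - cut s t i)"
    unfolding push_simplex_def sum_double
    by (intro arg_cong2[of _ _ _ _ "(+)"] sum.cong) (auto simp: split_weights_def)
  also have "\<dots> = split_weights n s (push_simplex m \<theta> t) j"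
  proof -
    consider "j \<le> n" | "n < j" "j \<le> 2 * n + 1" | "2 * n + 1 < j" by linarith
    then show ?thesis
    proof cases
      case 1
      then have "{i. i \<le> m \<and> \<theta> i + Suc n = j} = {}" by auto
      then show ?thesis using 1 push_simplex_cut[OF th s, of t j]
        by (simp add: split_weights_def push_simplex_def)
    next
      case 2
      have e: "{i. i \<le> m \<and> \<theta> i = j} = {}" "{i. i \<le> m \<and> \<theta> i + Suc n = j} = {i. i \<le> m \<and> \<theta> i = j - Suc n}"
        using le 2 by force+
      show ?thesis unfolding e using 2 push_simplex_cut[OF th s, of t "j - Suc n"]
        by (simp add: split_weights_def push_simplex_def sum_subtractf)
    next
      case 3
      then have "{i. i \<le> m \<and> \<theta> i = j} = {}" "{i. i \<le> m \<and> \<theta> i + Suc n = j} = {}"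
        using le by force+
      then show ?thesis using 3 by (simp only: split_weights_def) simp
    qed
  qed
  finally show "push_simplex (2 * m + 1) ?th (split_weights m s t) j = split_weights n s (push_simplex m \<theta> t) j" .
qed

lemma double_op:
  assumes th: "\<theta> \<in> simplicial_ops m n"
  shows "(\<lambda>i. if i \<le> m then \<theta> i else \<theta> (i - Suc m) + Suc n) \<in> simplicial_ops (2 * m + 1) (2 * n + 1)"
proof -
  have le: "\<theta> i \<le> n" if "i \<le> m" for i using opsD(2)[OF th order_refl that] .
  have mo: "\<theta> i \<le> \<theta> j" if "i \<le> j" "j \<le> m" for i j using opsD(1)[OF th that] .
  have 1: "\<theta> (i - Suc m) \<le> n" if "i \<le> 2 * m + 1" for i
    using le[of "i - Suc m"] that by simp
  show ?thesis
    unfolding simplicial_ops_def mono_on_def Pi_iff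
    using le 1 by (force intro: mo dest: le)
qed

lemma split_weights_pos:
  assumes "split_weights n s t i \<noteq> 0" "\<And>i. 0 \<le> t i"
  shows "if i \<le> n then t i \<noteq> 0 else i \<le> 2 * n + 1 \<and> t (i - Suc n) \<noteq> 0"
  using assms cut_bounds[of t i s] cut_bounds[of t "i - Suc n" s]
  by (auto simp: split_weights_def split: if_splits)

text \<open>Index of an interval containing \<open>s\<close>. At a common endpoint the smallest
  index is taken, but later arguments use only the bound by \<open>n\<close> and the two closed
  inequalities of the next lemma.\<close>

definition piece :: "real \<Rightarrow> (nat \<Rightarrow> real) \<Rightarrow> nat" where
  "piece s t = (LEAST k. s \<le> (\<Sum>i\<le>k. t i))"

lemma piece:
  assumes t: "t \<in> standard_simplex n" and s: "0 \<le> s" "s \<le> 1"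
  shows "piece s t \<le> n" "(\<Sum>i<piece s t. t i) \<le> s" "s \<le> (\<Sum>i\<le>piece s t. t i)"
proof -
  have n: "s \<le> (\<Sum>i\<le>n. t i)" using standard_simplexD(4)[OF t] s by simp
  show "piece s t \<le> n" unfolding piece_def by (rule Least_le) (rule n)
  show "s \<le> (\<Sum>i\<le>piece s t. t i)" unfolding piece_def by (rule LeastI[where P = "\<lambda>k. s \<le> (\<Sum>i\<le>k. t i)", OF n])
  show "(\<Sum>i<piece s t. t i) \<le> s"
  proof (cases "piece s t")
    case (Suc l)
    then have "\<not> s \<le> (\<Sum>i\<le>l. t i)"
      using not_less_Least[of l "\<lambda>k. s \<le> (\<Sum>i\<le>k. t i)"] by (simp add: piece_def)
    then show ?thesis by (simp add: Suc lessThan_Suc_atMost)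
  qed (use s in simp)
qed

text \<open>Intervals after the \<open>k\<close>-th lie above \<open>s\<close>, so nothing of them
  is cut off; intervals before it lie below \<open>s\<close>, so nothing of them remains.\<close>

lemma split_weights_piece:
  assumes nz: "split_weights n s t i \<noteq> 0" and t: "\<And>i. 0 \<le> t i"
    and k: "(\<Sum>i<k. t i) \<le> s" "s \<le> (\<Sum>i\<le>k. t i)"
  shows "if i \<le> n then i \<le> k else k \<le> i - Suc n"
proof -
  have 1: "j \<le> k" if "cut s t j \<noteq> 0" for j
  proof (rule ccontr)
    assume "\<not> j \<le> k"
    then have "(\<Sum>i\<le>k. t i) \<le> (\<Sum>i<j. t i)" "(\<Sum>i\<le>k. t i) \<le> (\<Sum>i\<le>j. t i)"
      using t by (auto intro!: sum_mono2)
    then show False using that k by (simp add: cut_def)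
  qed
  have 2: "k \<le> j" if "t j - cut s t j \<noteq> 0" for j
  proof (rule ccontr)
    assume "\<not> k \<le> j"
    then have "(\<Sum>i<j. t i) \<le> (\<Sum>i<k. t i)" "(\<Sum>i\<le>j. t i) \<le> (\<Sum>i<k. t i)"
      using t by (auto intro!: sum_mono2)
    moreover have "(\<Sum>i\<le>j. t i) = (\<Sum>i<j. t i) + t j" by (simp flip: lessThan_Suc_atMost)
    ultimately show False using that k by (simp add: cut_def)
  qed
  show ?thesis using nz 1[of i] 2[of "i - Suc n"] by (auto simp: split_weights_def split: if_splits)
qed

text \<open>Nonnegative weights in one fibre of \<open>\<theta>\<close> cannot cancel.\<close>

lemma push_simplex_pos:
  assumes "t i \<noteq> 0" "\<And>i. 0 \<le> t i" "i \<le> m"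
  shows "push_simplex m \<theta> t (\<theta> i) \<noteq> 0"
proof -
  have "t i \<le> push_simplex m \<theta> t (\<theta> i)"
    unfolding push_simplex_def by (rule member_le_sum) (use assms in auto)
  then show ?thesis using assms(1) assms(2)[of i] by simp
qed

lemma continuous_map_split_weights:
  assumes s: "continuous_map W euclideanreal s" and t: "continuous_map W (powertop_real UNIV) t"
  shows "continuous_map W (powertop_real UNIV) (\<lambda>w. split_weights n (s w) (t w))"
proof -
  have t: "continuous_map W euclideanreal (\<lambda>w. t w i)" for i
    using t by (simp add: continuous_map_componentwise_UNIV)
  have c: "continuous_map W euclideanreal (\<lambda>w. cut (s w) (t w) i)" for i
    unfolding cut_def by (intro continuous_intros continuous_map_real_min s t) auto
  show ?thesis
    unfolding continuous_map_componentwise_UNIV split_weights_def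
    by (auto intro!: continuous_intros c t)
qed

section \<open>Realizations of nerves of preordered sets\<close>

text \<open>All pairs \<open>i \<le> j\<close> are compared, including \<open>i = j\<close>, so that
  closure under monotone reindexing holds for an arbitrary relation \<open>R\<close>.\<close>

definition chains :: "('y \<Rightarrow> 'y \<Rightarrow> bool) \<Rightarrow> 'y set \<Rightarrow> nat \<Rightarrow> (nat \<Rightarrow> 'y) set" where
  "chains R Y n = {c \<in> {..n} \<rightarrow>\<^sub>E Y. \<forall>i j. i \<le> j \<longrightarrow> j \<le> n \<longrightarrow> R (c i) (c j)}"

lemma chainsD:
  assumes "c \<in> chains R Y n"
  shows "i \<le> n \<Longrightarrow> c i \<in> Y" "i \<le> j \<Longrightarrow> j \<le> n \<Longrightarrow> R (c i) (c j)" "restrict c {..n} = c"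
  using assms by (auto simp: chains_def PiE_def extensional_restrict)

lemma chainsI:
  assumes "\<And>i. i \<le> n \<Longrightarrow> c i \<in> Y" "\<And>i j. i \<le> j \<Longrightarrow> j \<le> n \<Longrightarrow> R (c i) (c j)"
  shows "restrict c {..n} \<in> chains R Y n"
  using assms by (auto simp: chains_def)

text \<open>\<open>enc\<close> presents \<open>X\<close> as the nerve of \<open>R\<close> on
  \<open>Y\<close>, with structure maps and action computed vertexwise. Arguments about the
  realization then never meet the objects, arrows and transport maps of the homotopy
  colimit.\<close>

locale chain_model = group G
  for G :: "('g, 'b) monoid_scheme" +
  fixes X :: "('g, 's) gsset"
    and Y :: "'y set" and R :: "'y \<Rightarrow> 'y \<Rightarrow> bool" and act :: "'g \<Rightarrow> 'y \<Rightarrow> 'y"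
    and enc :: "nat \<Rightarrow> (nat \<Rightarrow> 'y) \<Rightarrow> 's"
  assumes enc_bij: "bij_betw (enc n) (chains R Y n) (simplices X n)"
    and pull_enc: "\<lbrakk>\<theta> \<in> simplicial_ops m n; c \<in> chains R Y n\<rbrakk>
      \<Longrightarrow> pull X m n \<theta> (enc n c) = enc m (\<lambda>i\<in>{..m}. c (\<theta> i))"
    and sact_enc: "\<lbrakk>g \<in> carrier G; c \<in> chains R Y n\<rbrakk>
      \<Longrightarrow> sact X n g (enc n c) = enc n (\<lambda>i\<in>{..n}. act g (c i))"
    and act_closed: "\<lbrakk>g \<in> carrier G; y \<in> Y\<rbrakk> \<Longrightarrow> act g y \<in> Y"
    and act_mult: "\<lbrakk>g \<in> carrier G; h \<in> carrier G; y \<in> Y\<rbrakk> \<Longrightarrow> act g (act h y) = act (g \<otimes>\<^bsub>G\<^esub> h) y"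
    and act_one: "y \<in> Y \<Longrightarrow> act \<one>\<^bsub>G\<^esub> y = y"
    and act_mono: "\<lbrakk>g \<in> carrier G; y \<in> Y; y' \<in> Y; R y y'\<rbrakk> \<Longrightarrow> R (act g y) (act g y')"
begin

definition pt :: "nat \<Rightarrow> (nat \<Rightarrow> 'y) \<Rightarrow> (nat \<Rightarrow> real) \<Rightarrow> (nat \<times> 's) \<times> (nat \<Rightarrow> real)" where
  "pt n c t = ((n, enc n c), t)"

definition dec :: "nat \<Rightarrow> 's \<Rightarrow> nat \<Rightarrow> 'y" where
  "dec n = inv_into (chains R Y n) (enc n)"

lemma dec_enc [simp]: "c \<in> chains R Y n \<Longrightarrow> dec n (enc n c) = c"
  unfolding dec_def using enc_bij by (simp add: bij_betw_def)

lemma enc_in: "c \<in> chains R Y n \<Longrightarrow> enc n c \<in> simplices X n"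
  using enc_bij by (auto simp: bij_betw_def)

lemma simplexE:
  assumes "x \<in> simplices X n" obtains c where "c \<in> chains R Y n" "x = enc n c"
  using assms enc_bij[of n] by (auto simp: bij_betw_def)

lemma pt_in: "c \<in> chains R Y n \<Longrightarrow> t \<in> standard_simplex n \<Longrightarrow> pt n c t \<in> topspace (simplex_space X)"
  by (simp add: pt_def topspace_simplex_space enc_in)

lemma pointE:
  assumes "z \<in> topspace (simplex_space X)"
  obtains n c t where "z = pt n c t" "c \<in> chains R Y n" "t \<in> standard_simplex n"
  using assms by (auto simp: topspace_simplex_space pt_def elim!: simplexE)

lemma chain_pull:
  assumes "\<theta> \<in> simplicial_ops m n" "c \<in> chains R Y n"
  shows "(\<lambda>i\<in>{..m}. c (\<theta> i)) \<in> chains R Y m"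
  by (rule chainsI) (use opsD[OF assms(1)] opsD(2)[OF assms(1) order_refl] chainsD[OF assms(2)] in auto)

lemma chain_act:
  assumes "g \<in> carrier G" "c \<in> chains R Y n"
  shows "(\<lambda>i\<in>{..n}. act g (c i)) \<in> chains R Y n"
  by (rule chainsI) (use assms chainsD[OF assms(2)] in \<open>auto intro!: act_closed act_mono\<close>)

section \<open>Gluing classes and their step functions\<close>

lemma mem_class_iff: "z' \<in> simplex_class X z \<longleftrightarrow> simplex_class X z = simplex_class X z'"
proof
  let ?r = "(simplex_glue X \<union> (simplex_glue X)\<inverse>)\<^sup>*"
  assume "z' \<in> simplex_class X z"
  then have 1: "(z, z') \<in> ?r" by (simp add: simplex_class_def)
  have "sym ?r" by (rule sym_rtrancl) (auto simp: sym_def)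
  then have 2: "(z', z) \<in> ?r" using 1 by (rule symD)
  show "simplex_class X z = simplex_class X z'"
    unfolding simplex_class_def using rtrancl_trans[OF 1] rtrancl_trans[OF 2] by blast
qed (simp add: simplex_class_def)

lemma class_glue:
  assumes "\<theta> \<in> simplicial_ops m n" "c \<in> chains R Y n" "t \<in> standard_simplex m"
  shows "simplex_class X (pt m (\<lambda>i\<in>{..m}. c (\<theta> i)) t) = simplex_class X (pt n c (push_simplex m \<theta> t))"
proof -
  have "(pt m (\<lambda>i\<in>{..m}. c (\<theta> i)) t, pt n c (push_simplex m \<theta> t)) \<in> simplex_glue X"
    using assms enc_in[OF assms(2)] pull_enc[OF assms(1,2)] unfolding simplex_glue_def pt_def
    by (auto intro!: exI[of _ \<theta>] exI[of _ "enc n c"])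
  then have "pt n c (push_simplex m \<theta> t) \<in> simplex_class X (pt m (\<lambda>i\<in>{..m}. c (\<theta> i)) t)"
    unfolding simplex_class_def by auto
  then show ?thesis by (simp add: mem_class_iff)
qed

text \<open>Gluing classes are generated by zigzags, so invariance under one elementary gluing
  suffices. Functions and predicates on representatives descend to the realization in this
  way.\<close>

lemma class_invariant:
  assumes F: "\<And>\<theta> m n c t. \<lbrakk>\<theta> \<in> simplicial_ops m n; c \<in> chains R Y n; t \<in> standard_simplex m\<rbrakk>
      \<Longrightarrow> F (pt m (\<lambda>i\<in>{..m}. c (\<theta> i)) t) = F (pt n c (push_simplex m \<theta> t))"
    and eq: "simplex_class X z = simplex_class X z'"
  shows "F z = F z'"
proof -
  have 1: "F a = F b" if "(a, b) \<in> simplex_glue X" for a b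
    using that F by (auto simp: simplex_glue_def pull_enc pt_def elim!: simplexE)
  have "z' \<in> simplex_class X z" using eq by (auto simp: simplex_class_def)
  then have "(z, z') \<in> (simplex_glue X \<union> (simplex_glue X)\<inverse>)\<^sup>*" by (simp add: simplex_class_def)
  then show ?thesis by induction (auto dest: 1)
qed

lemma class_topspace:
  assumes "simplex_class X z = simplex_class X z'"
  shows "z \<in> topspace (simplex_space X) \<longleftrightarrow> z' \<in> topspace (simplex_space X)"
  by (rule class_invariant[OF _ assms]) (simp add: pt_in chain_pull push_closed)

text \<open>The retraction \<open>\<theta>\<close> onto the support of \<open>t\<close> satisfies \<open>\<theta>\<^sub>* t = t\<close>, and \<open>c \<circ> \<theta>\<close> only depends
  on the values of \<open>c\<close> on the support.\<close>

lemma class_support_cong: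
  assumes c: "c \<in> chains R Y n" "c' \<in> chains R Y n" and t: "t \<in> standard_simplex n"
    and eq: "\<And>i. i \<le> n \<Longrightarrow> t i \<noteq> 0 \<Longrightarrow> c i = c' i"
  shows "simplex_class X (pt n c t) = simplex_class X (pt n c' t)"
proof -
  define S where "S = {i. i \<le> n \<and> t i \<noteq> 0}"
  obtain k where k: "k \<in> S" using standard_simplex_support[OF t] by (auto simp: S_def)
  \<comment> \<open>Each vertex moves down to the nearest support vertex. Vertices before the
    support have none below them and go to \<open>Min S\<close>, which keeps \<open>\<theta>\<close>
    monotone.\<close>
  define \<theta> where "\<theta> i = (if \<exists>j\<in>S. j \<le> i then Max {j \<in> S. j \<le> i} else Min S)" for i
  have fin: "finite S" "finite {j \<in> S. j \<le> i}" for i by (auto simp: S_def)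
  have inS: "\<theta> i \<in> S" for i
    using Max_in[OF fin(2)[of i]] Min_in[OF fin(1)] k unfolding \<theta>_def by fastforce
  have retr: "\<theta> i = i" if "i \<in> S" for i
    unfolding \<theta>_def using that fin by (auto intro: Max_eqI)
  have mono: "\<theta> i \<le> \<theta> j" if "i \<le> j" for i j
  proof (cases "\<exists>k\<in>S. k \<le> i")
    case True
    moreover from True have "\<exists>k\<in>S. k \<le> j" using that by (meson order_trans)
    moreover have "Max {k \<in> S. k \<le> i} \<le> Max {k \<in> S. k \<le> j}"
      by (rule Max_mono) (use fin True that in auto)
    ultimately show ?thesis by (simp add: \<theta>_def)
  next
    case False
    then have "\<theta> i = Min S" by (auto simp: \<theta>_def)
    then show ?thesis using Min_le[OF fin(1) inS[of j]] by simp
  qed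
  have ops: "\<theta> \<in> simplicial_ops n n"
    using inS mono by (auto simp: simplicial_ops_def mono_on_def S_def)
  have "push_simplex n \<theta> t = t"
  proof
    fix j
    have "push_simplex n \<theta> t j = (\<Sum>i\<in>{..n}. if \<theta> i = j then t i else 0)"
      unfolding push_simplex_def by (subst sum.inter_filter[symmetric]) auto
    also have "\<dots> = (\<Sum>i\<in>{..n}. if i = j then t i else 0)"
    proof (rule sum.cong[OF refl])
      fix i assume "i \<in> {..n}"
      then show "(if \<theta> i = j then t i else 0) = (if i = j then t i else 0)"
        using retr[of i] by (cases "t i = 0") (auto simp: S_def)
    qed
    also have "\<dots> = t j" using standard_simplexD(3)[OF t, of j] by auto
    finally show "push_simplex n \<theta> t j = t j" .
  qed
  moreover have "(\<lambda>i\<in>{..n}. c (\<theta> i)) = (\<lambda>i\<in>{..n}. c' (\<theta> i))"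
    using inS eq by (auto simp: S_def)
  ultimately show ?thesis using class_glue[OF ops c(1) t] class_glue[OF ops c(2) t] by simp
qed

text \<open>A point of the realization determines a step function on \<open>[0, 1)\<close>, taking the values
  \<open>c 0, \<dots>, c n\<close> on consecutive intervals of lengths \<open>t 0, \<dots>, t n\<close>.\<close>

definition step_function :: "(nat \<times> 's) \<times> (nat \<Rightarrow> real) \<Rightarrow> real \<Rightarrow> 'y" where
  "step_function = (\<lambda>((n, x), t) r. dec n x (LEAST k. r < (\<Sum>i\<le>k. t i)))"

text \<open>By monotonicity of \<open>\<theta>\<close>, the interval of \<open>j\<close> after
  pushing forward is the union of the consecutive intervals of the vertices sent to
  \<open>j\<close>. The bound \<open>r < 1\<close> guarantees that the defining index exists and is
  at most the dimension.\<close>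

lemma step_function_class:
  assumes eq: "simplex_class X z = simplex_class X z'" and r: "0 \<le> r" "r < 1"
  shows "step_function z r = step_function z' r"
proof (rule class_invariant[OF _ eq])
  fix \<theta> m n c t assume th: "\<theta> \<in> simplicial_ops m n" and c: "c \<in> chains R Y n" and t: "t \<in> standard_simplex m"
  define k where "k = (LEAST k. r < (\<Sum>i\<le>k. t i))"
  have ex: "r < (\<Sum>i\<le>m. t i)" using standard_simplexD(4)[OF t] r by simp
  then have km: "k \<le> m" unfolding k_def by (rule Least_le)
  have k: "r < (\<Sum>i\<le>k. t i)" unfolding k_def by (rule LeastI) (rule ex)
  have *: "(\<Sum>j\<le>j. push_simplex m \<theta> t j) = (\<Sum>i | i \<le> m \<and> \<theta> i \<le> j. t i)" for j
    using sum_push_simplex[of "{..j}" m \<theta> t] by simp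
  have "(LEAST j. r < (\<Sum>j\<le>j. push_simplex m \<theta> t j)) = \<theta> k"
  proof (rule Least_equality)
    have "(\<Sum>i\<le>k. t i) \<le> (\<Sum>i | i \<le> m \<and> \<theta> i \<le> \<theta> k. t i)"
      by (rule sum_mono2) (use km opsD(1)[OF th] standard_simplexD(1)[OF t] in auto)
    then show "r < (\<Sum>j\<le>\<theta> k. push_simplex m \<theta> t j)" using k * by simp
  next
    fix j assume j: "r < (\<Sum>j\<le>j. push_simplex m \<theta> t j)"
    show "\<theta> k \<le> j"
    proof (rule ccontr)
      assume "\<not> \<theta> k \<le> j"
      \<comment> \<open>Weight pushed into \<open>{..j}\<close> comes from vertices before
        \<open>k\<close> only, and their total is at most \<open>r\<close> by minimality of
        \<open>k\<close>.\<close>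
      then have "i < k" if "i \<le> m" "\<theta> i \<le> j" for i
        using opsD(1)[OF th, of k i] that by (meson not_le order_trans)
      then have sub: "{i. i \<le> m \<and> \<theta> i \<le> j} \<subseteq> {..<k}" by auto
      have "\<not> r < (\<Sum>i<k. t i)"
      proof (cases k)
        case (Suc l)
        then have "\<not> r < (\<Sum>i\<le>l. t i)" using not_less_Least[of l "\<lambda>k. r < (\<Sum>i\<le>k. t i)"] by (simp add: k_def)
        then show ?thesis by (simp add: Suc lessThan_Suc_atMost)
      qed (use r in simp)
      moreover have "(\<Sum>i | i \<le> m \<and> \<theta> i \<le> j. t i) \<le> (\<Sum>i<k. t i)"
        by (rule sum_mono2) (use sub standard_simplexD(1)[OF t] in auto)
      ultimately show False using j * by simp
    qed
  qed
  then show "step_function (pt m (\<lambda>i\<in>{..m}. c (\<theta> i)) t) r = step_function (pt n c (push_simplex m \<theta> t)) r"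
    using c chain_pull[OF th c] km by (simp add: step_function_def pt_def flip: k_def)
qed

text \<open>The half-open interval of a vertex with positive weight is nonempty and contains its
  left endpoint, so the vertex can be recovered from the class.\<close>

lemma step_function_vertex:
  assumes c: "c \<in> chains R Y n" and t: "t \<in> standard_simplex n" and i: "t i \<noteq> 0"
  shows "step_function (pt n c t) (\<Sum>k<i. t k) = c i" "0 \<le> (\<Sum>k<i. t k)" "(\<Sum>k<i. t k) < 1"
proof -
  have pos: "0 \<le> t k" for k using standard_simplexD(1)[OF t] .
  have "i \<le> n" using standard_simplexD(3)[OF t, of i] i by force
  have e: "(\<Sum>k\<le>i. t k) = (\<Sum>k<i. t k) + t i" by (simp flip: lessThan_Suc_atMost)
  have lt: "(\<Sum>k<i. t k) < (\<Sum>k\<le>i. t k)" using i pos[of i] unfolding e by simp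
  have "(\<Sum>k\<le>i. t k) \<le> (\<Sum>k\<le>n. t k)" using \<open>i \<le> n\<close> pos by (intro sum_mono2) auto
  with lt show "(\<Sum>k<i. t k) < 1" using standard_simplexD(4)[OF t] by simp
  show "0 \<le> (\<Sum>k<i. t k)" by (simp add: pos sum_nonneg)
  have "(LEAST k. (\<Sum>k<i. t k) < (\<Sum>i\<le>k. t i)) = i"
  proof (rule Least_equality[where P = "\<lambda>k. (\<Sum>k<i. t k) < (\<Sum>i\<le>k. t i)", OF lt])
    fix j assume j: "(\<Sum>k<i. t k) < (\<Sum>i\<le>j. t i)"
    show "i \<le> j"
    proof (rule ccontr)
      assume "\<not> i \<le> j"
      then have "(\<Sum>i\<le>j. t i) \<le> (\<Sum>k<i. t k)" using pos by (intro sum_mono2) auto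
      with j show False by simp
    qed
  qed
  then show "step_function (pt n c t) (\<Sum>k<i. t k) = c i" using c by (simp add: step_function_def pt_def)
qed

section \<open>The action on points before gluing\<close>

definition point_act :: "'g \<Rightarrow> (nat \<times> 's) \<times> (nat \<Rightarrow> real) \<Rightarrow> (nat \<times> 's) \<times> (nat \<Rightarrow> real)" where
  "point_act g = (\<lambda>((n, x), t). ((n, sact X n g x), t))"

lemma point_act_pt:
  "g \<in> carrier G \<Longrightarrow> c \<in> chains R Y n \<Longrightarrow> point_act g (pt n c t) = pt n (\<lambda>i\<in>{..n}. act g (c i)) t"
  by (simp add: point_act_def pt_def sact_enc)

lemma point_act_closed:
  assumes "g \<in> carrier G" "z \<in> topspace (simplex_space X)"
  shows "point_act g z \<in> topspace (simplex_space X)"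
  using assms(2) by (rule pointE) (simp add: assms(1) point_act_pt pt_in chain_act)

lemma point_act_mult:
  assumes g: "g \<in> carrier G" "h \<in> carrier G" and z: "z \<in> topspace (simplex_space X)"
  shows "point_act g (point_act h z) = point_act (g \<otimes>\<^bsub>G\<^esub> h) z"
  using z
proof (rule pointE)
  fix n c t assume *: "z = pt n c t" "c \<in> chains R Y n"
  have "(\<lambda>i\<in>{..n}. act g ((\<lambda>i\<in>{..n}. act h (c i)) i)) = (\<lambda>i\<in>{..n}. act (g \<otimes>\<^bsub>G\<^esub> h) (c i))"
    using chainsD(1)[OF *(2)] g by (auto simp: act_mult)
  then show ?thesis using * g by (simp add: point_act_pt chain_act)
qed

lemma point_act_one:
  assumes z: "z \<in> topspace (simplex_space X)"
  shows "point_act \<one>\<^bsub>G\<^esub> z = z"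
  using z
proof (rule pointE)
  fix n c t assume *: "z = pt n c t" "c \<in> chains R Y n"
  have "(\<lambda>i\<in>{..n}. act \<one>\<^bsub>G\<^esub> (c i)) = restrict c {..n}"
    using chainsD(1)[OF *(2)] by (auto simp: act_one)
  then show ?thesis using * chainsD(3)[OF *(2)] by (simp add: point_act_pt)
qed

lemma point_act_class:
  assumes g: "g \<in> carrier G" and eq: "simplex_class X z = simplex_class X z'"
  shows "simplex_class X (point_act g z) = simplex_class X (point_act g z')"
proof (rule class_invariant[OF _ eq])
  fix \<theta> m n c t assume h: "\<theta> \<in> simplicial_ops m n" "c \<in> chains R Y n" "t \<in> standard_simplex m"
  have "(\<lambda>i\<in>{..m}. act g ((\<lambda>i\<in>{..m}. c (\<theta> i)) i)) = (\<lambda>i\<in>{..m}. (\<lambda>i\<in>{..n}. act g (c i)) (\<theta> i))"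
    using opsD(2)[OF h(1) order_refl] by (intro restrict_cong) (auto simp: simp_implies_def)
  then show "simplex_class X (point_act g (pt m (\<lambda>i\<in>{..m}. c (\<theta> i)) t)) =
      simplex_class X (point_act g (pt n c (push_simplex m \<theta> t)))"
    using class_glue[OF h(1) chain_act[OF g h(2)] h(3)] g h
    by (simp add: point_act_pt chain_pull)
qed

lemma topspace_realization: "topspace (realization X) = simplex_class X ` topspace (simplex_space X)"
  by (simp add: realization_def)

text \<open>The action respects gluing, so \<open>g\<close> maps a class into a single class;
  applying the inverse of \<open>g\<close> gives the reverse inclusion.\<close>

lemma realization_act_class:
  assumes g: "g \<in> carrier G" and z: "z \<in> topspace (simplex_space X)"
  shows "realization_act X g (simplex_class X z) = simplex_class X (point_act g z)"
proof -
  have "realization_act X g (simplex_class X z) = point_act g ` simplex_class X z"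
    using z unfolding realization_act_def point_act_def by (simp add: topspace_realization)
  also have "\<dots> = simplex_class X (point_act g z)"
  proof (intro subset_antisym subsetI)
    fix w assume "w \<in> simplex_class X (point_act g z)"
    then have w: "simplex_class X (point_act g z) = simplex_class X w" by (simp add: mem_class_iff)
    then have "w \<in> topspace (simplex_space X)" using class_topspace point_act_closed[OF g z] by blast
    then have "w = point_act g (point_act (inv\<^bsub>G\<^esub> g) w)"
      using g by (simp add: point_act_mult point_act_one)
    moreover have "simplex_class X z = simplex_class X (point_act (inv\<^bsub>G\<^esub> g) w)"
      using point_act_class[OF inv_closed[OF g] w] g z by (simp add: point_act_mult point_act_one)
    ultimately show "w \<in> point_act g ` simplex_class X z" by (auto simp: mem_class_iff)
  next
    fix w assume "w \<in> point_act g ` simplex_class X z"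
    then obtain w' where w': "w' \<in> simplex_class X z" "w = point_act g w'" by blast
    show "w \<in> simplex_class X (point_act g z)"
      using point_act_class[OF g, of z w'] w' by (simp add: mem_class_iff)
  qed
  finally show ?thesis .
qed

end

section \<open>Topology of the disjoint union of simplices\<close>

lemma openin_simplex_piece:
  assumes "x \<in> simplices X n"
  shows "openin (simplex_space X) ({(n, x)} \<times> standard_simplex n)"
proof -
  have "openin (subtopology (powertop_real UNIV) (standard_simplex m)) {t. ((m, y), t) \<in> {(n, x)} \<times> standard_simplex n}" for m y
    using openin_topspace[of "subtopology (powertop_real UNIV) (standard_simplex n)"]
    by (cases "(m, y) = (n, x)") auto
  then show ?thesis using assms by (auto simp: simplex_space_def openin_sum_topology)
qed

lemma continuous_map_snd_simplex_space: "continuous_map (simplex_space X) (powertop_real UNIV) snd"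
proof -
  have "openin (subtopology (powertop_real UNIV) (standard_simplex n)) {t \<in> standard_simplex n. t \<in> U}"
    if "openin (powertop_real UNIV) U" for n U
    using that by (auto simp: openin_subtopology intro!: exI[of _ U])
  then show ?thesis
    unfolding continuous_map_def simplex_space_def openin_sum_topology
    by (auto simp: Collect_conj_eq)
qed

lemma continuous_map_into_simplex_piece:
  assumes "x \<in> simplices X n" "continuous_map W (powertop_real UNIV) f"
    "\<And>w. w \<in> topspace W \<Longrightarrow> f w \<in> standard_simplex n"
  shows "continuous_map W (simplex_space X) (\<lambda>w. ((n, x), f w))"
proof -
  have "continuous_map W (subtopology (powertop_real UNIV) (standard_simplex n)) f"
    using assms by (auto simp: continuous_map_in_subtopology)
  moreover have "continuous_map (subtopology (powertop_real UNIV) (standard_simplex n)) (simplex_space X) (\<lambda>t. ((n, x), t))"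
    unfolding simplex_space_def
    using continuous_map_component_injection[of "(n, x)" "SIGMA n:UNIV. simplices X n"
      "\<lambda>(n, x). subtopology (powertop_real UNIV) (standard_simplex n)"] assms(1) by simp
  ultimately have "continuous_map W (simplex_space X) ((\<lambda>t. ((n, x), t)) \<circ> f)"
    by (rule continuous_map_compose)
  then show ?thesis by (simp add: comp_def)
qed

section \<open>Fixed points and deformations\<close>

text \<open>\<open>fixed_down\<close> models that a subset of a set centralizing \<open>P\<close>
  centralizes \<open>P\<close>: along \<open>R\<close> the images of the embeddings shrink.\<close>

locale fixed_chain_model = chain_model G X Y R act enc
  for G :: "('g, 'b) monoid_scheme" and X :: "('g, 's) gsset"
    and Y :: "'y set" and R act enc +
  fixes P :: "'g set"
  assumes P_sub: "P \<subseteq> carrier G"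
    and fixed_down: "\<lbrakk>y \<in> Y; y' \<in> Y; R y y'; \<forall>g\<in>P. act g y = y; g \<in> P\<rbrakk> \<Longrightarrow> act g y' = y'"
begin

definition YP :: "'y set" where "YP = {y \<in> Y. \<forall>g\<in>P. act g y = y}"

definition XP :: "((nat \<times> 's) \<times> (nat \<Rightarrow> real)) set set" where
  "XP = {w \<in> topspace (realization X). \<forall>g\<in>P. w \<in> invariants (topspace (realization X)) (realization_act X) g}"

definition pre_XP :: "((nat \<times> 's) \<times> (nat \<Rightarrow> real)) set" where
  "pre_XP = {z \<in> topspace (simplex_space X). simplex_class X z \<in> XP}"

lemma YP_down: "y \<in> YP \<Longrightarrow> y' \<in> Y \<Longrightarrow> R y y' \<Longrightarrow> y' \<in> YP"
  using fixed_down unfolding YP_def by blast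

lemma chains_YP: "c \<in> chains R YP n \<Longrightarrow> c \<in> chains R Y n"
  by (auto simp: chains_def YP_def)

text \<open>The direction from fixed vertices to a fixed class uses that vertices of weight zero do
  not affect the class, even where \<open>g\<close> moves them.\<close>

lemma class_XP_iff:
  assumes c: "c \<in> chains R Y n" and t: "t \<in> standard_simplex n"
  shows "simplex_class X (pt n c t) \<in> XP \<longleftrightarrow> (\<forall>i\<le>n. t i \<noteq> 0 \<longrightarrow> c i \<in> YP)"
proof -
  let ?z = "pt n c t"
  have z: "?z \<in> topspace (simplex_space X)" by (rule pt_in[OF c t])
  have "simplex_class X ?z \<in> XP \<longleftrightarrow> (\<forall>g\<in>P. simplex_class X (point_act g ?z) = simplex_class X ?z)"
    using z P_sub by (auto simp: XP_def invariants_def realization_act_class topspace_realization subset_iff)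
  also have "\<dots> \<longleftrightarrow> (\<forall>g\<in>P. \<forall>i\<le>n. t i \<noteq> 0 \<longrightarrow> act g (c i) = c i)"
  proof (intro ball_cong refl iffI allI impI)
    fix g i assume g: "g \<in> P" and eq: "simplex_class X (point_act g ?z) = simplex_class X ?z" and i: "i \<le> n" "t i \<noteq> 0"
    have g': "g \<in> carrier G" using g P_sub by blast
    have "act g (c i) = step_function (point_act g ?z) (\<Sum>k<i. t k)"
      using step_function_vertex(1)[OF chain_act[OF g' c] t i(2)] i(1) by (simp add: point_act_pt g' c)
    also have "\<dots> = step_function ?z (\<Sum>k<i. t k)"
      by (rule step_function_class[OF eq]) (use step_function_vertex[OF c t i(2)] in auto)
    also have "\<dots> = c i" by (rule step_function_vertex(1)[OF c t i(2)])
    finally show "act g (c i) = c i" .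
  next
    fix g assume g: "g \<in> P" and eq: "\<forall>i\<le>n. t i \<noteq> 0 \<longrightarrow> act g (c i) = c i"
    have g': "g \<in> carrier G" using g P_sub by blast
    show "simplex_class X (point_act g ?z) = simplex_class X ?z"
      unfolding point_act_pt[OF g' c]
      by (rule class_support_cong[OF chain_act[OF g' c] c t]) (use eq in auto)
  qed
  also have "\<dots> \<longleftrightarrow> (\<forall>i\<le>n. t i \<noteq> 0 \<longrightarrow> c i \<in> YP)"
    using chainsD(1)[OF c] by (auto simp: YP_def)
  finally show ?thesis .
qed

lemma pre_XP_pt_iff:
  assumes "c \<in> chains R Y n" "t \<in> standard_simplex n"
  shows "pt n c t \<in> pre_XP \<longleftrightarrow> (\<forall>i\<le>n. t i \<noteq> 0 \<longrightarrow> c i \<in> YP)"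
  using assms by (simp add: pre_XP_def pt_in class_XP_iff)

lemma pre_XP_sub: "pre_XP \<subseteq> topspace (simplex_space X)"
  by (auto simp: pre_XP_def)

lemma pre_XP_class: "simplex_class X z = simplex_class X z' \<Longrightarrow> z \<in> pre_XP \<longleftrightarrow> z' \<in> pre_XP"
  using class_topspace[of z z'] by (simp add: pre_XP_def)

text \<open>On the simplex over a chain, the condition is that the coordinates at the non-fixed
  vertices vanish. Closedness is what makes the restriction of the quotient map to this saturated
  set a quotient map again.\<close>

lemma closedin_pre_XP: "closedin (simplex_space X) pre_XP"
proof -
  have cl: "closedin (subtopology (powertop_real UNIV) (standard_simplex n)) {t. ((n, x), t) \<in> pre_XP}"
    if x: "x \<in> simplices X n" for n x
  proof -
    obtain c where c: "c \<in> chains R Y n" "x = enc n c" using simplexE[OF x] .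
    have "closedin (powertop_real UNIV) {t \<in> topspace (powertop_real UNIV). t i \<in> {0::real}}" for i :: nat
      by (rule closedin_continuous_map_preimage[OF continuous_map_product_projection]) auto
    then have 0: "closedin (powertop_real UNIV) {t. t i = (0::real)}" for i :: nat by simp
    have "closedin (powertop_real UNIV) (UNIV :: (nat \<Rightarrow> real) set)"
      using closedin_topspace[of "powertop_real (UNIV :: nat set)"] by simp
    then have "closedin (powertop_real UNIV) (\<Inter>i\<in>{i. i \<le> n \<and> c i \<notin> YP}. {t. t i = (0::real)})"
    proof (cases "{i. i \<le> n \<and> c i \<notin> YP} = {}")
      case True
      then show ?thesis using \<open>closedin (powertop_real UNIV) UNIV\<close> by (simp only: INT_empty)
    next
      case False
      show ?thesis by (rule closedin_Inter) (use False 0 in auto)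
    qed
    moreover have "{t. ((n, x), t) \<in> pre_XP} = (\<Inter>i\<in>{i. i \<le> n \<and> c i \<notin> YP}. {t. t i = (0::real)}) \<inter> standard_simplex n"
    proof (rule Set.set_eqI)
      fix t :: "nat \<Rightarrow> real"
      show "t \<in> {t. ((n, x), t) \<in> pre_XP} \<longleftrightarrow> t \<in> (\<Inter>i\<in>{i. i \<le> n \<and> c i \<notin> YP}. {t. t i = (0::real)}) \<inter> standard_simplex n"
      proof (cases "t \<in> standard_simplex n")
        case True
        then show ?thesis using pre_XP_pt_iff[OF c(1) True] by (auto simp: pt_def c(2))
      qed (use pre_XP_sub in \<open>auto simp: topspace_simplex_space\<close>)
    qed
    ultimately show ?thesis by (auto simp: closedin_subtopology)
  qed
  have "pre_XP \<subseteq> {((n, x), t). x \<in> simplices X n \<and> t \<in> standard_simplex n}"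
    using pre_XP_sub by (simp add: topspace_simplex_space)
  then show ?thesis using cl unfolding simplex_space_def closedin_sum_topology by auto
qed

lemma quotient_map_pre_XP:
  "quotient_map (subtopology (simplex_space X) pre_XP) (subtopology (realization X) XP) (simplex_class X)"
proof -
  have q: "quotient_map (simplex_space X) (realization X) (simplex_class X)"
    unfolding realization_def by (rule quotient_map_quotient_topology)
  have "XP \<subseteq> topspace (realization X)" by (auto simp: XP_def)
  then have "closedin (realization X) XP"
    using q closedin_pre_XP unfolding quotient_map_closedin pre_XP_def by blast
  then show ?thesis using quotient_map_restriction[OF q _ disjI2, of XP pre_XP] by (simp add: pre_XP_def)
qed

section \<open>Replacing the non-fixed vertices of a chain\<close>

definition first_fixed :: "nat \<Rightarrow> (nat \<Rightarrow> 'y) \<Rightarrow> nat" where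
  "first_fixed n c = (LEAST i. i \<le> n \<and> c i \<in> YP)"

definition fix_chain :: "nat \<Rightarrow> (nat \<Rightarrow> 'y) \<Rightarrow> nat \<Rightarrow> 'y" where
  "fix_chain n c = (\<lambda>i\<in>{..n}. c (max i (first_fixed n c)))"

text \<open>The index \<open>max i (first_fixed n c)\<close> is never before a fixed vertex, so its
  vertex is fixed. Taking the maximum with a constant is monotone and leaves all fixed positions
  alone.\<close>

lemma fix_chain:
  assumes c: "c \<in> chains R Y n" and ex: "i \<le> n" "c i \<in> YP"
  shows "fix_chain n c \<in> chains R YP n" "\<And>j. j \<le> n \<Longrightarrow> c j \<in> YP \<Longrightarrow> fix_chain n c j = c j"
proof -
  let ?k = "first_fixed n c"
  have k: "?k \<le> n \<and> c ?k \<in> YP"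
    unfolding first_fixed_def by (rule LeastI[of _ i]) (use ex in simp)
  have "c (max j ?k) \<in> YP" if "j \<le> n" for j
    using YP_down[of "c ?k" "c (max j ?k)"] k that chainsD(1,2)[OF c] by simp
  then show "fix_chain n c \<in> chains R YP n"
    unfolding fix_chain_def by (intro chainsI) (use k chainsD[OF c] in auto)
  show "fix_chain n c j = c j" if "j \<le> n" "c j \<in> YP" for j
  proof -
    have "?k \<le> j" unfolding first_fixed_def by (rule Least_le) (use that in simp)
    then show ?thesis using that by (simp add: fix_chain_def max_absorb1)
  qed
qed

lemma pre_XPE:
  assumes "z \<in> pre_XP"
  obtains n c t where "z = pt n c t" "c \<in> chains R Y n" "t \<in> standard_simplex n"
    "\<And>i. t i \<noteq> 0 \<Longrightarrow> i \<le> n \<and> c i \<in> YP" "fix_chain n c \<in> chains R YP n"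
    "\<And>i. t i \<noteq> 0 \<Longrightarrow> fix_chain n c i = c i"
proof -
  obtain n c t where z: "z = pt n c t" and c: "c \<in> chains R Y n" and t: "t \<in> standard_simplex n"
    using assms pre_XP_sub by (blast elim: pointE)
  have YP: "i \<le> n \<and> c i \<in> YP" if "t i \<noteq> 0" for i
    using that assms standard_simplexD(3)[OF t, of i] pre_XP_pt_iff[OF c t] unfolding z by (meson not_le)
  obtain k where k: "k \<le> n" "t k \<noteq> 0" using standard_simplex_support[OF t] .
  show thesis using that[OF z c t YP] fix_chain[OF c k(1)] YP k by blast
qed

section \<open>The homotopy between two comparable monotone maps\<close>

definition prism :: "('y \<Rightarrow> 'y) \<Rightarrow> ('y \<Rightarrow> 'y) \<Rightarrow> nat \<Rightarrow> nat \<Rightarrow> (nat \<Rightarrow> 'y) \<Rightarrow> nat \<Rightarrow> 'y" where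
  "prism \<phi> \<psi> n k c = (\<lambda>i\<in>{..2 * n + 1}. if i \<le> n then \<phi> (c (min i k)) else \<psi> (c (max (i - Suc n) k)))"

text \<open>On step functions \<open>f\<close> this is the path \<open>s \<mapsto> (r \<mapsto> if r < s then \<phi> (f r) else \<psi> (f r))\<close>.
  The truncation at \<open>k\<close> in \<^term>\<open>prism \<phi> \<psi> n k c\<close> is needed to get a chain, and only affects
  vertices of weight \<open>0\<close>.\<close>

definition deform :: "('y \<Rightarrow> 'y) \<Rightarrow> ('y \<Rightarrow> 'y) \<Rightarrow> real \<Rightarrow> (nat \<times> 's) \<times> (nat \<Rightarrow> real) \<Rightarrow> (nat \<times> 's) \<times> (nat \<Rightarrow> real)" where
  "deform \<phi> \<psi> s = (\<lambda>((n, x), t). pt (2 * n + 1) (prism \<phi> \<psi> n (piece s t) (fix_chain n (dec n x))) (split_weights n s t))"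

definition map_pt :: "('y \<Rightarrow> 'y) \<Rightarrow> (nat \<times> 's) \<times> (nat \<Rightarrow> real) \<Rightarrow> (nat \<times> 's) \<times> (nat \<Rightarrow> real)" where
  "map_pt \<phi> = (\<lambda>((n, x), t). pt n (\<lambda>i\<in>{..n}. \<phi> (fix_chain n (dec n x) i)) t)"

lemma deform_pt: "c \<in> chains R Y n \<Longrightarrow>
    deform \<phi> \<psi> s (pt n c t) = pt (2 * n + 1) (prism \<phi> \<psi> n (piece s t) (fix_chain n c)) (split_weights n s t)"
  by (simp add: deform_def pt_def)

lemma map_pt_pt: "c \<in> chains R Y n \<Longrightarrow> map_pt \<phi> (pt n c t) = pt n (\<lambda>i\<in>{..n}. \<phi> (fix_chain n c i)) t"
  by (simp add: map_pt_def pt_def)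

text \<open>The mixed comparison is asked for related \<open>y\<close> and \<open>y'\<close>,
  because the doubled chain compares \<open>\<phi>\<close> of an earlier vertex with
  \<open>\<psi>\<close> of a later one.\<close>

definition dominates :: "('y \<Rightarrow> 'y) \<Rightarrow> ('y \<Rightarrow> 'y) \<Rightarrow> bool" where
  "dominates \<phi> \<psi> \<longleftrightarrow> (\<forall>y\<in>YP. \<phi> y \<in> YP \<and> \<psi> y \<in> YP) \<and>
     (\<forall>y\<in>YP. \<forall>y'\<in>YP. R y y' \<longrightarrow> R (\<phi> y) (\<phi> y') \<and> R (\<psi> y) (\<psi> y') \<and> R (\<phi> y) (\<psi> y'))"

context
  fixes \<phi> \<psi> :: "'y \<Rightarrow> 'y"
  assumes dom: "dominates \<phi> \<psi>"
begin

text \<open>Truncation makes every index under \<open>\<phi>\<close> at most \<open>k\<close> and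
  every index under \<open>\<psi>\<close> at least \<open>k\<close>, so the mixed comparison applies
  across the junction.\<close>

lemma prism_chain:
  assumes c: "c \<in> chains R YP n" and k: "k \<le> n" shows "prism \<phi> \<psi> n k c \<in> chains R YP (2 * n + 1)"
proof -
  have le: "i - Suc n \<le> n" if "i \<le> 2 * n + 1" for i using that by simp
  have YP: "\<phi> y \<in> YP" "\<psi> y \<in> YP" if "y \<in> YP" for y using dom that by (auto simp: dominates_def)
  have RR: "R (\<phi> (c i)) (\<phi> (c j))" "R (\<psi> (c i)) (\<psi> (c j))" "R (\<phi> (c i)) (\<psi> (c j))" if "i \<le> j" "j \<le> n" for i j
    using dom that chainsD(1,2)[OF c] by (auto simp: dominates_def)
  show ?thesis
    unfolding prism_def
  proof (rule chainsI)
    fix i assume "i \<le> 2 * n + 1"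
    then show "(if i \<le> n then \<phi> (c (min i k)) else \<psi> (c (max (i - Suc n) k))) \<in> YP"
      using k le[of i] by (auto intro!: YP chainsD(1)[OF c])
  next
    fix i j assume ij: "i \<le> j" "j \<le> 2 * n + 1"
    have "i - Suc n \<le> j - Suc n" "j - Suc n \<le> n" using ij by auto
    then show "R (if i \<le> n then \<phi> (c (min i k)) else \<psi> (c (max (i - Suc n) k)))
        (if j \<le> n then \<phi> (c (min j k)) else \<psi> (c (max (j - Suc n) k)))"
      using ij k by (auto intro!: RR min.mono max.mono intro: min.coboundedI2 max.coboundedI2)
  qed
qed

text \<open>A doubled vertex carrying weight is on the side of \<open>k\<close> where truncation
  does nothing. As this holds for every \<open>k\<close> satisfying the closed inequalities, the
  class of the deformed point does not depend on which one is used.\<close>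

lemma prism_support:
  assumes "split_weights n s t i \<noteq> 0" "t \<in> standard_simplex n" "(\<Sum>i<k. t i) \<le> s" "s \<le> (\<Sum>i\<le>k. t i)"
  shows "prism \<phi> \<psi> n k c i = (if i \<le> n then \<phi> (c i) else \<psi> (c (i - Suc n)))"
  using split_weights_piece[OF assms(1) standard_simplexD(1)[OF assms(2)] assms(3,4)]
    split_weights_pos[OF assms(1) standard_simplexD(1)[OF assms(2)]]
  by (auto simp: prism_def min_absorb1 max_absorb1 split: if_splits)

lemma prism_pt_in:
  assumes "c \<in> chains R YP n" "k \<le> n" "t \<in> standard_simplex n" "0 \<le> s"
  shows "pt (2 * n + 1) (prism \<phi> \<psi> n k c) (split_weights n s t) \<in> pre_XP"
  using pre_XP_pt_iff[OF chains_YP[OF prism_chain[OF assms(1,2)]] split_weights_closed[OF assms(3,4)]]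
    chainsD(1)[OF prism_chain[OF assms(1,2)]] by blast

lemma deform_in:
  assumes z: "z \<in> pre_XP" and s: "0 \<le> s" "s \<le> 1"
  shows "deform \<phi> \<psi> s z \<in> pre_XP"
  using z by (rule pre_XPE) (simp only: deform_pt prism_pt_in piece s)

text \<open>Representatives related by \<open>\<theta>\<close> may have fixed chains and values of
  \<open>piece\<close> that do not correspond, so their doubled chains need not match along the
  ordinal sum of \<open>\<theta>\<close> with itself. They do match at all vertices carrying weight,
  and the class sees no others.\<close>

lemma deform_class:
  assumes z: "z \<in> pre_XP" and eq: "simplex_class X z = simplex_class X z'" and s: "0 \<le> s" "s \<le> 1"
  shows "simplex_class X (deform \<phi> \<psi> s z) = simplex_class X (deform \<phi> \<psi> s z')"
proof -
  \<comment> \<open>The default \<open>{}\<close> makes \<open>F\<close> a function on all points,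
    as \<open>class_invariant\<close> requires; the two cases never mix because
    \<open>pre_XP\<close> is saturated.\<close>
  define F where "F z = (if z \<in> pre_XP then simplex_class X (deform \<phi> \<psi> s z) else {})" for z
  have "F z = F z'"
  proof (rule class_invariant[OF _ eq])
    fix \<theta> m n c t assume th: "\<theta> \<in> simplicial_ops m n" and c: "c \<in> chains R Y n" and t: "t \<in> standard_simplex m"
    let ?c = "\<lambda>i\<in>{..m}. c (\<theta> i)" and ?t = "push_simplex m \<theta> t"
    let ?th = "\<lambda>i. if i \<le> m then \<theta> i else \<theta> (i - Suc m) + Suc n"
    have c': "?c \<in> chains R Y m" by (rule chain_pull[OF th c])
    have t': "?t \<in> standard_simplex n" by (rule push_closed[OF t th])
    have le: "\<theta> i \<le> n" if "i \<le> m" for i using opsD(2)[OF th order_refl that] .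
    have cl: "simplex_class X (pt m ?c t) = simplex_class X (pt n c ?t)" by (rule class_glue[OF th c t])
    show "F (pt m ?c t) = F (pt n c ?t)"
    proof (cases "pt m ?c t \<in> pre_XP")
      case True
      have "\<And>i. i \<le> m \<Longrightarrow> t i \<noteq> 0 \<Longrightarrow> ?c i \<in> YP" using True pre_XP_pt_iff[OF c' t] by blast
      then have ti: "c (\<theta> i) \<in> YP" if "i \<le> m" "t i \<noteq> 0" for i using that by force
      obtain k where k: "k \<le> m" "t k \<noteq> 0" using standard_simplex_support[OF t] .
      have fc: "fix_chain n c \<in> chains R YP n" "\<And>i. i \<le> m \<Longrightarrow> t i \<noteq> 0 \<Longrightarrow> fix_chain n c (\<theta> i) = c (\<theta> i)"
        using fix_chain[OF c le[OF k(1)] ti[OF k]] ti le by blast+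
      have fc': "fix_chain m ?c \<in> chains R YP m" "\<And>i. i \<le> m \<Longrightarrow> t i \<noteq> 0 \<Longrightarrow> fix_chain m ?c i = c (\<theta> i)"
        using fix_chain[OF c' k(1)] ti k by auto
      let ?J = "prism \<phi> \<psi> m (piece s t) (fix_chain m ?c)" and ?J' = "prism \<phi> \<psi> n (piece s ?t) (fix_chain n c)"
      note j = chains_YP[OF prism_chain[OF fc(1) piece(1)[OF t' s]]]
        and j' = chains_YP[OF prism_chain[OF fc'(1) piece(1)[OF t s]]]
      have "simplex_class X (deform \<phi> \<psi> s (pt m ?c t)) = simplex_class X (pt (2 * m + 1) ?J (split_weights m s t))"
        by (simp only: deform_pt[OF c'])
      also have "\<dots> = simplex_class X (pt (2 * m + 1) (\<lambda>i\<in>{..2 * m + 1}. ?J' (?th i)) (split_weights m s t))"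
      proof (rule class_support_cong[OF j' chain_pull[OF double_op[OF th] j] split_weights_closed[OF t s(1)]])
        fix i assume i: "i \<le> 2 * m + 1" and nz: "split_weights m s t i \<noteq> 0"
        have *: "if i \<le> m then t i \<noteq> 0 else i \<le> 2 * m + 1 \<and> t (i - Suc m) \<noteq> 0"
          by (rule split_weights_pos[OF nz standard_simplexD(1)[OF t]])
        \<comment> \<open>A vertex carrying weight still carries weight after pushing forward, so
          both doubled chains can be evaluated without truncation.\<close>
        have nz': "split_weights n s ?t (?th i) \<noteq> 0"
          unfolding push_simplex_split[OF th s(1), symmetric]
          by (rule push_simplex_pos[where t = "split_weights m s t" and \<theta> = ?th, OF nz standard_simplexD(1)[OF split_weights_closed[OF t s(1)]] i])
        have eqs: "?J i = (if i \<le> m then \<phi> (fix_chain m ?c i) else \<psi> (fix_chain m ?c (i - Suc m)))"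
          "?J' (?th i) = (if ?th i \<le> n then \<phi> (fix_chain n c (?th i)) else \<psi> (fix_chain n c (?th i - Suc n)))"
          using prism_support[OF nz t piece(2,3)[OF t s]] prism_support[OF nz' t' piece(2,3)[OF t' s]] .
        show "?J i = (\<lambda>i\<in>{..2 * m + 1}. ?J' (?th i)) i"
        proof (cases "i \<le> m")
          case True
          then show ?thesis using i * le[OF True] fc(2)[of i] fc'(2)[of i] eqs by simp
        next
          case False
          then have "i - Suc m \<le> m" using i by simp
          then show ?thesis using False i * le[of "i - Suc m"] fc(2)[of "i - Suc m"] fc'(2)[of "i - Suc m"] eqs
            by simp
        qed
      qed
      also have "\<dots> = simplex_class X (pt (2 * n + 1) ?J' (split_weights n s ?t))"
        by (simp only: class_glue[OF double_op[OF th] j split_weights_closed[OF t s(1)]] push_simplex_split[OF th s(1)])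
      also have "\<dots> = simplex_class X (deform \<phi> \<psi> s (pt n c ?t))"
        by (simp only: deform_pt[OF c])
      finally show ?thesis using True pre_XP_class[OF cl] by (simp add: F_def)
    qed (use pre_XP_class[OF cl] in \<open>simp add: F_def\<close>)
  qed
  then show ?thesis using z pre_XP_class[OF eq] by (simp add: F_def)
qed

lemma map_pt_chains:
  assumes "c \<in> chains R YP n"
  shows "(\<lambda>i\<in>{..n}. \<phi> (c i)) \<in> chains R Y n" "(\<lambda>i\<in>{..n}. \<psi> (c i)) \<in> chains R Y n"
  using dom chainsD(1,2)[OF assms] by (auto intro!: chainsI chains_YP simp: dominates_def)

text \<open>At \<open>s = 1\<close> all weight is on the first copies and at \<open>s = 0\<close> on
  the second ones, so the doubled point lies on the front or the back face. The homotopy thus runs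
  from \<open>\<psi>\<close> to \<open>\<phi>\<close>.\<close>

lemma deform_ends:
  assumes z: "z \<in> pre_XP"
  shows "simplex_class X (deform \<phi> \<psi> 1 z) = simplex_class X (map_pt \<phi> z)"
    and "simplex_class X (deform \<phi> \<psi> 0 z) = simplex_class X (map_pt \<psi> z)"
proof -
  obtain n c t where h: "z = pt n c t" "c \<in> chains R Y n" "t \<in> standard_simplex n" "fix_chain n c \<in> chains R YP n"
    using z by (rule pre_XPE)
  have k1: "piece 1 t \<le> n" and k0: "piece 0 t \<le> n" using piece(1)[OF h(3)] by auto
  note j1 = chains_YP[OF prism_chain[OF h(4) k1]] and j0 = chains_YP[OF prism_chain[OF h(4) k0]]
  have le: "i \<le> n" if "t i \<noteq> 0" for i using standard_simplexD(3)[OF h(3), of i] that by force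
  have w1: "split_weights n 1 t i = t i" if "i \<le> n" for i using cut_one[OF h(3)] that by (simp add: split_weights_def)
  have w0: "split_weights n 0 t (i + Suc n) = t i" if "i \<le> n" for i
    using cut_zero[of t] standard_simplexD(1)[OF h(3)] that by (simp add: split_weights_def)
  have p1: "push_simplex n (\<lambda>i. i) t = split_weights n 1 t"
  proof
    fix k
    have "{i. i \<le> n \<and> i = k} = (if k \<le> n then {k} else {})" by auto
    then show "push_simplex n (\<lambda>i. i) t k = split_weights n 1 t k"
      using cut_one[OF h(3)] unfolding push_simplex_def split_weights_def by simp
  qed
  have o1: "(\<lambda>i. i) \<in> simplicial_ops n (2 * n + 1)" by (auto simp: simplicial_ops_def mono_on_def)
  have "simplex_class X (deform \<phi> \<psi> 1 z) = simplex_class X (pt n (\<lambda>i\<in>{..n}. prism \<phi> \<psi> n (piece 1 t) (fix_chain n c) i) t)"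
    using class_glue[OF o1 j1 h(3)] unfolding h(1) deform_pt[OF h(2)] p1 by (rule sym)
  also have "\<dots> = simplex_class X (map_pt \<phi> z)"
    unfolding h(1) map_pt_pt[OF h(2)]
  proof (rule class_support_cong[OF chain_pull[OF o1 j1] map_pt_chains(1)[OF h(4)] h(3)])
    fix i assume "i \<le> n" "t i \<noteq> 0"
    then show "(\<lambda>i\<in>{..n}. prism \<phi> \<psi> n (piece 1 t) (fix_chain n c) i) i = (\<lambda>i\<in>{..n}. \<phi> (fix_chain n c i)) i"
      using prism_support[OF _ h(3) piece(2,3)[OF h(3)], of 1 i] w1 by simp
  qed
  finally show "simplex_class X (deform \<phi> \<psi> 1 z) = simplex_class X (map_pt \<phi> z)" .
  have p0: "push_simplex n (\<lambda>i. i + Suc n) t = split_weights n 0 t"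
  proof
    fix k
    have "{i. i \<le> n \<and> i + Suc n = k} = (if n < k \<and> k \<le> 2 * n + 1 then {k - Suc n} else {})" by auto
    then show "push_simplex n (\<lambda>i. i + Suc n) t k = split_weights n 0 t k"
      using cut_zero[of t] standard_simplexD(1)[OF h(3)] unfolding push_simplex_def split_weights_def by simp
  qed
  have o0: "(\<lambda>i. i + Suc n) \<in> simplicial_ops n (2 * n + 1)" by (auto simp: simplicial_ops_def mono_on_def)
  have "simplex_class X (deform \<phi> \<psi> 0 z) = simplex_class X (pt n (\<lambda>i\<in>{..n}. prism \<phi> \<psi> n (piece 0 t) (fix_chain n c) (i + Suc n)) t)"
    using class_glue[OF o0 j0 h(3)] unfolding h(1) deform_pt[OF h(2)] p0 by (rule sym)
  also have "\<dots> = simplex_class X (map_pt \<psi> z)"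
    unfolding h(1) map_pt_pt[OF h(2)]
  proof (rule class_support_cong[OF chain_pull[OF o0 j0] map_pt_chains(2)[OF h(4)] h(3)])
    fix i assume "i \<le> n" "t i \<noteq> 0"
    then show "(\<lambda>i\<in>{..n}. prism \<phi> \<psi> n (piece 0 t) (fix_chain n c) (i + Suc n)) i = (\<lambda>i\<in>{..n}. \<psi> (fix_chain n c i)) i"
      using prism_support[OF _ h(3) piece(2,3)[OF h(3)], of 0 "i + Suc n"] w0 by simp
  qed
  finally show "simplex_class X (deform \<phi> \<psi> 0 z) = simplex_class X (map_pt \<psi> z)" .
qed

end

section \<open>Descent to the fixed points and to their orbits\<close>

text \<open>\<open>D\<close> is trivial for the fixed point space and \<open>C\<^sub>G(P)\<close> for its orbit space.\<close>

context
  fixes D :: "'g set" and Q :: "'q topology" and q :: "(nat \<times> 's) \<times> (nat \<Rightarrow> real) \<Rightarrow> 'q"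
  assumes D: "subgroup D G" "D \<subseteq> centralizer G P"
    and q: "quotient_map (subtopology (simplex_space X) pre_XP) Q q"
    and q_iff: "\<lbrakk>z \<in> pre_XP; z' \<in> pre_XP\<rbrakk>
      \<Longrightarrow> q z = q z' \<longleftrightarrow> (\<exists>g\<in>D. simplex_class X (point_act g z) = simplex_class X z')"
begin

lemma q_class:
  assumes z: "z \<in> pre_XP" and eq: "simplex_class X z = simplex_class X z'" shows "q z = q z'"
proof -
  have 1: "\<one>\<^bsub>G\<^esub> \<in> D" using D(1) by (rule subgroup.one_closed)
  have "point_act \<one>\<^bsub>G\<^esub> z = z" using point_act_one z pre_XP_sub by blast
  then have "simplex_class X (point_act \<one>\<^bsub>G\<^esub> z) = simplex_class X z'" using eq by simp
  then have ex: "\<exists>g\<in>D. simplex_class X (point_act g z) = simplex_class X z'" using 1 by (rule bexI)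
  have z': "z' \<in> pre_XP" using z pre_XP_class[OF eq] by blast
  show ?thesis unfolding q_iff[OF z z'] by (rule ex)
qed

lemma D_carrier: "g \<in> D \<Longrightarrow> g \<in> carrier G"
  using D(1) by (rule subgroup.mem_carrier)

lemma act_YP:
  assumes g: "g \<in> D" and y: "y \<in> YP" shows "act g y \<in> YP"
proof -
  have "act h (act g y) = act g y" if h: "h \<in> P" for h
  proof -
    have hc: "h \<in> carrier G" and yY: "y \<in> Y" using h P_sub y by (auto simp: YP_def)
    have "act h (act g y) = act (h \<otimes>\<^bsub>G\<^esub> g) y" using hc yY D_carrier[OF g] by (simp add: act_mult)
    also have "h \<otimes>\<^bsub>G\<^esub> g = g \<otimes>\<^bsub>G\<^esub> h" using D(2) g h by (auto simp: centralizer_def)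
    also have "act (g \<otimes>\<^bsub>G\<^esub> h) y = act g (act h y)" using hc yY D_carrier[OF g] by (simp add: act_mult)
    also have "act h y = y" using y h by (simp add: YP_def)
    finally show ?thesis .
  qed
  then show ?thesis using y act_closed[OF D_carrier[OF g]] by (auto simp: YP_def)
qed

lemma act_YP_iff:
  assumes g: "g \<in> D" and y: "y \<in> Y" shows "act g y \<in> YP \<longleftrightarrow> y \<in> YP"
proof
  assume "act g y \<in> YP"
  then have "act (inv\<^bsub>G\<^esub> g) (act g y) \<in> YP" by (rule act_YP[OF subgroup.m_inv_closed[OF D(1) g]])
  then show "y \<in> YP" using y D_carrier[OF g] by (simp add: act_mult act_one)
qed (rule act_YP[OF g])

text \<open>Elements centralizing \<open>P\<close> preserve and reflect fixedness of each vertex, so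
  both chains have the same first fixed index.\<close>

lemma fix_chain_act:
  assumes g: "g \<in> D" and c: "c \<in> chains R Y n" and ex: "i \<le> n" "c i \<in> YP"
  shows "fix_chain n (\<lambda>i\<in>{..n}. act g (c i)) = (\<lambda>i\<in>{..n}. act g (fix_chain n c i))"
proof -
  let ?d = "\<lambda>i\<in>{..n}. act g (c i)"
  have "(\<lambda>i. i \<le> n \<and> ?d i \<in> YP) = (\<lambda>i. i \<le> n \<and> c i \<in> YP)"
    using act_YP_iff[OF g] chainsD(1)[OF c] by auto
  then have ff: "first_fixed n ?d = first_fixed n c" by (simp only: first_fixed_def)
  have "first_fixed n c \<le> i" unfolding first_fixed_def by (rule Least_le) (use ex in simp)
  then show ?thesis unfolding fix_chain_def ff using ex(1) by (intro restrict_cong) (auto simp: simp_implies_def)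
qed

lemma point_act_in: "g \<in> D \<Longrightarrow> z \<in> pre_XP \<Longrightarrow> point_act g z \<in> pre_XP"
proof (erule pre_XPE)
  fix n c t assume g: "g \<in> D" and h: "z = pt n c t" "c \<in> chains R Y n" "t \<in> standard_simplex n" "\<And>i. t i \<noteq> 0 \<Longrightarrow> i \<le> n \<and> c i \<in> YP"
  show "point_act g z \<in> pre_XP"
    unfolding h(1) point_act_pt[OF D_carrier[OF g] h(2)]
    by (subst pre_XP_pt_iff[OF chain_act[OF D_carrier[OF g] h(2)] h(3)]) (use h(4) act_YP[OF g] in auto)
qed

text \<open>The position of the cut and the weights depend on the coordinates alone, which the
  action leaves unchanged. Equality therefore holds for representatives and not merely for
  classes.\<close>

lemma deform_point_act:
  assumes dom: "dominates \<phi> \<psi>" and g: "g \<in> D" and z: "z \<in> pre_XP" and s: "0 \<le> s" "s \<le> 1"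
    and eqv: "\<And>y. y \<in> YP \<Longrightarrow> \<phi> (act g y) = act g (\<phi> y)" "\<And>y. y \<in> YP \<Longrightarrow> \<psi> (act g y) = act g (\<psi> y)"
  shows "deform \<phi> \<psi> s (point_act g z) = point_act g (deform \<phi> \<psi> s z)"
  using z
proof (rule pre_XPE)
  fix n c t assume h: "z = pt n c t" "c \<in> chains R Y n" "t \<in> standard_simplex n"
    "\<And>i. t i \<noteq> 0 \<Longrightarrow> i \<le> n \<and> c i \<in> YP" "fix_chain n c \<in> chains R YP n"
  obtain k where k: "k \<le> n" "c k \<in> YP" using standard_simplex_support[OF h(3)] h(4) by blast
  have YP: "fix_chain n c i \<in> YP" if "i \<le> n" for i using chainsD(1)[OF h(5) that] .
  have p: "piece s t \<le> n" by (rule piece(1)[OF h(3) s])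
  have "prism \<phi> \<psi> n (piece s t) (\<lambda>i\<in>{..n}. act g (fix_chain n c i)) =
      (\<lambda>i\<in>{..2 * n + 1}. act g (prism \<phi> \<psi> n (piece s t) (fix_chain n c) i))"
    unfolding prism_def by (intro restrict_cong) (use eqv YP p in \<open>auto simp: simp_implies_def\<close>)
  then show ?thesis
    using chain_act[OF D_carrier[OF g] h(2)] chains_YP[OF prism_chain[OF dom h(5) p]]
    by (simp only: h(1) point_act_pt[OF D_carrier[OF g]] h(2) deform_pt fix_chain_act[OF g h(2) k])
qed

lemma q_deform:
  assumes dom: "dominates \<phi> \<psi>" and s: "0 \<le> s" "s \<le> 1" and z: "z \<in> pre_XP" "z' \<in> pre_XP" and eq: "q z = q z'"
    and eqv: "\<And>g y. \<lbrakk>g \<in> D; y \<in> YP\<rbrakk> \<Longrightarrow> \<phi> (act g y) = act g (\<phi> y)" "\<And>g y. \<lbrakk>g \<in> D; y \<in> YP\<rbrakk> \<Longrightarrow> \<psi> (act g y) = act g (\<psi> y)"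
  shows "q (deform \<phi> \<psi> s z) = q (deform \<phi> \<psi> s z')"
proof -
  obtain g where g: "g \<in> D" and gz: "simplex_class X (point_act g z) = simplex_class X z'"
    using eq unfolding q_iff[OF z] by (rule bexE)
  have "simplex_class X (point_act g (deform \<phi> \<psi> s z)) = simplex_class X (deform \<phi> \<psi> s z')"
    using deform_class[OF dom point_act_in[OF g z(1)] gz s] deform_point_act[OF dom g z(1) s] eqv[OF g] by simp
  then have "\<exists>g\<in>D. simplex_class X (point_act g (deform \<phi> \<psi> s z)) = simplex_class X (deform \<phi> \<psi> s z')"
    using g by (rule bexI)
  then show ?thesis by (simp only: q_iff[OF deform_in[OF dom z(1) s] deform_in[OF dom z(2) s]])
qed

text \<open>The truncated chain can jump when \<open>s\<close> crosses a partial sum of the weights,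
  so \<open>deform\<close> need not be continuous into the disjoint union of simplices. On the
  closed region where \<open>s\<close> lies in the \<open>k\<close>-th interval the chain is
  constant and only the weights vary; the finitely many regions are pasted after applying
  \<open>q\<close>.\<close>

lemma continuous_map_deform:
  assumes dom: "dominates \<phi> \<psi>"
  shows "continuous_map (prod_topology (top_of_set {0..1}) (subtopology (simplex_space X) pre_XP)) Q
     (\<lambda>(s, z). q (deform \<phi> \<psi> s z))"
proof -
  let ?I = "top_of_set {0..1::real}" and ?S = "subtopology (simplex_space X) pre_XP"
  let ?W = "prod_topology ?I ?S"
  have tW: "topspace ?W = {0..1} \<times> pre_XP" using pre_XP_sub by auto
  have cW1: "continuous_map ?W euclideanreal fst"
    by (rule continuous_map_into_fulltopology[OF continuous_map_fst])
  have cW2: "continuous_map ?W (powertop_real UNIV) (snd \<circ> snd)"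
    by (rule continuous_map_compose[OF continuous_map_into_fulltopology[OF continuous_map_snd]
          continuous_map_snd_simplex_space])
  define J where "J = (SIGMA n:UNIV. simplices X n)"
  define T where "T i = {0..1::real} \<times> (pre_XP \<inter> ({i} \<times> standard_simplex (fst i)))" for i :: "nat \<times> 's"
  show ?thesis
  proof (rule pasting_lemma[where I = J and T = T and f = "\<lambda>i (s, z). q (deform \<phi> \<psi> s z)"])
    fix i assume "i \<in> J"
    then obtain n x where [simp]: "i = (n, x)" and x: "x \<in> simplices X n" by (auto simp: J_def)
    let ?V = "subtopology ?W (T i)"
    have "openin ?S (pre_XP \<inter> ({i} \<times> standard_simplex n))"
      using openin_simplex_piece[OF x] by (simp add: openin_subtopology_Int2)
    then show "openin ?W (T i)" by (simp add: T_def openin_prod_Times_iff)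
    show "continuous_map ?V Q (\<lambda>(s, z). q (deform \<phi> \<psi> s z))"
    proof (cases "T i = {}")
      case False
      then obtain t where z: "((n, x), t) \<in> pre_XP" by (auto simp: T_def)
      then obtain c where c: "x = enc n c" "c \<in> chains R Y n" "fix_chain n c \<in> chains R YP n"
        by (rule pre_XPE) (auto simp: pt_def)
      have tV: "topspace ?V = T i" unfolding topspace_subtopology tW by (auto simp: T_def)
      have TE: "\<exists>s t. w = (s, pt n c t) \<and> 0 \<le> s \<and> s \<le> 1 \<and> t \<in> standard_simplex n \<and> pt n c t \<in> pre_XP" if "w \<in> T i" for w
        using that by (auto simp: T_def pt_def c(1))
      have cs: "continuous_map ?V euclideanreal fst" "continuous_map ?V (powertop_real UNIV) (\<lambda>w. snd (snd w))"
        using continuous_map_from_subtopology[OF cW1] continuous_map_from_subtopology[OF cW2]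
        unfolding comp_def .
      have spl: "split_weights n (fst w) (snd (snd w)) \<in> standard_simplex (2 * n + 1)" if "w \<in> topspace ?V" for w
        by (rule split_weights_closed) (use TE[of w] that tV in \<open>auto simp: pt_def\<close>)
      from cs have ct: "continuous_map ?V euclideanreal (\<lambda>w. snd (snd w) j)" for j
        by (simp add: continuous_map_componentwise_UNIV)
      define f where "f k w = q (pt (2 * n + 1) (prism \<phi> \<psi> n k (fix_chain n c)) (split_weights n (fst w) (snd (snd w))))"
        for k and w :: "real \<times> (nat \<times> 's) \<times> (nat \<Rightarrow> real)"
      \<comment> \<open>Both inequalities include equality, so neighbouring regions overlap; writing
        them as preimages of \<open>{..0}\<close> shows that the regions are closed.\<close>
      define C where "C k = {w \<in> topspace ?V. (\<Sum>j<k. snd (snd w) j) - fst w \<in> {..0} \<and> fst w - (\<Sum>j\<le>k. snd (snd w) j) \<in> {..0}}" for k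
      show ?thesis
      proof (rule pasting_lemma_closed[where I = "{..n}" and T = C and f = f])
        fix k assume "k \<in> {..n}"
        then have k: "k \<le> n" by simp
        have "closedin ?V {w \<in> topspace ?V. (\<Sum>j<k. snd (snd w) j) - fst w \<in> {..0}}"
          "closedin ?V {w \<in> topspace ?V. fst w - (\<Sum>j\<le>k. snd (snd w) j) \<in> {..0}}"
          by (rule closedin_continuous_map_preimage[where Y = euclideanreal];
              (intro continuous_intros cs ct)?; simp)+
        then have "closedin ?V ({w \<in> topspace ?V. (\<Sum>j<k. snd (snd w) j) - fst w \<in> {..0}} \<inter>
            {w \<in> topspace ?V. fst w - (\<Sum>j\<le>k. snd (snd w) j) \<in> {..0}})" by (rule closedin_Int)
        then show "closedin ?V (C k)" by (simp add: C_def Int_def conj_ac cong: conj_cong)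
        have e: "enc (2 * n + 1) (prism \<phi> \<psi> n k (fix_chain n c)) \<in> simplices X (2 * n + 1)"
          by (intro enc_in chains_YP prism_chain[OF dom] c k)
        have "continuous_map ?V (simplex_space X)
            (\<lambda>w. ((2 * n + 1, enc (2 * n + 1) (prism \<phi> \<psi> n k (fix_chain n c))), split_weights n (fst w) (snd (snd w))))"
          by (rule continuous_map_into_simplex_piece[OF e continuous_map_split_weights[OF cs] spl])
        moreover have "pt (2 * n + 1) (prism \<phi> \<psi> n k (fix_chain n c)) (split_weights n (fst w) (snd (snd w))) \<in> pre_XP"
          if "w \<in> topspace ?V" for w
          by (rule prism_pt_in[OF dom c(3) k]) (use TE[of w] that tV in \<open>auto simp: pt_def\<close>)
        ultimately have "continuous_map ?V ?S
            (\<lambda>w. pt (2 * n + 1) (prism \<phi> \<psi> n k (fix_chain n c)) (split_weights n (fst w) (snd (snd w))))"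
          unfolding continuous_map_in_subtopology by (auto simp: pt_def)
        from continuous_map_compose[OF this quotient_imp_continuous_map[OF q]]
        have "continuous_map ?V Q (f k)" by (simp add: f_def[abs_def] comp_def)
        then show "continuous_map (subtopology ?V (C k)) Q (f k)" by (rule continuous_map_from_subtopology)
      next
        fix k l w assume kl: "k \<in> {..n}" "l \<in> {..n}" and w: "w \<in> topspace ?V \<inter> C k \<inter> C l"
        then obtain s t where st: "w = (s, pt n c t)" "0 \<le> s" "s \<le> 1" and t: "t \<in> standard_simplex n"
          using TE[of w] tV by auto
        have v: "(\<Sum>j<k. t j) \<le> s" "s \<le> (\<Sum>j\<le>k. t j)" "(\<Sum>j<l. t j) \<le> s" "s \<le> (\<Sum>j\<le>l. t j)"
          using w by (auto simp: C_def st(1) pt_def)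
        \<comment> \<open>On an overlap the two truncated chains differ at most at vertices of
          weight zero.\<close>
        have "simplex_class X (pt (2 * n + 1) (prism \<phi> \<psi> n k (fix_chain n c)) (split_weights n s t)) =
            simplex_class X (pt (2 * n + 1) (prism \<phi> \<psi> n l (fix_chain n c)) (split_weights n s t))"
          by (rule class_support_cong[OF chains_YP chains_YP split_weights_closed[OF t st(2)]])
            (use kl prism_support[OF dom _ t v(1,2)] prism_support[OF dom _ t v(3,4)] c(3) in
              \<open>simp_all only: prism_chain[OF dom] atMost_iff simp_thms\<close>)
        then have "q (pt (2 * n + 1) (prism \<phi> \<psi> n k (fix_chain n c)) (split_weights n s t)) =
            q (pt (2 * n + 1) (prism \<phi> \<psi> n l (fix_chain n c)) (split_weights n s t))"
          by (intro q_class prism_pt_in[OF dom c(3) _ t st(2)]) (use kl in simp)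
        then show "f k w = f l w" by (simp add: f_def st(1) pt_def[of n])
      next
        fix w assume w: "w \<in> topspace ?V"
        then obtain s t where st: "w = (s, pt n c t)" "0 \<le> s" "s \<le> 1" and t: "t \<in> standard_simplex n"
          using TE[of w] tV by auto
        show "\<exists>k. k \<in> {..n} \<and> w \<in> C k \<and> (\<lambda>(s, z). q (deform \<phi> \<psi> s z)) w = f k w"
        proof (intro exI[of _ "piece s t"] conjI)
          have sp: "snd (pt n c t) = t" by (simp add: pt_def)
          show "piece s t \<in> {..n}" using piece(1)[OF t st(2,3)] by simp
          show "w \<in> C (piece s t)" using w piece(2,3)[OF t st(2,3)] by (simp add: C_def st(1) sp)
          show "(\<lambda>(s, z). q (deform \<phi> \<psi> s z)) w = f (piece s t) w"
            by (simp add: f_def st(1) sp deform_pt[OF c(2)])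
        qed
      qed simp
    qed (simp add: continuous_map_on_empty)
  next
    fix w assume w: "w \<in> topspace ?W"
    then obtain s n x t where [simp]: "w = (s, ((n, x), t))" by (metis surj_pair)
    have "w \<in> T (n, x)" "(n, x) \<in> J"
      using w pre_XP_sub unfolding tW by (auto simp: T_def J_def topspace_simplex_space)
    then show "\<exists>j. j \<in> J \<and> w \<in> T j \<and> (\<lambda>(s, z). q (deform \<phi> \<psi> s z)) w = (\<lambda>(s, z). q (deform \<phi> \<psi> s z)) w"
      by blast
  qed simp
qed

text \<open>The product of \<open>q\<close> with the interval is a quotient map because the interval
  is compact Hausdorff, so the deformation, being constant on its fibres, factors continuously.
  \<open>F\<close> and \<open>F'\<close> are prescribed on values of \<open>q\<close>, which exhaust
  the space.\<close>

lemma homotopic_map_pt: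
  assumes dom: "dominates \<phi> \<psi>"
    and eqv: "\<And>g y. \<lbrakk>g \<in> D; y \<in> YP\<rbrakk> \<Longrightarrow> \<phi> (act g y) = act g (\<phi> y)" "\<And>g y. \<lbrakk>g \<in> D; y \<in> YP\<rbrakk> \<Longrightarrow> \<psi> (act g y) = act g (\<psi> y)"
    and F: "\<And>z. z \<in> pre_XP \<Longrightarrow> F (q z) = q (map_pt \<psi> z)" and F': "\<And>z. z \<in> pre_XP \<Longrightarrow> F' (q z) = q (map_pt \<phi> z)"
  shows "homotopic_with (\<lambda>_. True) Q Q F F'"
proof -
  let ?I = "top_of_set {0..1::real}" and ?S = "subtopology (simplex_space X) pre_XP"
  have tS: "topspace ?S = pre_XP" using pre_XP_sub by auto
  have tQ: "topspace Q = q ` pre_XP" using quotient_imp_surjective_map[OF q] tS by simp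
  have qm: "quotient_map (prod_topology ?I ?S) (prod_topology ?I Q) (\<lambda>(s, z). (s, q z))"
    by (rule quotient_map_prod_right[OF _ _ q])
      (auto simp: Hausdorff_space_subtopology compact_space_subtopology intro!: compact_imp_locally_compact_space)
  have wd: "(\<lambda>(s, z). q (deform \<phi> \<psi> s z)) x = (\<lambda>(s, z). q (deform \<phi> \<psi> s z)) y"
    if "x \<in> topspace (prod_topology ?I ?S)" "y \<in> topspace (prod_topology ?I ?S)"
      "(\<lambda>(s, z). (s, q z)) x = (\<lambda>(s, z). (s, q z)) y" for x y
  proof -
    obtain s z where x: "x = (s, z)" by (cases x)
    obtain s' z' where y: "y = (s', z')" by (cases y)
    have ss: "s' = s" and h: "0 \<le> s" "s \<le> 1" "z \<in> pre_XP" "z' \<in> pre_XP" "q z = q z'"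
      using that unfolding topspace_prod_topology tS x y by auto
    then show ?thesis unfolding x y ss prod.case by (intro q_deform[OF dom h eqv])
  qed
  obtain h where h: "continuous_map (prod_topology ?I Q) Q h"
    and heq: "\<And>x. x \<in> topspace (prod_topology ?I ?S) \<Longrightarrow> h ((\<lambda>(s, z). (s, q z)) x) = (\<lambda>(s, z). q (deform \<phi> \<psi> s z)) x"
    by (rule quotient_map_lift_exists[OF qm continuous_map_deform[OF dom] wd]) (assumption+, rule that)
  have heq': "h (s, q z) = q (deform \<phi> \<psi> s z)" if "s \<in> {0..1}" "z \<in> pre_XP" for s z
    using heq[of "(s, z)"] that unfolding topspace_prod_topology tS by simp
  have "h (0, q z) = F (q z)" "h (1, q z) = F' (q z)" if z: "z \<in> pre_XP" for z
    using heq'[of 0 z] heq'[of 1 z] z F[OF z] F'[OF z] q_class[OF deform_in[OF dom z] deform_ends(1)[OF dom z]]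
      q_class[OF deform_in[OF dom z] deform_ends(2)[OF dom z]] by auto
  then show ?thesis
    by (subst homotopic_with) (use h tQ in auto)
qed

text \<open>\<open>\<kappa>\<close> precedes both the identity and the constant map at
  \<open>y0\<close>, so the self-map \<open>F\<close> that it induces is homotopic to each of
  them.\<close>

theorem cone_contractible:
  assumes \<kappa>: "\<And>y. y \<in> YP \<Longrightarrow> \<kappa> y \<in> YP"
      "\<And>y y'. \<lbrakk>y \<in> YP; y' \<in> YP; R y y'\<rbrakk> \<Longrightarrow> R (\<kappa> y) (\<kappa> y')" "\<And>y y'. \<lbrakk>y \<in> YP; y' \<in> YP; R y y'\<rbrakk> \<Longrightarrow> R (\<kappa> y) y'"
      "\<And>g y. \<lbrakk>g \<in> D; y \<in> YP\<rbrakk> \<Longrightarrow> \<kappa> (act g y) = act g (\<kappa> y)"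
    and y0: "y0 \<in> YP" "R y0 y0" "\<And>y. y \<in> YP \<Longrightarrow> R (\<kappa> y) y0" "\<And>g. g \<in> D \<Longrightarrow> act g y0 = y0"
  shows "nonempty_contractible Q"
proof -
  let ?e = "\<lambda>j::nat. if j = 0 then 1 else 0::real" and ?c = "\<lambda>i\<in>{..0::nat}. y0"
  have tQ: "topspace Q = q ` pre_XP" using quotient_imp_surjective_map[OF q] pre_XP_sub by auto
  have c0: "?c \<in> chains R YP 0" using y0 by (auto simp: chains_def)
  have pt0: "pt 0 ?c ?e \<in> pre_XP" using pre_XP_pt_iff[OF chains_YP[OF c0], of ?e] y0 by simp
  have d1: "dominates \<kappa> (\<lambda>y. y)" and d2: "dominates \<kappa> (\<lambda>_. y0)" using \<kappa> y0 by (auto simp: dominates_def)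
  \<comment> \<open>The induced map uses a chosen preimage. Independence of the choice comes from
    \<open>q_deform\<close> at \<open>s = 1\<close>, where the deformation agrees with
    \<open>map_pt \<kappa>\<close> up to gluing.\<close>
  define F where "F w = q (map_pt \<kappa> (SOME z. z \<in> pre_XP \<and> q z = w))" for w
  have F: "F (q z) = q (map_pt \<kappa> z)" if z: "z \<in> pre_XP" for z
  proof -
    have *: "q (deform \<kappa> (\<lambda>y. y) 1 z) = q (map_pt \<kappa> z)" if z: "z \<in> pre_XP" for z
      by (rule q_class[OF deform_in[OF d1 z] deform_ends(1)[OF d1 z]]) simp_all
    define z' where "z' = (SOME z'. z' \<in> pre_XP \<and> q z' = q z)"
    have z': "z' \<in> pre_XP" "q z' = q z"
      using someI[of "\<lambda>z'. z' \<in> pre_XP \<and> q z' = q z" z] z by (auto simp: z'_def)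
    have "q (deform \<kappa> (\<lambda>y. y) 1 z') = q (deform \<kappa> (\<lambda>y. y) 1 z)"
      by (rule q_deform[OF d1 _ _ z'(1) z z'(2)]) (use \<kappa>(4) in auto)
    then show ?thesis using * z z'(1) by (simp add: F_def flip: z'_def)
  qed
  have id: "q z = q (map_pt (\<lambda>y. y) z)" if z: "z \<in> pre_XP" for z
    using z
  proof (rule pre_XPE)
    fix n c t assume h: "z = pt n c t" "c \<in> chains R Y n" "t \<in> standard_simplex n"
      "fix_chain n c \<in> chains R YP n" "\<And>i. t i \<noteq> 0 \<Longrightarrow> fix_chain n c i = c i"
    have "simplex_class X (pt n c t) = simplex_class X (pt n (fix_chain n c) t)"
      by (rule class_support_cong[OF h(2) chains_YP[OF h(4)] h(3)]) (simp add: h(5))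
    then show ?thesis using q_class[OF z, of "map_pt (\<lambda>y. y) z"] chainsD(3)[OF h(4)] by (simp add: h(1) map_pt_pt[OF h(2)])
  qed
  have const: "q (pt 0 ?c ?e) = q (map_pt (\<lambda>_. y0) z)" if z: "z \<in> pre_XP" for z
    using z
  proof (rule pre_XPE)
    fix n c t assume h: "z = pt n c t" "c \<in> chains R Y n" "t \<in> standard_simplex n"
    have o: "(\<lambda>_. 0) \<in> simplicial_ops n 0" by (auto simp: simplicial_ops_def mono_on_def)
    have p: "push_simplex n (\<lambda>_. 0) t = ?e"
      using standard_simplexD(4)[OF h(3)] by (auto simp: push_simplex_def fun_eq_iff atMost_def)
    have "simplex_class X (map_pt (\<lambda>_. y0) z) = simplex_class X (pt 0 ?c ?e)"
      using class_glue[OF o chains_YP[OF c0] h(3)] by (simp add: h(1) map_pt_pt[OF h(2)] p)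
    then show ?thesis by (intro q_class[OF pt0]) (rule sym)
  qed
  have "homotopic_with (\<lambda>_. True) Q Q id F"
    by (rule homotopic_map_pt[OF d1]) (use id F \<kappa>(4) in auto)
  moreover have "homotopic_with (\<lambda>_. True) Q Q (\<lambda>_. q (pt 0 ?c ?e)) F"
    by (rule homotopic_map_pt[OF d2]) (use const F \<kappa>(4) y0(4) in auto)
  ultimately have "homotopic_with (\<lambda>_. True) Q Q id (\<lambda>_. q (pt 0 ?c ?e))"
    using homotopic_with_trans homotopic_with_symD by metis
  then show ?thesis using pt0 tQ by (auto simp: nonempty_contractible_def contractible_space_def)
qed

end

end

section \<open>The Dwyer space as the nerve of a preordered set\<close>

definition embeddings :: "('a, 'b) monoid_scheme \<Rightarrow> 'a set set \<Rightarrow> ('a monoid \<times> ('a \<Rightarrow> 'a)) set" where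
  "embeddings G \<E> = {(H, i). group H \<and> i \<in> mon H G \<and> i \<in> extensional (carrier H) \<and> i ` carrier H \<in> \<E>}"

text \<open>An arrow of the opposite category goes to the embedding of smaller image.\<close>

definition image_ge :: "'a monoid \<times> ('a \<Rightarrow> 'a) \<Rightarrow> 'a monoid \<times> ('a \<Rightarrow> 'a) \<Rightarrow> bool" where
  "image_ge y y' \<longleftrightarrow> snd y' ` carrier (fst y') \<subseteq> snd y ` carrier (fst y)"

definition embedding_act :: "('a, 'b) monoid_scheme \<Rightarrow> 'a \<Rightarrow> 'a monoid \<times> ('a \<Rightarrow> 'a) \<Rightarrow> 'a monoid \<times> ('a \<Rightarrow> 'a)" where
  "embedding_act G g y = (fst y, conj_map G (fst y) g (snd y))"

text \<open>The unique homomorphism \<open>f\<close> with \<open>i' = i \<circ> f\<close>, where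
  \<open>i\<close> and \<open>i'\<close> are the two embeddings; it exists once the image of
  \<open>i'\<close> lies in that of \<open>i\<close>.\<close>

definition transition :: "'a monoid \<times> ('a \<Rightarrow> 'a) \<Rightarrow> 'a monoid \<times> ('a \<Rightarrow> 'a) \<Rightarrow> 'a \<Rightarrow> 'a" where
  "transition y y' = (\<lambda>h\<in>carrier (fst y'). inv_into (carrier (fst y)) (snd y) (snd y' h))"

definition embedding_class :: "('a, 'b) monoid_scheme \<Rightarrow> 'a monoid \<times> ('a \<Rightarrow> 'a) \<Rightarrow> 'a monoid \<times> ('a \<Rightarrow> 'a) set" where
  "embedding_class G y = (fst y, conj_class G (fst y) (snd y))"

text \<open>The chain of objects remembers only conjugacy classes. The point
  \<open>snd (y 0)\<close> of the first class restores the embeddings, since each later one is its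
  composite with the arrow from vertex 0.\<close>

definition dwyer_simplex where
  "dwyer_simplex G n y = ((\<lambda>k\<in>{..n}. embedding_class G (y k),
     \<lambda>(j, k)\<in>ordinal_arrows n. transition (y j) (y k)), snd (y 0))"

lemma embeddingsD:
  assumes "y \<in> embeddings G \<E>"
  shows "group (fst y)" "snd y \<in> hom (fst y) G" "inj_on (snd y) (carrier (fst y))"
    "snd y \<in> extensional (carrier (fst y))" "snd y ` carrier (fst y) \<in> \<E>"
    "snd y \<in> carrier (fst y) \<rightarrow> carrier G"
  using assms by (auto simp: embeddings_def mon_def hom_def)

lemma compose_transition:
  assumes y: "y' \<in> embeddings G \<E>" and R: "image_ge y y'"
  shows "compose (carrier (fst y')) (snd y) (transition y y') = snd y'"
proof
  fix h
  show "compose (carrier (fst y')) (snd y) (transition y y') h = snd y' h"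
  proof (cases "h \<in> carrier (fst y')")
    case True
    then have "snd y' h \<in> snd y ` carrier (fst y)" using R by (auto simp: image_ge_def)
    then show ?thesis using True by (simp add: compose_def transition_def f_inv_into_f)
  next
    case False
    then show ?thesis using embeddingsD(4)[OF y] by (simp add: compose_def extensional_def)
  qed
qed

lemma transition_hom:
  assumes y: "y \<in> embeddings G \<E>" "y' \<in> embeddings G \<E>" and R: "image_ge y y'"
  shows "transition y y' \<in> hom (fst y') (fst y)" "transition y y' \<in> extensional (carrier (fst y'))"
proof -
  have in_img: "snd y' h \<in> snd y ` carrier (fst y)" if "h \<in> carrier (fst y')" for h
    using R that by (auto simp: image_ge_def)
  have cl: "transition y y' h \<in> carrier (fst y)" if "h \<in> carrier (fst y')" for h
    using inv_into_into[OF in_img[OF that]] that by (simp add: transition_def)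
  have eq: "snd y (transition y y' h) = snd y' h" if "h \<in> carrier (fst y')" for h
    using f_inv_into_f[OF in_img[OF that]] that by (simp add: transition_def)
  show "transition y y' \<in> extensional (carrier (fst y'))" by (simp add: transition_def)
  show "transition y y' \<in> hom (fst y') (fst y)"
  proof (rule homI[OF cl])
    fix h k assume h: "h \<in> carrier (fst y')" "k \<in> carrier (fst y')"
    have hk: "h \<otimes>\<^bsub>fst y'\<^esub> k \<in> carrier (fst y')"
      using h embeddingsD(1)[OF y(2)] by (simp add: group.is_monoid monoid.m_closed)
    have hk': "transition y y' h \<otimes>\<^bsub>fst y\<^esub> transition y y' k \<in> carrier (fst y)"
      using cl h embeddingsD(1)[OF y(1)] by (simp add: group.is_monoid monoid.m_closed)
    have "snd y (transition y y' (h \<otimes>\<^bsub>fst y'\<^esub> k)) = snd y' h \<otimes>\<^bsub>G\<^esub> snd y' k"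
      using eq[OF hk] hom_mult[OF embeddingsD(2)[OF y(2)] h] by simp
    also have "\<dots> = snd y (transition y y' h \<otimes>\<^bsub>fst y\<^esub> transition y y' k)"
      using hom_mult[OF embeddingsD(2)[OF y(1)] cl[OF h(1)] cl[OF h(2)]] eq h by simp
    finally show "transition y y' (h \<otimes>\<^bsub>fst y'\<^esub> k) = transition y y' h \<otimes>\<^bsub>fst y\<^esub> transition y y' k"
      by (rule inj_onD[OF embeddingsD(3)[OF y(1)] _ cl[OF hk] hk'])
  qed
qed

lemma transition_unique:
  assumes y: "y \<in> embeddings G \<E>" and f: "f \<in> carrier (fst y') \<rightarrow> carrier (fst y)" "f \<in> extensional (carrier (fst y'))"
    and eq: "compose (carrier (fst y')) (snd y) f = snd y'"
  shows "f = transition y y'"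
proof
  fix h
  show "f h = transition y y' h"
  proof (cases "h \<in> carrier (fst y')")
    case True
    have "snd y' h = snd y (f h)" using True by (simp add: compose_def flip: eq)
    moreover have "f h \<in> carrier (fst y)" using f True by blast
    ultimately show ?thesis using True inv_into_f_f[OF embeddingsD(3)[OF y]] by (simp add: transition_def)
  next
    case False
    then show ?thesis using f by (simp add: transition_def extensional_def)
  qed
qed

lemma transition_refl:
  assumes y: "y \<in> embeddings G \<E>"
  shows "transition y y = (\<lambda>h\<in>carrier (fst y). h)"
proof (rule sym, rule transition_unique[OF y])
  show "compose (carrier (fst y)) (snd y) (\<lambda>h\<in>carrier (fst y). h) = snd y"
    using embeddingsD(4)[OF y] by (auto simp: compose_def extensional_def fun_eq_iff)
qed auto

lemma transition_trans:
  assumes y: "y \<in> embeddings G \<E>" "y' \<in> embeddings G \<E>" "y'' \<in> embeddings G \<E>" and R: "image_ge y y'" "image_ge y' y''"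
  shows "compose (carrier (fst y'')) (transition y y') (transition y' y'') = transition y y''"
proof (rule transition_unique[OF y(1)])
  note t = transition_hom[OF y(1,2) R(1)] transition_hom[OF y(2,3) R(2)]
  show "compose (carrier (fst y'')) (transition y y') (transition y' y'') \<in> carrier (fst y'') \<rightarrow> carrier (fst y)"
    using t by (auto simp: compose_def hom_def)
  show "compose (carrier (fst y'')) (snd y) (compose (carrier (fst y'')) (transition y y') (transition y' y'')) = snd y''"
    using compose_assoc[of "transition y' y''" "carrier (fst y'')" "carrier (fst y')" "snd y" "transition y y'"] t
    by (simp add: hom_def compose_transition[OF y(2) R(1)] compose_transition[OF y(3) R(2)])
qed simp

context group begin

lemma conj_mon:
  assumes g: "g \<in> carrier G" and i: "i \<in> hom H G" "inj_on i (carrier H)" and H: "group H"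
  shows "conj_map G H g i \<in> hom H G" "inj_on (conj_map G H g i) (carrier H)"
    "conj_map G H g i ` carrier H = (\<lambda>x. g \<otimes> x \<otimes> inv g) ` i ` carrier H"
proof -
  have ic: "i h \<in> carrier G" if "h \<in> carrier H" for h using i that by (auto simp: hom_def)
  show "conj_map G H g i \<in> hom H G"
  proof (rule homI)
    fix h k assume h: "h \<in> carrier H" "k \<in> carrier H"
    then have "h \<otimes>\<^bsub>H\<^esub> k \<in> carrier H" using H by (simp add: group.is_monoid monoid.m_closed)
    moreover have "g \<otimes> (i h \<otimes> i k) \<otimes> inv g = (g \<otimes> i h \<otimes> inv g) \<otimes> (g \<otimes> i k \<otimes> inv g)"
      using g ic[OF h(1)] ic[OF h(2)] by (simp add: m_assoc inv_solve_left' flip: m_assoc[of "inv g" g])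
    ultimately show "conj_map G H g i (h \<otimes>\<^bsub>H\<^esub> k) = conj_map G H g i h \<otimes> conj_map G H g i k"
      using h hom_mult[OF i(1) h] by (simp add: conj_map_def)
  qed (use g ic in \<open>auto simp: conj_map_def\<close>)
  show "inj_on (conj_map G H g i) (carrier H)"
  proof (rule inj_onI)
    fix h k assume h: "h \<in> carrier H" "k \<in> carrier H" and "conj_map G H g i h = conj_map G H g i k"
    then have "i h = i k" using g ic by (simp add: conj_map_def)
    then show "h = k" using inj_onD[OF i(2)] h by blast
  qed
  show "conj_map G H g i ` carrier H = (\<lambda>x. g \<otimes> x \<otimes> inv g) ` i ` carrier H"
    by (auto simp: conj_map_def image_image)
qed

context
  fixes \<E> :: "'a set set"
  assumes conj_closed: "\<And>g K. g \<in> carrier G \<Longrightarrow> K \<in> \<E> \<Longrightarrow> (\<lambda>x. g \<otimes> x \<otimes> inv g) ` K \<in> \<E>"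
begin

abbreviation "\<Y> \<equiv> embeddings G \<E>"
abbreviation "\<C> \<equiv> conj_category G \<E>"

lemma embedding_act_closed:
  assumes "g \<in> carrier G" "y \<in> \<Y>" shows "embedding_act G g y \<in> \<Y>"
  using conj_mon[OF assms(1) embeddingsD(2,3,1)[OF assms(2)]] embeddingsD[OF assms(2)] conj_closed[OF assms(1)]
  by (simp add: embeddings_def embedding_act_def mon_def) (simp add: conj_map_def)

lemma embedding_class_ob: "y \<in> \<Y> \<Longrightarrow> embedding_class G y \<in> Ob \<C>"
  by (auto simp: embeddings_def embedding_class_def conj_category_def)

lemma embedding_class_self: "y \<in> \<Y> \<Longrightarrow> snd y \<in> snd (embedding_class G y)"
  unfolding embedding_class_def snd_conv by (intro conj_class_self embeddingsD)

text \<open>Conjugates of an embedding are embeddings with the same class, so an object together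
  with a member of its class amounts to one embedding.\<close>

lemma ob_embedding:
  assumes a: "a \<in> Ob \<C>" and x: "x \<in> snd a"
  shows "(fst a, x) \<in> \<Y>" "embedding_class G (fst a, x) = a"
proof -
  obtain i where y: "(fst a, i) \<in> \<Y>" and I: "snd a = conj_class G (fst a) i"
    using a by (auto simp: conj_category_def embeddings_def)
  obtain g where g: "g \<in> carrier G" "x = conj_map G (fst a) g i"
    using x by (auto simp: I conj_class_alt)
  show "(fst a, x) \<in> \<Y>" using embedding_act_closed[OF g(1) y] by (simp add: embedding_act_def g(2))
  show "embedding_class G (fst a, x) = a"
    using conj_class_eq[of x "fst a" i] x I embeddingsD(6)[OF y] by (simp add: embedding_class_def prod_eq_iff)
qed

lemma transition_Hom:
  assumes y: "y \<in> \<Y>" "y' \<in> \<Y>" and R: "image_ge y y'"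
  shows "transition y y' \<in> Hom \<C> (embedding_class G y') (embedding_class G y)"
proof -
  have "conj_class G (fst y') (snd y') = conj_class G (fst y') (compose (carrier (fst y')) (snd y) (transition y y'))"
    by (simp add: compose_transition[OF y(2) R])
  then show ?thesis
    using transition_hom[OF y R] embedding_class_self[OF y(1)] embedding_class_self[OF y(2)]
    unfolding conj_category_def embedding_class_def by auto
qed

lemma dwyer_simplex_in:
  assumes y: "y \<in> chains image_ge \<Y> n"
  shows "dwyer_simplex G n y \<in> simplices (dwyer_sset G \<E>) n"
proof -
  have yk: "y k \<in> \<Y>" if "k \<le> n" for k using chainsD(1)[OF y that] .
  have R: "image_ge (y j) (y k)" if "j \<le> k" "k \<le> n" for j k using chainsD(2)[OF y that] .
  have tH: "transition (y j) (y k) \<in> Hom \<C> (embedding_class G (y k)) (embedding_class G (y j))" if "j \<le> k" "k \<le> n" for j k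
    by (rule transition_Hom[OF yk yk R]) (use that in simp_all)
  show ?thesis
    unfolding dwyer_sset_def dwyer_simplex_def hocolim_simps nerve_simps
  proof (intro conjI allI impI)
    show "(\<lambda>k\<in>{..n}. embedding_class G (y k)) \<in> {..n} \<rightarrow>\<^sub>E Ob (op_cat \<C>)"
      using embedding_class_ob yk by auto
    show "(\<lambda>(j, k)\<in>ordinal_arrows n. transition (y j) (y k)) \<in> (\<Pi>\<^sub>E (i, j)\<in>ordinal_arrows n.
        Hom (op_cat \<C>) ((\<lambda>k\<in>{..n}. embedding_class G (y k)) i) ((\<lambda>k\<in>{..n}. embedding_class G (y k)) j))"
      using tH by (auto simp: ordinal_arrows_def)
  next
    fix k assume "k \<le> n"
    then show "(\<lambda>(j, k)\<in>ordinal_arrows n. transition (y j) (y k)) (k, k) = Idt (op_cat \<C>) ((\<lambda>k\<in>{..n}. embedding_class G (y k)) k)"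
      using transition_refl[OF yk] by (simp add: ordinal_arrows_def embedding_class_def)
  next
    fix i j k assume ijk: "i \<le> j \<and> j \<le> k \<and> k \<le> n"
    then show "(\<lambda>(j, k)\<in>ordinal_arrows n. transition (y j) (y k)) (i, k) =
       Comp (op_cat \<C>) ((\<lambda>k\<in>{..n}. embedding_class G (y k)) i) ((\<lambda>k\<in>{..n}. embedding_class G (y k)) j)
        ((\<lambda>k\<in>{..n}. embedding_class G (y k)) k)
        ((\<lambda>(j, k)\<in>ordinal_arrows n. transition (y j) (y k)) (j, k)) ((\<lambda>(j, k)\<in>ordinal_arrows n. transition (y j) (y k)) (i, j))"
      using transition_trans[OF yk[of i] yk[of j] yk[of k]] R[of i j] R[of j k]
      by (simp add: ordinal_arrows_def embedding_class_def)
  next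
    show "snd (y 0) \<in> dset (alpha_functor G) ((\<lambda>k\<in>{..n}. embedding_class G (y k)) 0)"
      using embedding_class_self[OF yk[of 0]] by (simp add: embedding_class_def)
  qed
qed

lemma dwyer_simplex_inj: "inj_on (dwyer_simplex G n) (chains image_ge \<Y> n)"
proof (rule inj_onI)
  fix y y' assume y: "y \<in> chains image_ge \<Y> n" "y' \<in> chains image_ge \<Y> n" and eq: "dwyer_simplex G n y = dwyer_simplex G n y'"
  have "y k = y' k" if k: "k \<le> n" for k
  proof -
    have c: "(\<lambda>k\<in>{..n}. embedding_class G (y k)) k = (\<lambda>k\<in>{..n}. embedding_class G (y' k)) k"
      and u: "(\<lambda>(j, k)\<in>ordinal_arrows n. transition (y j) (y k)) (0, k) = (\<lambda>(j, k)\<in>ordinal_arrows n. transition (y' j) (y' k)) (0, k)"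
      and x: "snd (y 0) = snd (y' 0)"
      using eq by (simp_all add: dwyer_simplex_def)
    have 1: "fst (y k) = fst (y' k)" using c k by (simp add: embedding_class_def)
    have "snd (y k) = compose (carrier (fst (y k))) (snd (y 0)) (transition (y 0) (y k))"
      using compose_transition[OF chainsD(1,2)[OF y(1)]] k by simp
    also have "\<dots> = compose (carrier (fst (y' k))) (snd (y' 0)) (transition (y' 0) (y' k))"
      using u k 1 x by (simp add: ordinal_arrows_def)
    also have "\<dots> = snd (y' k)" using compose_transition[OF chainsD(1,2)[OF y(2)]] k by simp
    finally show ?thesis using 1 by (simp add: prod_eq_iff)
  qed
  then have "restrict y {..n} = restrict y' {..n}" by (intro restrict_cong) (auto simp: simp_implies_def)
  then show "y = y'" by (simp add: chainsD(3)[OF y(1)] chainsD(3)[OF y(2)])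
qed

lemma dwyer_simplex_surj:
  assumes s: "s \<in> simplices (dwyer_sset G \<E>) n"
  shows "s \<in> dwyer_simplex G n ` chains image_ge \<Y> n"
proof -
  obtain c u x where scu: "s = ((c, u), x)" by (metis surj_pair)
  have cu: "(c, u) \<in> simplices (nerve (op_cat \<C>)) n" and x: "x \<in> snd (c 0)"
    using s by (simp_all add: scu dwyer_sset_def alpha_functor_def split: prod.splits)
  have c: "c k \<in> Ob \<C>" if "k \<le> n" for k using cu that by (auto simp: nerve_simps)
  have u: "u (j, k) \<in> Hom \<C> (c k) (c j)" if "j \<le> k" "k \<le> n" for j k
    using cu that by (fastforce simp: nerve_simps ordinal_arrows_def PiE_iff)
  have u': "u (j, k) \<in> hom (fst (c k)) (fst (c j))" "u (j, k) \<in> extensional (carrier (fst (c k)))"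
    "snd (c k) = (\<lambda>i. compose (carrier (fst (c k))) i (u (j, k))) ` snd (c j)" if "j \<le> k" "k \<le> n" for j k
    using Hom_iff[of "fst (c k)" "snd (c k)" \<E> "fst (c j)" "snd (c j)" "u (j, k)"] c[of k] c[of j] u[OF that] that by simp_all
  have ucomp: "u (i, k) = compose (carrier (fst (c k))) (u (i, j)) (u (j, k))" if "i \<le> j" "j \<le> k" "k \<le> n" for i j k
  proof -
    have "u (i, k) = Comp (op_cat \<C>) (c i) (c j) (c k) (u (j, k)) (u (i, j))"
      using cu that unfolding nerve_simps by blast
    then show ?thesis by (cases "c k") (simp add: conj_category_def)
  qed
  \<comment> \<open>The embedding \<open>x\<close> is restricted along the arrow from vertex 0.
    Functoriality of the chain then forces every \<open>u (j, k)\<close> to be a transition.\<close>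
  define y where "y = (\<lambda>k\<in>{..n}. (fst (c k), compose (carrier (fst (c k))) x (u (0, k))))"
  have yk: "y k = (fst (c k), compose (carrier (fst (c k))) x (u (0, k)))" if "k \<le> n" for k using that by (simp add: y_def)
  have mem: "snd (y k) \<in> snd (c k)" if "k \<le> n" for k
    using u'(3)[of 0 k] that x by (simp add: yk)
  have Y: "y k \<in> \<Y>" and cl: "embedding_class G (y k) = c k" if "k \<le> n" for k
    using ob_embedding[OF c[OF that] mem[OF that]] that by (simp_all add: yk)
  have comp: "compose (carrier (fst (c k))) (snd (y j)) (u (j, k)) = snd (y k)" if "j \<le> k" "k \<le> n" for j k
    using compose_assoc[of "u (j, k)" "carrier (fst (c k))" "carrier (fst (c j))" x "u (0, j)"]
      u'(1)[OF that] ucomp[of 0 j k] that by (simp add: yk hom_def)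
  have tr: "u (j, k) = transition (y j) (y k)" if "j \<le> k" "k \<le> n" for j k
    by (rule transition_unique[OF Y]) (use that u'(1,2)[OF that] comp[OF that] in \<open>simp_all add: yk hom_def\<close>)
  have R: "image_ge (y j) (y k)" if "j \<le> k" "k \<le> n" for j k
    unfolding image_ge_def comp[OF that, symmetric] using u'(1)[OF that] that by (auto simp: yk hom_def compose_def)
  have "restrict y {..n} \<in> chains image_ge \<Y> n" by (rule chainsI) (use Y R in auto)
  then have ych: "y \<in> chains image_ge \<Y> n" by (simp add: y_def)
  have "x \<in> extensional (carrier (fst (c 0)))" using embeddingsD(4)[OF ob_embedding(1)[OF c x]] by simp
  moreover have "u (0, 0) = (\<lambda>h\<in>carrier (fst (c 0)). h)"
    using tr[of 0 0] transition_refl[OF Y[of 0]] by (simp add: yk)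
  ultimately have "snd (y 0) = x" by (auto simp: yk compose_def extensional_def fun_eq_iff)
  moreover have "restrict (\<lambda>k. embedding_class G (y k)) {..n} = c"
  proof -
    have "restrict (\<lambda>k. embedding_class G (y k)) {..n} = restrict c {..n}"
      by (intro restrict_cong) (auto simp: simp_implies_def cl)
    also have "\<dots> = c" using cu by (auto simp: nerve_simps PiE_def extensional_restrict)
    finally show ?thesis .
  qed
  moreover have "(\<lambda>(j, k)\<in>ordinal_arrows n. transition (y j) (y k)) = u"
  proof -
    have "(\<lambda>(j, k)\<in>ordinal_arrows n. transition (y j) (y k)) = restrict u (ordinal_arrows n)"
      by (intro restrict_cong) (auto simp: simp_implies_def tr ordinal_arrows_def)
    also have "\<dots> = u" using cu by (auto simp: nerve_simps PiE_def extensional_restrict)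
    finally show ?thesis .
  qed
  ultimately have "s = dwyer_simplex G n y" by (simp add: scu dwyer_simplex_def)
  then show ?thesis using ych by blast
qed

lemma chain_model_dwyer:
  "chain_model G (dwyer_sset G \<E>) \<Y> image_ge (embedding_act G) (dwyer_simplex G)"
proof (intro chain_model.intro chain_model_axioms.intro is_group)
  fix n
  show "bij_betw (dwyer_simplex G n) (chains image_ge \<Y> n) (simplices (dwyer_sset G \<E>) n)"
    unfolding bij_betw_def using dwyer_simplex_inj dwyer_simplex_in dwyer_simplex_surj by blast
next
  fix \<theta> m n y assume th: "\<theta> \<in> simplicial_ops m n" and y: "y \<in> chains image_ge \<Y> n"
  have le: "\<theta> i \<le> n" if "i \<le> m" for i using opsD(2)[OF th order_refl that] .
  have mo: "\<theta> i \<le> \<theta> j" if "i \<le> j" "j \<le> m" for i j using opsD(1)[OF th that] .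
  have 1: "(\<lambda>i\<in>{..m}. (\<lambda>k\<in>{..n}. embedding_class G (y k)) (\<theta> i)) = (\<lambda>k\<in>{..m}. embedding_class G ((\<lambda>i\<in>{..m}. y (\<theta> i)) k))"
    by (intro restrict_cong) (auto simp: simp_implies_def le)
  have 2: "(\<lambda>(i, j)\<in>ordinal_arrows m. (\<lambda>(j, k)\<in>ordinal_arrows n. transition (y j) (y k)) (\<theta> i, \<theta> j)) =
      (\<lambda>(j, k)\<in>ordinal_arrows m. transition ((\<lambda>i\<in>{..m}. y (\<theta> i)) j) ((\<lambda>i\<in>{..m}. y (\<theta> i)) k))"
    by (intro restrict_cong) (auto simp: simp_implies_def le mo ordinal_arrows_def)
  have 0: "image_ge (y 0) (y (\<theta> 0))" "y (\<theta> 0) \<in> \<Y>" "y 0 \<in> \<Y>" using chainsD(1,2)[OF y] le[of 0] by auto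
  have 3: "(\<lambda>(j, k)\<in>ordinal_arrows n. transition (y j) (y k)) (0, \<theta> 0) = transition (y 0) (y (\<theta> 0))"
    using le[of 0] by (simp add: ordinal_arrows_def)
  \<comment> \<open>When the initial vertex changes, the functor restricts the first embedding along
    the arrow, and the result is the embedding at the new initial vertex.\<close>
  have 4: "dmap (alpha_functor G) (embedding_class G (y 0)) (embedding_class G (y (\<theta> 0))) (transition (y 0) (y (\<theta> 0))) (snd (y 0)) = snd (y (\<theta> 0))"
    using embedding_class_self[OF 0(3)] compose_transition[OF 0(2,1)] by (simp add: embedding_class_def)
  show "pull (dwyer_sset G \<E>) m n \<theta> (dwyer_simplex G n y) = dwyer_simplex G m (\<lambda>i\<in>{..m}. y (\<theta> i))"
    unfolding dwyer_sset_def dwyer_simplex_def hocolim_simps nerve_pull 1 2 3 using 4 le[of 0] by simp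
next
  fix g n y assume g: "g \<in> carrier G" and y: "y \<in> chains image_ge \<Y> n"
  have yk: "y k \<in> \<Y>" if "k \<le> n" for k using chainsD(1)[OF y that] .
  have R: "image_ge (y j) (y k)" if "j \<le> k" "k \<le> n" for j k using chainsD(2)[OF y that] .
  let ?y = "\<lambda>i\<in>{..n}. embedding_act G g (y i)"
  have 1: "(\<lambda>k\<in>{..n}. embedding_class G (y k)) = (\<lambda>k\<in>{..n}. embedding_class G (?y k))"
    by (intro restrict_cong)
      (auto simp: simp_implies_def embedding_class_def embedding_act_def conj_class_conj_map g embeddingsD(6)[OF yk])
  \<comment> \<open>Conjugation by \<open>g\<close> acts on both embeddings, so the old homomorphism
    satisfies the equation that characterizes the new transition.\<close>
  have "transition (y j) (y k) = transition (embedding_act G g (y j)) (embedding_act G g (y k))" if jk: "j \<le> k" "k \<le> n" for j k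
  proof (rule transition_unique[OF embedding_act_closed[OF g yk]])
    note t = transition_hom[OF yk[of j] yk[of k] R[OF jk]]
    show "transition (y j) (y k) \<in> carrier (fst (embedding_act G g (y k))) \<rightarrow> carrier (fst (embedding_act G g (y j)))"
      "transition (y j) (y k) \<in> extensional (carrier (fst (embedding_act G g (y k))))"
      using t jk by (auto simp: embedding_act_def hom_def)
    show "compose (carrier (fst (embedding_act G g (y k)))) (snd (embedding_act G g (y j))) (transition (y j) (y k)) = snd (embedding_act G g (y k))"
      using conj_map_compose[OF t(1), of G g "snd (y j)"] jk
      by (simp add: embedding_act_def compose_transition[OF yk R])
  qed (use jk in simp)
  then have 2: "(\<lambda>(j, k)\<in>ordinal_arrows n. transition (y j) (y k)) = (\<lambda>(j, k)\<in>ordinal_arrows n. transition (?y j) (?y k))"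
    by (intro restrict_cong) (auto simp: simp_implies_def ordinal_arrows_def)
  have s: "dwyer_simplex G n y \<in> simplices (hocolim (op_cat \<C>) (alpha_functor G)) n"
    using dwyer_simplex_in[OF y] by (simp add: dwyer_sset_def)
  have 3: "dact (alpha_functor G) (embedding_class G (y 0)) g (snd (y 0)) = snd (?y 0)"
    using embedding_class_self[OF yk[of 0]] by (simp add: embedding_class_def embedding_act_def)
  have "sact (dwyer_sset G \<E>) n g (dwyer_simplex G n y) =
      ((\<lambda>k\<in>{..n}. embedding_class G (y k), \<lambda>(j, k)\<in>ordinal_arrows n. transition (y j) (y k)), snd (?y 0))"
    using s 3 unfolding dwyer_sset_def dwyer_simplex_def by simp
  then show "sact (dwyer_sset G \<E>) n g (dwyer_simplex G n y) = dwyer_simplex G n ?y"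
    unfolding dwyer_simplex_def[of G n ?y] 1[symmetric] 2[symmetric] .
next
  fix g y assume "g \<in> carrier G" "y \<in> \<Y>"
  then show "embedding_act G g y \<in> \<Y>" by (rule embedding_act_closed)
next
  fix g h y assume "g \<in> carrier G" "h \<in> carrier G" "y \<in> \<Y>"
  then show "embedding_act G g (embedding_act G h y) = embedding_act G (g \<otimes> h) y"
    using conj_map_mult[OF _ _ embeddingsD(6)] by (simp add: embedding_act_def)
next
  fix y assume "y \<in> \<Y>"
  from conj_map_one[OF embeddingsD(6)[OF this] embeddingsD(4)[OF this]]
  show "embedding_act G \<one> y = y" by (simp add: embedding_act_def)
next
  fix g y y' assume "g \<in> carrier G" "y \<in> \<Y>" "y' \<in> \<Y>" and R: "image_ge y y'"
  then have "(\<lambda>x. g \<otimes> x \<otimes> inv g) ` snd y' ` carrier (fst y') \<subseteq> (\<lambda>x. g \<otimes> x \<otimes> inv g) ` snd y ` carrier (fst y)"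
    unfolding image_ge_def by (intro image_mono)
  then show "image_ge (embedding_act G g y) (embedding_act G g y')"
    using conj_mon(3)[OF \<open>g \<in> carrier G\<close> embeddingsD(2,3,1)[OF \<open>y \<in> \<Y>\<close>]] conj_mon(3)[OF \<open>g \<in> carrier G\<close> embeddingsD(2,3,1)[OF \<open>y' \<in> \<Y>\<close>]]
    by (simp add: image_ge_def embedding_act_def)
qed

end

end

section \<open>Elementary abelian subgroups\<close>

text \<open>Conjugacy classes outside the centre have size divisible by \<open>p\<close>, hence so does the centre.\<close>

lemma p_group_center_nontrivial:
  assumes H: "group H" and p: "prime p" and fin: "finite (carrier H)" and card: "card (carrier H) = p ^ k"
    and ne: "carrier H \<noteq> {\<one>\<^bsub>H\<^esub>}"
  obtains z where "z \<in> carrier H" "z \<noteq> \<one>\<^bsub>H\<^esub>" "\<And>x. x \<in> carrier H \<Longrightarrow> z \<otimes>\<^bsub>H\<^esub> x = x \<otimes>\<^bsub>H\<^esub> z"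
proof -
  interpret group H by fact
  let ?\<phi> = "\<lambda>g. \<lambda>h\<in>carrier H. g \<otimes>\<^bsub>H\<^esub> h \<otimes>\<^bsub>H\<^esub> inv\<^bsub>H\<^esub> g"
  interpret conj: group_action H "carrier H" ?\<phi> by (rule action_by_conjugation)
  define Z where "Z = {z \<in> carrier H. \<forall>x\<in>carrier H. z \<otimes>\<^bsub>H\<^esub> x = x \<otimes>\<^bsub>H\<^esub> z}"
  \<comment> \<open>\<open>f\<close> counts non-central elements: an orbit meeting \<open>Z\<close>
    is a single point and contributes 0, while any other orbit contributes its cardinality, a
    positive power of \<open>p\<close>.\<close>
  define f where "f x = (if x \<in> Z then 0 else 1::nat)" for x
  have triv: "?\<phi> g z = z" if "g \<in> carrier H" "z \<in> Z" for g z
    using that by (auto simp: Z_def m_assoc[symmetric]) (metis inv_closed m_assoc r_inv r_one)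
  have "p dvd (\<Sum>x\<in>orb. f x)" if orb: "orb \<in> orbits H (carrier H) ?\<phi>" for orb
  proof -
    obtain x where x: "x \<in> carrier H" "orb = orbit H ?\<phi> x" using orb by (auto simp: orbits_def)
    show ?thesis
    proof (cases "orb \<inter> Z = {}")
      case False
      then obtain z where z: "z \<in> orb" "z \<in> Z" by blast
      have zc: "z \<in> carrier H" using z by (simp add: Z_def)
      have "y = z" if "y \<in> orb" for y
      proof -
        have "x \<in> orbit H ?\<phi> z" using conj.orbit_sym[OF x(1) zc] z(1) x(2) by simp
        then have "x = z" using triv[OF _ z(2)] by (auto simp: orbit_def simp del: restrict_apply)
        then show ?thesis using that triv[OF _ z(2)] by (auto simp: x(2) orbit_def simp del: restrict_apply)
      qed
      then have "(\<Sum>x\<in>orb. f x) = 0" using z(2) by (intro sum.neutral) (auto simp: f_def)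
      then show ?thesis by simp
    next
      case True
      then have s: "(\<Sum>x\<in>orb. f x) = card orb" by (subst sum.cong[OF refl, of orb f "\<lambda>_. 1"]) (auto simp: f_def)
      have xo: "x \<in> orb" using conj.orbit_refl[OF x(1)] x(2) by simp
      then have "x \<notin> Z" using True by blast
      have "p ^ k = card orb * card (stabilizer H ?\<phi> x)"
        unfolding x(2) card[symmetric] order_def[symmetric] by (rule conj.orbit_stabilizer_theorem[OF x(1), symmetric])
      then have "card orb dvd p ^ k" by (rule dvdI)
      then obtain i where i: "card orb = p ^ i" using divides_primepow_nat[OF p] by blast
      have "i \<noteq> 0"
      proof
        assume "i = 0"
        then have "card orb = 1" using i by simp
        then have orb1: "orb = {x}" using xo by (metis card_1_singletonE singletonD)
        have "x \<in> Z"
          unfolding Z_def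
        proof (intro CollectI conjI ballI x(1))
          fix g assume g: "g \<in> carrier H"
          have "?\<phi> g x \<in> orb" using g unfolding x(2) orbit_def by blast
          then have "g \<otimes>\<^bsub>H\<^esub> x \<otimes>\<^bsub>H\<^esub> inv\<^bsub>H\<^esub> g = x" using orb1 x(1) by simp
          then show "x \<otimes>\<^bsub>H\<^esub> g = g \<otimes>\<^bsub>H\<^esub> x" using g x(1) by (metis inv_closed inv_solve_right m_closed)
        qed
        with \<open>x \<notin> Z\<close> show False by blast
      qed
      then show ?thesis using i s by simp
    qed
  qed
  then have "p dvd (\<Sum>orb\<in>orbits H (carrier H) ?\<phi>. \<Sum>x\<in>orb. f x)" by (rule dvd_sum)
  then have "p dvd (\<Sum>x\<in>carrier H. f x)" using conj.disjoint_sum[OF fin, of f] by simp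
  also have "(\<Sum>x\<in>carrier H. f x) = card (carrier H - Z)"
    using fin by (subst sum.mono_neutral_right[of _ "carrier H - Z"]) (auto simp: f_def)
  also have "\<dots> = card (carrier H) - card Z"
    using fin by (intro card_Diff_subset finite_subset[of Z "carrier H"]) (auto simp: Z_def)
  finally have 1: "p dvd card (carrier H) - card Z" .
  have "k \<noteq> 0" using card ne one_closed by (metis card_1_singletonE power_0 singletonD)
  then have "p dvd card (carrier H)" using card by simp
  moreover have "card Z \<le> card (carrier H)" using fin by (intro card_mono) (auto simp: Z_def)
  ultimately have "p dvd card Z" using 1 by (metis dvd_diffD1)
  then have "Z \<noteq> {\<one>\<^bsub>H\<^esub>}" using p by (metis card.empty card_insert_disjoint empty_iff finite.emptyI nat_dvd_1_iff_1 not_prime_1 One_nat_def)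
  moreover have "\<one>\<^bsub>H\<^esub> \<in> Z" by (simp add: Z_def)
  ultimately obtain z where "z \<in> Z" "z \<noteq> \<one>\<^bsub>H\<^esub>" by blast
  then show thesis using that by (auto simp: Z_def)
qed

section \<open>Central torsion of a p-group and products of elementary abelian subgroups\<close>

context group begin

lemma inv_commute:
  assumes "a \<otimes> x = x \<otimes> a" "a \<in> carrier G" "x \<in> carrier G" shows "inv a \<otimes> x = x \<otimes> inv a"
proof -
  have "inv a \<otimes> x = inv a \<otimes> (x \<otimes> a) \<otimes> inv a" using assms(2,3) by (simp add: m_assoc)
  also have "\<dots> = x \<otimes> inv a" using assms(2,3) by (simp flip: assms(1) m_assoc)
  finally show ?thesis .
qed

lemma mult_commute:
  assumes "a \<otimes> x = x \<otimes> a" "b \<otimes> x = x \<otimes> b" "a \<in> carrier G" "b \<in> carrier G" "x \<in> carrier G"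
  shows "a \<otimes> b \<otimes> x = x \<otimes> (a \<otimes> b)"
proof -
  have "a \<otimes> b \<otimes> x = a \<otimes> x \<otimes> b" using assms(3-5) by (simp add: m_assoc assms(2))
  then show ?thesis using assms by (simp add: m_assoc)
qed

text \<open>For a \<open>p\<close>-group this is the subgroup usually written Omega_1(Z(P)).\<close>

definition central_torsion :: "nat \<Rightarrow> 'a set \<Rightarrow> 'a set" where
  "central_torsion p P = {z \<in> P. z [^] p = \<one> \<and> (\<forall>x\<in>P. z \<otimes> x = x \<otimes> z)}"

lemma central_torsion_nontrivial:
  assumes p: "prime p" and P: "finite_p_subgroup p P G" and ne: "P \<noteq> {\<one>}"
  shows "central_torsion p P \<noteq> {\<one>}"
proof -
  have sub: "subgroup P G" and fin: "finite P" using P by (auto simp: finite_p_subgroup_def)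
  obtain k where k: "card P = p ^ k" using P by (auto simp: finite_p_subgroup_def)
  let ?H = "G\<lparr>carrier := P\<rparr>"
  have H: "group ?H" by (rule subgroup.subgroup_is_group[OF sub is_group])
  obtain x where x: "x \<in> P" "x \<noteq> \<one>" "\<And>y. y \<in> P \<Longrightarrow> x \<otimes> y = y \<otimes> x"
    using p_group_center_nontrivial[OF H p] fin k ne by auto
  have PG: "y \<in> carrier G" if "y \<in> P" for y using sub that by (rule subgroup.mem_carrier)
  have pow: "y [^] n \<in> P" if "y \<in> P" for y and n :: nat
    using monoid.nat_pow_closed[OF group.is_monoid[OF H], of y n] that nat_pow_consistent[of y n P] by simp
  have "x [^] (p ^ k) = \<one>"
    using group.pow_order_eq_1[OF H, of x] x(1) k nat_pow_consistent[of x "p ^ k" P] by (simp add: order_def)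
  then have "ord x dvd p ^ k" using pow_eq_id PG x(1) by simp
  then obtain j where j: "ord x = p ^ j" using divides_primepow_nat[OF p] by blast
  have "j \<noteq> 0" using j x(2) ord_eq_1[OF PG[OF x(1)]] by (metis power_0)
  then obtain l where l: "j = Suc l" by (cases j) auto
  \<comment> \<open>The order of \<open>x\<close> is \<open>p ^ Suc l\<close>, so this power of
    \<open>x\<close> has order exactly \<open>p\<close>.\<close>
  define z where "z = x [^] (p ^ l)"
  have "z [^] p = x [^] ord x" using PG[OF x(1)] by (simp add: z_def nat_pow_pow j l mult.commute)
  then have "z [^] p = \<one>" using PG[OF x(1)] by simp
  moreover have "z \<noteq> \<one>"
  proof
    assume "z = \<one>"
    then have "p ^ Suc l dvd p ^ l" using pow_eq_id[OF PG[OF x(1)]] j l by (simp add: z_def)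
    then show False using prime_gt_1_nat[OF p] by (simp add: power_dvd_imp_le dvd_power_iff_le)
  qed
  moreover have "z \<otimes> y = y \<otimes> z" if "y \<in> P" for y
    unfolding z_def by (rule group_commutes_pow) (use x that PG in auto)
  ultimately have "z \<in> central_torsion p P" using pow[OF x(1)] by (simp add: central_torsion_def z_def)
  then show ?thesis using \<open>z \<noteq> \<one>\<close> by blast
qed

lemma elementary_abelian_central_torsion:
  assumes P: "subgroup P G"
  shows "elementary_abelian_subgroup p (central_torsion p P) G"
proof -
  have PG: "y \<in> carrier G" if "y \<in> P" for y using P that by (rule subgroup.mem_carrier)
  have "subgroup (central_torsion p P) G"
  proof (rule subgroupI)
    show "central_torsion p P \<subseteq> carrier G" using PG by (auto simp: central_torsion_def)
    show "central_torsion p P \<noteq> {}" using subgroup.one_closed[OF P] PG by (force simp: central_torsion_def)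
  next
    fix a assume a: "a \<in> central_torsion p P"
    then have aP: "a \<in> P" and ap: "a [^] p = \<one>" and ac: "\<And>x. x \<in> P \<Longrightarrow> a \<otimes> x = x \<otimes> a" by (auto simp: central_torsion_def)
    have "inv a \<otimes> x = x \<otimes> inv a" if "x \<in> P" for x
      by (rule inv_commute[OF ac[OF that] PG[OF aP] PG[OF that]])
    then show "inv a \<in> central_torsion p P"
      using subgroup.m_inv_closed[OF P aP] ap PG[OF aP] by (simp add: central_torsion_def nat_pow_inv)
  next
    fix a b assume a: "a \<in> central_torsion p P" and b: "b \<in> central_torsion p P"
    then have ab: "a \<in> P" "b \<in> P" "a [^] p = \<one>" "b [^] p = \<one>" and ac: "\<And>x. x \<in> P \<Longrightarrow> a \<otimes> x = x \<otimes> a"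
      and bc: "\<And>x. x \<in> P \<Longrightarrow> b \<otimes> x = x \<otimes> b" by (auto simp: central_torsion_def)
    have "a \<otimes> b \<otimes> x = x \<otimes> (a \<otimes> b)" if "x \<in> P" for x
      by (rule mult_commute[OF ac[OF that] bc[OF that] PG[OF ab(1)] PG[OF ab(2)] PG[OF that]])
    then show "a \<otimes> b \<in> central_torsion p P"
      using subgroup.m_closed[OF P ab(1,2)] pow_mult_distrib[OF ac[OF ab(2)], of p] ab PG by (simp add: central_torsion_def)
  qed
  then show ?thesis
    unfolding elementary_abelian_subgroup_def central_torsion_def by blast
qed

text \<open>As \<open>A\<close> and \<open>B\<close> commute elementwise, multiplication is a
  homomorphism on their direct product, and the required identities hold componentwise.\<close>

lemma elementary_abelian_set_mult:
  assumes A: "elementary_abelian_subgroup p A G" and B: "elementary_abelian_subgroup p B G"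
    and comm: "\<And>a b. a \<in> A \<Longrightarrow> b \<in> B \<Longrightarrow> a \<otimes> b = b \<otimes> a"
  shows "elementary_abelian_subgroup p (A <#> B) G"
proof -
  have sA: "subgroup A G" and sB: "subgroup B G" using A B by (auto simp: elementary_abelian_subgroup_def)
  have AG: "a \<in> carrier G" if "a \<in> A" for a using sA that by (rule subgroup.mem_carrier)
  have BG: "b \<in> carrier G" if "b \<in> B" for b using sB that by (rule subgroup.mem_carrier)
  have mult: "(a \<otimes> b) \<otimes> (a' \<otimes> b') = (a \<otimes> a') \<otimes> (b \<otimes> b')" if "a \<in> A" "a' \<in> A" "b \<in> B" "b' \<in> B" for a a' b b'
    using comm[OF that(2,3)] AG[OF that(1)] AG[OF that(2)] BG[OF that(3)] BG[OF that(4)] by (metis m_assoc m_closed)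
  have "subgroup (A <#> B) G"
  proof (rule subgroupI)
    show "A <#> B \<subseteq> carrier G" using AG BG by (auto simp: set_mult_def)
    show "A <#> B \<noteq> {}" using subgroup.one_closed[OF sA] subgroup.one_closed[OF sB] by (auto simp: set_mult_def)
  next
    fix x assume "x \<in> A <#> B"
    then obtain a b where x: "a \<in> A" "b \<in> B" "x = a \<otimes> b" by (auto simp: set_mult_def)
    have "inv x = inv a \<otimes> inv b"
      using comm[OF subgroup.m_inv_closed[OF sA x(1)] subgroup.m_inv_closed[OF sB x(2)]] AG[OF x(1)] BG[OF x(2)]
      by (simp add: x(3) inv_mult_group)
    then show "inv x \<in> A <#> B"
      using subgroup.m_inv_closed[OF sA x(1)] subgroup.m_inv_closed[OF sB x(2)] by (auto simp: set_mult_def)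
  next
    fix x y assume "x \<in> A <#> B" "y \<in> A <#> B"
    then obtain a b a' b' where x: "a \<in> A" "b \<in> B" "x = a \<otimes> b" and y: "a' \<in> A" "b' \<in> B" "y = a' \<otimes> b'" by (auto simp: set_mult_def)
    then show "x \<otimes> y \<in> A <#> B"
      using mult[of a a' b b'] subgroup.m_closed[OF sA x(1) y(1)] subgroup.m_closed[OF sB x(2) y(2)] by (auto simp: set_mult_def)
  qed
  moreover have "x \<otimes> y = y \<otimes> x" if "x \<in> A <#> B" "y \<in> A <#> B" for x y
  proof -
    obtain a b where x: "a \<in> A" "b \<in> B" "x = a \<otimes> b" using \<open>x \<in> A <#> B\<close> by (auto simp: set_mult_def)
    obtain a' b' where y: "a' \<in> A" "b' \<in> B" "y = a' \<otimes> b'" using \<open>y \<in> A <#> B\<close> by (auto simp: set_mult_def)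
    have "a \<otimes> a' = a' \<otimes> a" "b \<otimes> b' = b' \<otimes> b"
      using A B x y by (auto simp: elementary_abelian_subgroup_def)
    then show ?thesis using mult[OF x(1) y(1) x(2) y(2)] mult[OF y(1) x(1) y(2) x(2)] x(3) y(3) by simp
  qed
  moreover have "x [^] p = \<one>" if x: "x \<in> A <#> B" for x
  proof -
    obtain a b where x: "a \<in> A" "b \<in> B" "x = a \<otimes> b" using x by (auto simp: set_mult_def)
    have "a [^] p = \<one>" "b [^] p = \<one>" using A B x by (auto simp: elementary_abelian_subgroup_def)
    then show ?thesis using pow_mult_distrib[OF comm[OF x(1,2)] AG[OF x(1)] BG[OF x(2)], of p] x(3) by simp
  qed
  ultimately show ?thesis by (simp add: elementary_abelian_subgroup_def)
qed

lemma conj_nontrivial_elementary_abelian: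
  assumes g: "g \<in> carrier G" and K: "K \<in> nontrivial_elementary_abelians p G"
  shows "(\<lambda>x. g \<otimes> x \<otimes> inv g) ` K \<in> nontrivial_elementary_abelians p G"
proof -
  let ?f = "\<lambda>x. g \<otimes> x \<otimes> inv g"
  have sub: "subgroup K G" and comm: "\<And>x y. x \<in> K \<Longrightarrow> y \<in> K \<Longrightarrow> x \<otimes> y = y \<otimes> x" and pow: "\<And>x. x \<in> K \<Longrightarrow> x [^] p = \<one>" and ne: "K \<noteq> {\<one>}"
    using K by (auto simp: nontrivial_elementary_abelians_def elementary_abelian_subgroup_def)
  have KG: "x \<in> carrier G" if "x \<in> K" for x using sub that by (rule subgroup.mem_carrier)
  have hom: "?f (x \<otimes> y) = ?f x \<otimes> ?f y" if "x \<in> carrier G" "y \<in> carrier G" for x y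
    using g that by (simp add: m_assoc inv_solve_left' flip: m_assoc[of "inv g" g])
  have fhom: "group_hom G G ?f"
    using g hom by (intro group_hom.intro group_hom_axioms.intro is_group homI) auto
  have "subgroup (?f ` K) G" by (rule group_hom.subgroup_img_is_subgroup[OF fhom sub])
  moreover have "?f x \<otimes> ?f y = ?f y \<otimes> ?f x" if "x \<in> K" "y \<in> K" for x y
    using hom KG that comm[OF that] by metis
  moreover have "?f x [^] p = \<one>" if "x \<in> K" for x
    using group_hom.hom_nat_pow[OF fhom KG[OF that], of p] pow[OF that] g by simp
  moreover have "?f ` K \<noteq> {\<one>}"
  proof
    assume eq: "?f ` K = {\<one>}"
    have "x = \<one>" if "x \<in> K" for x
    proof -
      have "?f x = \<one>" using eq that by blast
      then have "?f x = ?f \<one>" using g by simp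
      then show ?thesis using g KG[OF that] by (simp only: right_cancel Units_l_cancel Units_eq inv_closed m_closed one_closed)
    qed
    then show False using ne subgroup.one_closed[OF sub] by blast
  qed
  ultimately show ?thesis by (auto simp: nontrivial_elementary_abelians_def elementary_abelian_subgroup_def)
qed

lemma subgroup_centralizer:
  assumes P: "P \<subseteq> carrier G" shows "subgroup (centralizer G P) G"
proof (rule subgroupI)
  have "\<one> \<in> centralizer G P" using P by (auto simp: centralizer_def)
  then show "centralizer G P \<noteq> {}" by blast
next
  fix a assume "a \<in> centralizer G P"
  then show "inv a \<in> centralizer G P" using P unfolding centralizer_def by (blast intro: inv_commute)
next
  fix a b assume "a \<in> centralizer G P" "b \<in> centralizer G P"
  then show "a \<otimes> b \<in> centralizer G P" using P unfolding centralizer_def by (blast intro: mult_commute)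
qed (auto simp: centralizer_def)

end

section \<open>Contractibility\<close>

context fixed_chain_model begin

text \<open>The orbit space is reached from the disjoint union of simplices by composing two
  quotient maps, so the argument on representatives serves both spaces.\<close>

lemma fixed_and_orbit_space_contractible:
  assumes \<kappa>: "\<And>y. y \<in> YP \<Longrightarrow> \<kappa> y \<in> YP"
      "\<And>y y'. \<lbrakk>y \<in> YP; y' \<in> YP; R y y'\<rbrakk> \<Longrightarrow> R (\<kappa> y) (\<kappa> y')" "\<And>y y'. \<lbrakk>y \<in> YP; y' \<in> YP; R y y'\<rbrakk> \<Longrightarrow> R (\<kappa> y) y'"
      "\<And>g y. \<lbrakk>g \<in> centralizer G P; y \<in> YP\<rbrakk> \<Longrightarrow> \<kappa> (act g y) = act g (\<kappa> y)"
    and y0: "y0 \<in> YP" "R y0 y0" "\<And>y. y \<in> YP \<Longrightarrow> R (\<kappa> y) y0" "\<And>g. g \<in> centralizer G P \<Longrightarrow> act g y0 = y0"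
  shows "nonempty_contractible (fixed_point_space P (realization_act X) (realization X))"
    and "nonempty_contractible (orbit_space (G\<lparr>carrier := centralizer G P\<rparr>) (realization_act X)
      (fixed_point_space P (realization_act X) (realization X)))"
proof -
  let ?C = "centralizer G P" and ?FP = "fixed_point_space P (realization_act X) (realization X)"
  let ?orb = "orbit (G\<lparr>carrier := ?C\<rparr>) (realization_act X)"
  have FP: "?FP = subtopology (realization X) XP" by (simp add: fixed_point_space_def XP_def)
  have C: "subgroup ?C G" by (rule subgroup_centralizer[OF P_sub])
  have one: "{\<one>\<^bsub>G\<^esub>} \<subseteq> ?C" using subgroup.one_closed[OF C] by simp
  show "nonempty_contractible ?FP"
  proof (rule cone_contractible[where D = "{\<one>\<^bsub>G\<^esub>}" and q = "simplex_class X" and \<kappa> = \<kappa> and ?y0.0 = y0])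
    show "subgroup {\<one>\<^bsub>G\<^esub>} G" by (rule triv_subgroup)
    show "quotient_map (subtopology (simplex_space X) pre_XP) ?FP (simplex_class X)"
      unfolding FP by (rule quotient_map_pre_XP)
    show "simplex_class X z = simplex_class X z' \<longleftrightarrow> (\<exists>g\<in>{\<one>\<^bsub>G\<^esub>}. simplex_class X (point_act g z) = simplex_class X z')"
      if "z \<in> pre_XP" for z z' using that pre_XP_sub point_act_one[of z] by auto
  qed (use \<kappa> y0 one in auto)
  show "nonempty_contractible (orbit_space (G\<lparr>carrier := ?C\<rparr>) (realization_act X) ?FP)"
  proof (rule cone_contractible[where D = ?C and q = "?orb \<circ> simplex_class X" and \<kappa> = \<kappa> and ?y0.0 = y0])
    show "quotient_map (subtopology (simplex_space X) pre_XP) (orbit_space (G\<lparr>carrier := ?C\<rparr>) (realization_act X) ?FP) (?orb \<circ> simplex_class X)"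
      unfolding FP orbit_space_def by (rule quotient_map_compose[OF quotient_map_pre_XP quotient_map_quotient_topology])
  next
    fix z z' assume z: "z \<in> pre_XP" "z' \<in> pre_XP"
    have zT: "z \<in> topspace (simplex_space X)" "z' \<in> topspace (simplex_space X)" using z pre_XP_sub by auto
    have CG: "g \<in> carrier G" if "g \<in> ?C" for g using C that by (rule subgroup.mem_carrier)
    have orb: "?orb (simplex_class X w) = {simplex_class X (point_act g w) |g. g \<in> ?C}"
      if "w \<in> topspace (simplex_space X)" for w
      using realization_act_class[OF CG that] by (auto simp: orbit_def)
    show "(?orb \<circ> simplex_class X) z = (?orb \<circ> simplex_class X) z' \<longleftrightarrow> (\<exists>g\<in>?C. simplex_class X (point_act g z) = simplex_class X z')"
    proof
      assume "(?orb \<circ> simplex_class X) z = (?orb \<circ> simplex_class X) z'"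
      then have eq: "{simplex_class X (point_act g z) |g. g \<in> ?C} = {simplex_class X (point_act g z') |g. g \<in> ?C}"
        using orb zT by simp
      have "simplex_class X z' = simplex_class X (point_act \<one>\<^bsub>G\<^esub> z')" by (simp only: point_act_one[OF zT(2)])
      then have "simplex_class X z' \<in> {simplex_class X (point_act g z') |g. g \<in> ?C}" using one by blast
      then show "\<exists>g\<in>?C. simplex_class X (point_act g z) = simplex_class X z'" unfolding eq[symmetric] by auto
    next
      assume "\<exists>g\<in>?C. simplex_class X (point_act g z) = simplex_class X z'"
      then obtain g where g: "g \<in> ?C" and gz: "simplex_class X (point_act g z) = simplex_class X z'" by blast
      \<comment> \<open>The centralizer is closed under right multiplication by \<open>g\<close> and
        by its inverse, which turns the orbit of one point into that of the other.\<close>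
      have 1: "simplex_class X (point_act h z') = simplex_class X (point_act (h \<otimes>\<^bsub>G\<^esub> g) z)" if "h \<in> ?C" for h
        using point_act_class[OF CG[OF that] gz] point_act_mult[OF CG[OF that] CG[OF g] zT(1)] by simp
      have 2: "simplex_class X (point_act h z) = simplex_class X (point_act (h \<otimes>\<^bsub>G\<^esub> inv\<^bsub>G\<^esub> g) z')" if "h \<in> ?C" for h
        using 1[OF subgroup.m_closed[OF C that subgroup.m_inv_closed[OF C g]]] CG[OF that] CG[OF g] by (simp add: m_assoc)
      have "{simplex_class X (point_act g z) |g. g \<in> ?C} = {simplex_class X (point_act g z') |g. g \<in> ?C}"
        using 1 2 subgroup.m_closed[OF C _ g] subgroup.m_closed[OF C _ subgroup.m_inv_closed[OF C g]] by blast
      then show "(?orb \<circ> simplex_class X) z = (?orb \<circ> simplex_class X) z'" using orb zT by simp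
    qed
  qed (use \<kappa> y0 C in auto)
qed

end

definition embedding_image :: "'a monoid \<times> ('a \<Rightarrow> 'a) \<Rightarrow> 'a set" where
  "embedding_image y = snd y ` carrier (fst y)"

lemma image_ge_iff: "image_ge y y' \<longleftrightarrow> embedding_image y' \<subseteq> embedding_image y"
  by (simp add: image_ge_def embedding_image_def)

context group begin

text \<open>The subgroup is repackaged as a plain \<open>monoid\<close> record, because the objects
  of the conjugacy category carry no further record fields.\<close>

definition inclusion :: "'a set \<Rightarrow> 'a monoid \<times> ('a \<Rightarrow> 'a)" where
  "inclusion K = (\<lparr>carrier = K, monoid.mult = (\<otimes>), one = \<one>\<rparr>, \<lambda>x\<in>K. x)"

lemma embedding_image_inclusion [simp]: "embedding_image (inclusion K) = K"
  by (auto simp: embedding_image_def inclusion_def)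

lemma inclusion_embedding:
  assumes K: "subgroup K G" "K \<in> \<E>" shows "inclusion K \<in> embeddings G \<E>"
proof -
  have "group \<lparr>carrier = K, monoid.mult = (\<otimes>), one = \<one>\<rparr>"
  proof (rule groupI)
    fix x assume "x \<in> carrier \<lparr>carrier = K, monoid.mult = (\<otimes>), one = \<one>\<rparr>"
    then show "\<exists>y\<in>carrier \<lparr>carrier = K, monoid.mult = (\<otimes>), one = \<one>\<rparr>.
        y \<otimes>\<^bsub>\<lparr>carrier = K, monoid.mult = (\<otimes>), one = \<one>\<rparr>\<^esub> x = \<one>\<^bsub>\<lparr>carrier = K, monoid.mult = (\<otimes>), one = \<one>\<rparr>\<^esub>"
      using subgroup.m_inv_closed[OF K(1)] subgroup.mem_carrier[OF K(1)] by (auto intro!: bexI[of _ "inv x"])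
  qed (use subgroup.m_closed[OF K(1)] subgroup.one_closed[OF K(1)] subgroup.mem_carrier[OF K(1)] in \<open>auto simp: m_assoc\<close>)
  then show ?thesis
    using subgroup.mem_carrier[OF K(1)] subgroup.m_closed[OF K(1)] K(2)
    by (auto simp: embeddings_def inclusion_def mon_def hom_def)
qed

text \<open>The action keeps the source group, so being fixed is an equality of maps: conjugation by
  \<open>g\<close> fixes the image pointwise and not merely as a set. Hence centralizers appear, and
  not normalizers.\<close>

lemma embedding_act_fixed_iff:
  assumes y: "y \<in> embeddings G \<E>" and g: "g \<in> carrier G"
  shows "embedding_act G g y = y \<longleftrightarrow> (\<forall>x\<in>embedding_image y. g \<otimes> x = x \<otimes> g)"
proof -
  have yc: "snd y h \<in> carrier G" if "h \<in> carrier (fst y)" for h using embeddingsD(6)[OF y] that by blast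
  have "embedding_act G g y = y \<longleftrightarrow> conj_map G (fst y) g (snd y) = snd y"
    by (simp add: embedding_act_def prod_eq_iff)
  also have "\<dots> \<longleftrightarrow> (\<forall>h\<in>carrier (fst y). g \<otimes> snd y h \<otimes> inv g = snd y h)"
    using embeddingsD(4)[OF y] by (auto simp: conj_map_def fun_eq_iff extensional_def)
  also have "\<dots> \<longleftrightarrow> (\<forall>h\<in>carrier (fst y). g \<otimes> snd y h = snd y h \<otimes> g)"
    using g yc by (intro ball_cong refl) (simp add: inv_solve_right')
  finally show ?thesis by (simp add: embedding_image_def)
qed

section \<open>The equivariant cone on the embeddings fixed by P\<close>

context
  fixes p :: nat and P :: "'a set"
  assumes p: "prime p" and P: "finite_p_subgroup p P G" and P_ne: "P \<noteq> {\<one>}"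
begin

private abbreviation "E \<equiv> nontrivial_elementary_abelians p G"
private abbreviation "Z \<equiv> central_torsion p P"
private abbreviation "C \<equiv> centralizer G P"

private lemma P_sub: "subgroup P G" "P \<subseteq> carrier G"
  using P subgroup.subset by (auto simp: finite_p_subgroup_def)

private lemma C_sub: "subgroup C G"
  by (rule subgroup_centralizer[OF P_sub(2)])

private lemma CG: "g \<in> C \<Longrightarrow> g \<in> carrier G"
  by (simp add: centralizer_def)

private lemma Z_in: "Z \<in> E"
  using central_torsion_nontrivial[OF p P P_ne] elementary_abelian_central_torsion[OF P_sub(1)]
  by (simp add: nontrivial_elementary_abelians_def)

private lemma E_sub: "K \<in> E \<Longrightarrow> subgroup K G"
  by (simp add: nontrivial_elementary_abelians_def elementary_abelian_subgroup_def)

private lemma Z_C: "z \<in> Z \<Longrightarrow> z \<in> C"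
  using P_sub(2) by (auto simp: central_torsion_def centralizer_def)

private lemma Z_comm: "z \<in> Z \<Longrightarrow> g \<in> C \<Longrightarrow> g \<otimes> z = z \<otimes> g"
  by (simp add: central_torsion_def centralizer_def)

private lemma fixed_model:
  "fixed_chain_model G (dwyer_sset G E) (embeddings G E) image_ge (embedding_act G) (dwyer_simplex G) P"
proof (intro fixed_chain_model.intro fixed_chain_model_axioms.intro P_sub(2))
  show "chain_model G (dwyer_sset G E) (embeddings G E) image_ge (embedding_act G) (dwyer_simplex G)"
    by (rule chain_model_dwyer[OF conj_nontrivial_elementary_abelian])
next
  fix y y' g assume y: "y \<in> embeddings G E" "y' \<in> embeddings G E" "image_ge y y'" and fixed: "\<forall>g\<in>P. embedding_act G g y = y"
    and g: "g \<in> P"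
  have gG: "g \<in> carrier G" using g P_sub(2) by blast
  show "embedding_act G g y' = y'"
    using fixed g y(3) unfolding embedding_act_fixed_iff[OF y(2) gG] image_ge_iff
    using embedding_act_fixed_iff[OF y(1) gG] by blast
qed

interpretation F: fixed_chain_model G "dwyer_sset G E" "embeddings G E" image_ge "embedding_act G" "dwyer_simplex G" P
  by (rule fixed_model)

private lemma YP_iff: "y \<in> F.YP \<longleftrightarrow> y \<in> embeddings G E \<and> embedding_image y \<subseteq> C"
proof -
  have "(\<forall>g\<in>P. embedding_act G g y = y) \<longleftrightarrow> embedding_image y \<subseteq> C" if y: "y \<in> embeddings G E"
  proof -
    have im: "x \<in> carrier G" if "x \<in> embedding_image y" for x
      using embeddingsD(6)[OF y] that by (auto simp: embedding_image_def)
    have "(\<forall>g\<in>P. embedding_act G g y = y) \<longleftrightarrow> (\<forall>g\<in>P. \<forall>x\<in>embedding_image y. g \<otimes> x = x \<otimes> g)"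
      using embedding_act_fixed_iff[OF y] P_sub(2) by (intro ball_cong refl) blast
    also have "\<dots> \<longleftrightarrow> (\<forall>x\<in>embedding_image y. \<forall>g\<in>P. x \<otimes> g = g \<otimes> x)" by (auto dest: bspec sym)
    also have "\<dots> \<longleftrightarrow> embedding_image y \<subseteq> C" using im unfolding centralizer_def by blast
    finally show ?thesis .
  qed
  then show ?thesis by (auto simp: F.YP_def)
qed

private lemma image_E: "y \<in> F.YP \<Longrightarrow> embedding_image y \<in> E"
  unfolding YP_iff embedding_image_def by (rule embeddingsD(5)) (erule conjunct1)

private lemma act_YP: "g \<in> C \<Longrightarrow> y \<in> F.YP \<Longrightarrow> embedding_act G g y \<in> F.YP"
proof -
  assume g: "g \<in> C" and y: "y \<in> F.YP"
  then have yE: "y \<in> embeddings G E" and im: "embedding_image y \<subseteq> C" by (auto simp: YP_iff)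
  have "embedding_image (embedding_act G g y) = (\<lambda>x. g \<otimes> x \<otimes> inv g) ` embedding_image y"
    by (auto simp: embedding_image_def embedding_act_def conj_map_def image_image)
  then have "embedding_image (embedding_act G g y) \<subseteq> C"
    using im subgroup.m_closed[OF C_sub] subgroup.m_inv_closed[OF C_sub] g by auto
  then show ?thesis using F.act_closed[OF CG[OF g] yE] by (simp add: YP_iff)
qed

text \<open>For an embedding \<open>i\<close> of \<open>H\<close> the map \<open>enlarge\<close> below embeds a group isomorphic to \<open>i(H) Z\<close>. To be
  equivariant, that group may only depend on the \<open>C\<close>-orbit of \<open>i\<close>, so it is built from a chosen
  representative \<open>r\<close> of the orbit and transported back along some \<open>g\<close> with \<open>g r g\<inverse> = i\<close>.\<close>

private definition rep :: "'a monoid \<times> ('a \<Rightarrow> 'a) \<Rightarrow> 'a monoid \<times> ('a \<Rightarrow> 'a)" where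
  "rep y = (SOME r. r \<in> (\<lambda>g. embedding_act G g y) ` C)"

private definition transport :: "'a monoid \<times> ('a \<Rightarrow> 'a) \<Rightarrow> 'a" where
  "transport y = (SOME g. g \<in> C \<and> embedding_act G g (rep y) = y)"

private definition enlarge :: "'a monoid \<times> ('a \<Rightarrow> 'a) \<Rightarrow> 'a monoid \<times> ('a \<Rightarrow> 'a)" where
  "enlarge y = embedding_act G (transport y) (inclusion (embedding_image (rep y) <#> Z))"

private lemma rep:
  assumes y: "y \<in> F.YP"
  shows "rep y \<in> F.YP" "transport y \<in> C" "embedding_act G (transport y) (rep y) = y"
proof -
  have yE: "y \<in> embeddings G E" using y by (simp add: YP_iff)
  have "rep y \<in> (\<lambda>g. embedding_act G g y) ` C"
    unfolding rep_def by (rule someI[of _ "embedding_act G \<one> y"]) (use subgroup.one_closed[OF C_sub] in blast)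
  then obtain h where h: "h \<in> C" "rep y = embedding_act G h y" by blast
  then show "rep y \<in> F.YP" using act_YP y by simp
  have "inv h \<in> C \<and> embedding_act G (inv h) (rep y) = y"
    using h CG[OF h(1)] subgroup.m_inv_closed[OF C_sub] yE by (simp add: F.act_mult F.act_one)
  then have "transport y \<in> C \<and> embedding_act G (transport y) (rep y) = y"
    unfolding transport_def by (rule someI[of _ "inv h"])
  then show "transport y \<in> C" "embedding_act G (transport y) (rep y) = y" by auto
qed

text \<open>\<open>rep\<close> chooses from the orbit as a set, and translating by \<open>h\<close>
  does not change that set.\<close>

private lemma rep_act:
  assumes h: "h \<in> C" and y: "y \<in> F.YP" shows "rep (embedding_act G h y) = rep y"
proof -
  have yE: "y \<in> embeddings G E" using y by (simp add: YP_iff)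
  have "(\<lambda>g. embedding_act G g (embedding_act G h y)) ` C = (\<lambda>g. embedding_act G g y) ` C"
  proof (intro subset_antisym subsetI)
    fix w assume "w \<in> (\<lambda>g. embedding_act G g (embedding_act G h y)) ` C"
    then obtain g where g: "g \<in> C" "w = embedding_act G g (embedding_act G h y)" by blast
    then have "w = embedding_act G (g \<otimes> h) y" using h CG yE by (simp add: F.act_mult)
    then show "w \<in> (\<lambda>g. embedding_act G g y) ` C" using subgroup.m_closed[OF C_sub g(1) h] by blast
  next
    fix w assume "w \<in> (\<lambda>g. embedding_act G g y) ` C"
    then obtain g where g: "g \<in> C" "w = embedding_act G g y" by blast
    then have "w = embedding_act G (g \<otimes> inv h) (embedding_act G h y)"
      using CG[OF h] CG[OF g(1)] yE by (simp add: F.act_mult m_assoc)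
    then show "w \<in> (\<lambda>g. embedding_act G g (embedding_act G h y)) ` C"
      using subgroup.m_closed[OF C_sub g(1) subgroup.m_inv_closed[OF C_sub h]] by blast
  qed
  then show ?thesis by (simp only: rep_def)
qed

text \<open>\<open>Z\<close> lies in \<open>P\<close>, so \<open>A\<close>, which centralizes
  \<open>P\<close>, commutes with \<open>Z\<close>. The product stays in \<open>C\<close> because
  \<open>Z\<close> is central in \<open>P\<close>.\<close>

private lemma set_mult_Z:
  assumes A: "A \<in> E" "A \<subseteq> C" shows "A <#> Z \<in> E" "A <#> Z \<subseteq> C" "A \<subseteq> A <#> Z" "Z \<subseteq> A <#> Z"
proof -
  have sA: "subgroup A G" and sZ: "subgroup Z G" using A(1) Z_in by (auto intro: E_sub)
  show s: "A \<subseteq> A <#> Z"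
    using subgroup.one_closed[OF sZ] subgroup.mem_carrier[OF sA] unfolding set_mult_def by force
  show "Z \<subseteq> A <#> Z"
    using subgroup.one_closed[OF sA] subgroup.mem_carrier[OF sZ] unfolding set_mult_def by force
  show "A <#> Z \<subseteq> C" using A(2) Z_C subgroup.m_closed[OF C_sub] by (auto simp: set_mult_def)
  have "elementary_abelian_subgroup p (A <#> Z) G"
    by (rule elementary_abelian_set_mult) (use A Z_in Z_comm in \<open>auto simp: nontrivial_elementary_abelians_def\<close>)
  moreover have "A <#> Z \<noteq> {\<one>}"
    using s subgroup.one_closed[OF sA] A(1) by (auto simp: nontrivial_elementary_abelians_def)
  ultimately show "A <#> Z \<in> E" by (simp add: nontrivial_elementary_abelians_def)
qed

private lemma conj_mult_Z:
  assumes "g \<in> C" "x \<in> carrier G" "z \<in> Z"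
  shows "g \<otimes> (x \<otimes> z) \<otimes> inv g = (g \<otimes> x \<otimes> inv g) \<otimes> z"
proof -
  have c: "g \<in> carrier G" "z \<in> carrier G" using assms CG Z_C by auto
  have "inv g \<otimes> z = z \<otimes> inv g" by (rule inv_commute[OF Z_comm[OF assms(3,1)] c])
  then show ?thesis using c assms(2) by (simp add: m_assoc)
qed

text \<open>Conjugation by \<open>transport y\<close> carries the image of the representative to
  that of \<open>y\<close> and fixes \<open>Z\<close> pointwise, so the choices leave no trace in
  the image.\<close>

private lemma enlarge_image:
  assumes y: "y \<in> F.YP" shows "embedding_image (enlarge y) = embedding_image y <#> Z"
proof -
  let ?A = "embedding_image (rep y)" and ?g = "transport y"
  have AG: "?A \<subseteq> carrier G" using E_sub[OF image_E[OF rep(1)[OF y]]] by (rule subgroup.subset)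
  have "embedding_image (enlarge y) = (\<lambda>x. ?g \<otimes> x \<otimes> inv ?g) ` (?A <#> Z)"
    by (auto simp: enlarge_def embedding_image_def embedding_act_def inclusion_def conj_map_def image_def)
  also have "\<dots> = (\<lambda>x. ?g \<otimes> x \<otimes> inv ?g) ` ?A <#> Z"
    using conj_mult_Z[OF rep(2)[OF y]] AG by (auto simp: set_mult_def image_UN subset_iff)
  also have "(\<lambda>x. ?g \<otimes> x \<otimes> inv ?g) ` ?A = embedding_image (embedding_act G ?g (rep y))"
    by (auto simp: embedding_image_def embedding_act_def conj_map_def image_image)
  finally show ?thesis by (simp add: rep(3)[OF y])
qed

private lemma enlarge_YP:
  assumes y: "y \<in> F.YP" shows "enlarge y \<in> F.YP"
proof -
  have "embedding_image (rep y) <#> Z \<in> E"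
    using set_mult_Z(1)[OF image_E[OF rep(1)[OF y]]] rep(1)[OF y] by (simp add: YP_iff)
  then have "enlarge y \<in> embeddings G E"
    unfolding enlarge_def using F.act_closed[OF CG[OF rep(2)[OF y]] inclusion_embedding] E_sub by blast
  moreover have "embedding_image (enlarge y) \<subseteq> C"
    unfolding enlarge_image[OF y] using set_mult_Z(2)[OF image_E[OF y]] y by (simp add: YP_iff)
  ultimately show ?thesis by (simp add: YP_iff)
qed

text \<open>The transporter of the translate and \<open>h\<close> times the transporter of
  \<open>y\<close> may differ by an element of \<open>C\<close> fixing \<open>rep y\<close>. Such an
  element centralizes the image of \<open>rep y\<close> as well as \<open>Z\<close>, so the two
  conjugations agree on the product.\<close>

private lemma enlarge_act:
  assumes h: "h \<in> C" and y: "y \<in> F.YP"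
  shows "enlarge (embedding_act G h y) = embedding_act G h (enlarge y)"
proof -
  let ?A = "embedding_image (rep y)" and ?y = "embedding_act G h y"
  let ?g = "transport y" and ?g' = "transport ?y"
  have yh: "?y \<in> F.YP" by (rule act_YP[OF h y])
  have ryE: "rep y \<in> embeddings G E" using rep(1)[OF y] by (simp add: YP_iff)
  note c = CG[OF h] CG[OF rep(2)[OF y]] CG[OF rep(2)[OF yh]]
  have K: "?A <#> Z \<in> E" using set_mult_Z(1)[OF image_E[OF rep(1)[OF y]]] rep(1)[OF y] by (simp add: YP_iff)
  have AG: "x \<in> carrier G" if "x \<in> ?A" for x
    using E_sub[OF image_E[OF rep(1)[OF y]]] that by (rule subgroup.mem_carrier)
  have "embedding_act G ?g' (rep y) = embedding_act G (h \<otimes> ?g) (rep y)"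
    using rep(3)[OF yh] rep(3)[OF y] c ryE by (simp add: rep_act[OF h y] flip: F.act_mult)
  then have eq: "conj_map G (fst (rep y)) ?g' (snd (rep y)) a = conj_map G (fst (rep y)) (h \<otimes> ?g) (snd (rep y)) a" for a
    by (simp add: embedding_act_def)
  then have A: "?g' \<otimes> x \<otimes> inv ?g' = (h \<otimes> ?g) \<otimes> x \<otimes> inv (h \<otimes> ?g)" if "x \<in> ?A" for x
  proof -
    obtain a where a: "a \<in> carrier (fst (rep y))" "x = snd (rep y) a" using \<open>x \<in> ?A\<close> by (auto simp: embedding_image_def)
    then show ?thesis using eq[of a] by (simp add: conj_map_def)
  qed
  have hg: "h \<otimes> ?g \<in> C" using subgroup.m_closed[OF C_sub h rep(2)[OF y]] .
  have "?g' \<otimes> x \<otimes> inv ?g' = (h \<otimes> ?g) \<otimes> x \<otimes> inv (h \<otimes> ?g)" if x: "x \<in> ?A <#> Z" for x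
  proof -
    obtain a z where "a \<in> ?A" "z \<in> Z" "x = a \<otimes> z" using x by (auto simp: set_mult_def)
    then show ?thesis using conj_mult_Z[OF rep(2)[OF yh] AG, of a z] conj_mult_Z[OF hg AG, of a z] A[of a] by simp
  qed
  then have "embedding_act G ?g' (inclusion (?A <#> Z)) = embedding_act G (h \<otimes> ?g) (inclusion (?A <#> Z))"
    by (auto simp: embedding_act_def inclusion_def conj_map_def intro!: restrict_ext)
  also have "\<dots> = embedding_act G h (enlarge y)"
    unfolding enlarge_def using c inclusion_embedding[OF E_sub[OF K] K] by (simp add: F.act_mult)
  finally show ?thesis by (simp add: enlarge_def[of ?y] rep_act[OF h y])
qed

lemma dwyer_fixed_and_orbit_space_contractible:
  "nonempty_contractible (fixed_point_space P (dwyer_act G E) (dwyer_space G E))"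
  "nonempty_contractible (orbit_space (G\<lparr>carrier := C\<rparr>) (dwyer_act G E) (fixed_point_space P (dwyer_act G E) (dwyer_space G E)))"
proof -
  have C1: "\<And>y. y \<in> F.YP \<Longrightarrow> enlarge y \<in> F.YP" by (rule enlarge_YP)
  have C2: "image_ge (enlarge y) (enlarge y')" if "y \<in> F.YP" "y' \<in> F.YP" "image_ge y y'" for y y'
    using that unfolding image_ge_iff enlarge_image[OF that(1)] enlarge_image[OF that(2)] by (intro mono_set_mult) auto
  have im: "embedding_image y \<subseteq> embedding_image (enlarge y)" "Z \<subseteq> embedding_image (enlarge y)" if "y \<in> F.YP" for y
    using set_mult_Z(3,4)[OF image_E[OF that]] that unfolding enlarge_image[OF that] by (simp_all add: YP_iff)
  have C3: "image_ge (enlarge y) y'" if "y \<in> F.YP" "y' \<in> F.YP" "image_ge y y'" for y y'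
    using im(1)[OF that(1)] that(3) by (auto simp: image_ge_iff)
  have ZY: "inclusion Z \<in> embeddings G E" by (rule inclusion_embedding[OF E_sub[OF Z_in] Z_in])
  have Y1: "inclusion Z \<in> F.YP" using ZY Z_C by (auto simp: YP_iff)
  have Y2: "image_ge (inclusion Z) (inclusion Z)" by (simp add: image_ge_iff)
  have Y3: "image_ge (enlarge y) (inclusion Z)" if "y \<in> F.YP" for y using im(2)[OF that] by (simp add: image_ge_iff)
  \<comment> \<open>The apex is fixed as an embedding, since \<open>C\<close> centralizes
    \<open>P\<close> and hence commutes with \<open>Z\<close> elementwise.\<close>
  have Y4: "embedding_act G g (inclusion Z) = inclusion Z" if "g \<in> C" for g
    using embedding_act_fixed_iff[OF ZY CG[OF that]] Z_comm[OF _ that] by simp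
  show "nonempty_contractible (fixed_point_space P (dwyer_act G E) (dwyer_space G E))"
    "nonempty_contractible (orbit_space (G\<lparr>carrier := C\<rparr>) (dwyer_act G E) (fixed_point_space P (dwyer_act G E) (dwyer_space G E)))"
    unfolding dwyer_act_def dwyer_space_def
    using F.fixed_and_orbit_space_contractible[where \<kappa> = enlarge, OF C1 C2 C3 enlarge_act Y1 Y2 Y3 Y4] by blast+
qed

end

end

theorem proposition6p7:
  fixes G :: "('a, 'b) monoid_scheme" and p :: nat and P :: "'a set"
  assumes "group G"
    and "prime p"
    and "finite_p_subgroup p P G" and "P \<noteq> {\<one>\<^bsub>G\<^esub>}"
  shows "let \<E> = nontrivial_elementary_abelians p G;
             XP = fixed_point_space P (dwyer_act G \<E>) (dwyer_space G \<E>)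
         in nonempty_contractible XP \<and>
            nonempty_contractible
              (orbit_space (G\<lparr>carrier := centralizer G P\<rparr>) (dwyer_act G \<E>) XP)"
  unfolding Let_def using group.dwyer_fixed_and_orbit_space_contractible[OF assms] by blast

end
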